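(* For every $n\geq 1$ and all nonnegative integers $a,b,c$ with $a+b+c=n$, polyhedral orientations with $n$ inner vertices, among which $a$ are red, $b$ are blue and $c$ are green, are in bijection with $P$-admissible bipolar orientations with $n+1$ edges, $a+1$ white vertices, $b+1$ black vertices, and $c$ inner faces.
   Context: Maps. A planar map is a connected multigraph embedded on the oriented sphere, considered up to orientation-preserving homeomorphism. It is rooted by marking a corner; the face incident to that corner is the outer face, and its vertex is the root-vertex. Vertices and edges incident to the outer face are called outer, the others inner; the faces other than the outer face are inner. A corner at a vertex $v$ is a triple $(v,e_1,e_2)$ with $e_1,e_2$ consecutive edges around $v$; it lies in a unique face. Polyhedral orientations. A triangulation is a planar map (multiple edges allowed) all of whose faces have degree 3. It is Eulerian if all vertices have even degree; then its faces are uniquely bicolored light/dark so that each edge has one light and one dark side and the outer face is light. An Eulerian triangulation is uniquely properly vertex-3-colorable once the colors on one triangle are fixed; in a rooted one, the convention is that the root-vertex is red and the outer vertices are red, green, blue in clockwise order around the outer face (walking along the outer contour with the outer face on the left). In an orientation of a planar map, a corner $(v,e_1,e_2)$ is lateral if exactly one of $e_1,e_2$ is ingoing at $v$, and extremal otherwise. A polyhedral orientation is a rooted Eulerian triangulation endowed with an orientation of its edges such that: (PO1) there is no extremal corner at the outer vertices, and the outer contour is a clockwise directed cycle (the outer face is on its left); (PO2) every inner vertex is incident to exactly two extremal corners, and all the extremal corners are incident to light faces. Plane bipolar orientations. A plane bipolar orientation is a rooted planar map endowed with an acyclic orientation having a unique source $S$, located at the root-vertex, and a unique sink $N$, which is incident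 to the outer face. The contour of each inner face $f$ is then partitioned into a left lateral path (the one having $f$ on its right) and a right lateral path (the one having $f$ on its left), both directed from the bottom vertex of $f$ to the top vertex of $f$. The type of $f$ is the pair $(i,j)$ such that the left (resp. right) lateral path of $f$ has length $i+1$ (resp. $j+1$). The outer type is the pair $(i,j)$ such that the left outer boundary (directed path of outer edges from $S$ to $N$ with the outer face on its left) has length $i+1$ and the right outer boundary (from $S$ to $N$ with the outer face on its right) has length $j+1$. If the underlying map is bipartite, its vertices are bicolored black/white so that $N$ is white; an inner face is called blacktip (resp. whitetip) if its top vertex is black (resp. white). A bipartite plane bipolar orientation is called $P$-admissible if (PA1) it has outer type $(0,k)$ for some even $k\geq 2$, and (PA2) the type $(i,j)$ of every blacktip (resp. whitetip) inner face satisfies $i\geq 1$ (resp. $j\geq 1$). *)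

theory Defs
  imports "HOL-Combinatorics.Orbits"
begin

section \<open>Rooted planar maps\<close>

text \<open>
  A map on the oriented sphere is encoded by its darts (half-edges).  A dart points away from
  its origin; \<open>succ d\<close> is the next dart in counterclockwise order around the origin of \<open>d\<close>, and
  \<open>opp d\<close> is the other half of the edge of \<open>d\<close>.  Vertices are the orbits of \<open>succ\<close>.

  Walking along \<open>d\<close> with a face on the left, the next dart of that walk is the clockwise neighbour
  of \<open>opp d\<close>; so faces are the orbits of \<open>inv succ \<circ> opp\<close>, and \<open>face_of m d\<close> is the face to the
  left of \<open>d\<close>, while \<open>face_of m (opp d)\<close> is the face to its right.

  The corners are in bijection with the darts: \<open>d\<close> stands for the corner at the origin of \<open>d\<close>
  between \<open>d\<close> and \<open>succ d\<close>, which lies in the face to the left of \<open>d\<close>.  In particular \<open>root m\<close>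
  is the root corner, and \<open>root m\<close> read as a dart has the outer face on its left.
\<close>

record 'd rooted_map =
  darts :: "'d set"
  succ :: "'d \<Rightarrow> 'd"
  opp :: "'d \<Rightarrow> 'd"
  root :: 'd

definition vertex_of :: "('d, 'z) rooted_map_scheme \<Rightarrow> 'd \<Rightarrow> 'd set" where
  "vertex_of m d = orbit (succ m) d"

definition next_in_face :: "('d, 'z) rooted_map_scheme \<Rightarrow> 'd \<Rightarrow> 'd" where
  "next_in_face m = inv (succ m) \<circ> opp m"

definition face_of :: "('d, 'z) rooted_map_scheme \<Rightarrow> 'd \<Rightarrow> 'd set" where
  "face_of m d = orbit (next_in_face m) d"

definition vertices :: "('d, 'z) rooted_map_scheme \<Rightarrow> 'd set set" where
  "vertices m = vertex_of m ` darts m"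

definition edges :: "('d, 'z) rooted_map_scheme \<Rightarrow> 'd set set" where
  "edges m = (\<lambda>d. {d, opp m d}) ` darts m"

definition faces :: "('d, 'z) rooted_map_scheme \<Rightarrow> 'd set set" where
  "faces m = face_of m ` darts m"

definition map_connected :: "('d, 'z) rooted_map_scheme \<Rightarrow> bool" where
  "map_connected m \<longleftrightarrow>
     (\<forall>x\<in>darts m. \<forall>y\<in>darts m.
        (x, y) \<in> ({(d, succ m d) |d. d \<in> darts m} \<union> {(d, opp m d) |d. d \<in> darts m})\<^sup>*)"

text \<open>
  A connected combinatorial map describes an embedding on the sphere exactly when its Euler
  characteristic is 2.  The map with one vertex and no edge has no dart and is not represented; it
  is not a triangulation, and it has no outer type.
\<close>

definition rooted_planar_map :: "('d, 'z) rooted_map_scheme \<Rightarrow> bool" where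
  "rooted_planar_map m \<longleftrightarrow>
     finite (darts m) \<and> root m \<in> darts m \<and>
     succ m permutes darts m \<and> opp m permutes darts m \<and>
     (\<forall>d\<in>darts m. opp m d \<noteq> d \<and> opp m (opp m d) = d) \<and>
     map_connected m \<and>
     card (vertices m) + card (faces m) = card (edges m) + 2"

definition root_vertex :: "('d, 'z) rooted_map_scheme \<Rightarrow> 'd set" where
  "root_vertex m = vertex_of m (root m)"

definition outer_face :: "('d, 'z) rooted_map_scheme \<Rightarrow> 'd set" where
  "outer_face m = face_of m (root m)"

definition inner_faces :: "('d, 'z) rooted_map_scheme \<Rightarrow> 'd set set" where
  "inner_faces m = faces m - {outer_face m}"

definition outer_vertices :: "('d, 'z) rooted_map_scheme \<Rightarrow> 'd set set" where
  "outer_vertices m = vertex_of m ` outer_face m"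

definition inner_vertices :: "('d, 'z) rooted_map_scheme \<Rightarrow> 'd set set" where
  "inner_vertices m = vertices m - outer_vertices m"


section \<open>Orientations\<close>

text \<open>
  An orientation is given by the set \<open>outs\<close> of darts that are outgoing at their origin: for each
  edge, the one of its two darts that traverses it in the direction of the edge.
\<close>

record 'd oriented_map = "'d rooted_map" +
  outs :: "'d set"

definition orientation :: "('d, 'z) oriented_map_scheme \<Rightarrow> bool" where
  "orientation m \<longleftrightarrow>
     outs m \<subseteq> darts m \<and> (\<forall>d\<in>darts m. (d \<in> outs m) \<noteq> (opp m d \<in> outs m))"

definition lateral :: "('d, 'z) oriented_map_scheme \<Rightarrow> 'd \<Rightarrow> bool" where
  "lateral m d \<longleftrightarrow> (d \<notin> outs m) \<noteq> (succ m d \<notin> outs m)"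

abbreviation extremal :: "('d, 'z) oriented_map_scheme \<Rightarrow> 'd \<Rightarrow> bool" where
  "extremal m d \<equiv> \<not> lateral m d"

text \<open>
  Maps are considered up to orientation-preserving homeomorphism respecting root and orientation.
\<close>

definition map_iso :: "'d oriented_map \<Rightarrow> 'd oriented_map \<Rightarrow> bool" where
  "map_iso m m' \<longleftrightarrow>
     (\<exists>h. bij_betw h (darts m) (darts m') \<and>
        (\<forall>d\<in>darts m. h (succ m d) = succ m' (h d) \<and> h (opp m d) = opp m' (h d)) \<and>
        h (root m) = root m' \<and>
        h ` outs m = outs m')"

definition iso_classes :: "'d oriented_map set \<Rightarrow> 'd oriented_map set set" where
  "iso_classes A = A // {(m, m'). m \<in> A \<and> m' \<in> A \<and> map_iso m m'}"


section \<open>Polyhedral orientations\<close>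

definition rooted_triangulation :: "('d, 'z) rooted_map_scheme \<Rightarrow> bool" where
  "rooted_triangulation m \<longleftrightarrow> rooted_planar_map m \<and> (\<forall>f\<in>faces m. card f = 3)"

definition eulerian_triangulation :: "('d, 'z) rooted_map_scheme \<Rightarrow> bool" where
  "eulerian_triangulation m \<longleftrightarrow> rooted_triangulation m \<and> (\<forall>v\<in>vertices m. even (card v))"

text \<open>\<open>L\<close> is the set of light faces.  In an Eulerian triangulation there is exactly one such \<open>L\<close>.\<close>

definition face_bicoloring :: "('d, 'z) rooted_map_scheme \<Rightarrow> 'd set set \<Rightarrow> bool" where
  "face_bicoloring m L \<longleftrightarrow>
     L \<subseteq> faces m \<and> outer_face m \<in> L \<and>
     (\<forall>d\<in>darts m. (face_of m d \<in> L) \<noteq> (face_of m (opp m d) \<in> L))"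

definition polyhedral_orientation :: "('d, 'z) oriented_map_scheme \<Rightarrow> bool" where
  "polyhedral_orientation m \<longleftrightarrow>
     eulerian_triangulation m \<and> orientation m \<and>
     (\<forall>d\<in>darts m. vertex_of m d \<in> outer_vertices m \<longrightarrow> lateral m d) \<and>
     outer_face m \<subseteq> outs m \<and>
     (\<forall>v\<in>inner_vertices m. card {d \<in> v. extremal m d} = 2) \<and>
     (\<exists>L. face_bicoloring m L \<and> (\<forall>d\<in>darts m. extremal m d \<longrightarrow> face_of m d \<in> L))"

datatype color = Red | Green | Blue

text \<open>
  Iterating \<open>next_in_face\<close> from the root walks along the outer contour with the outer face on
  the left, that is, clockwise.  In a rooted Eulerian triangulation the coloring exists and is
  unique on the vertices.
\<close>

definition vertex_tricoloring :: "('d, 'z) rooted_map_scheme \<Rightarrow> ('d set \<Rightarrow> color) \<Rightarrow> bool" where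
  "vertex_tricoloring m C \<longleftrightarrow>
     (\<forall>d\<in>darts m. C (vertex_of m d) \<noteq> C (vertex_of m (opp m d))) \<and>
     C (root_vertex m) = Red \<and>
     C (vertex_of m (next_in_face m (root m))) = Green \<and>
     C (vertex_of m (next_in_face m (next_in_face m (root m)))) = Blue"

text \<open>Every finite map has a copy with darts in \<^typ>\<open>nat\<close>, so this type yields all classes.\<close>

definition polyhedral_orientations ::
    "nat \<Rightarrow> nat \<Rightarrow> nat \<Rightarrow> nat \<Rightarrow> nat oriented_map set" where
  "polyhedral_orientations n a b c =
     {m. polyhedral_orientation m \<and> card (inner_vertices m) = n \<and>
         (\<exists>C. vertex_tricoloring m C \<and>
              card {v \<in> inner_vertices m. C v = Red} = a \<and>
              card {v \<in> inner_vertices m. C v = Blue} = b \<and>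
              card {v \<in> inner_vertices m. C v = Green} = c)}"


section \<open>Plane bipolar orientations\<close>

definition sources :: "('d, 'z) oriented_map_scheme \<Rightarrow> 'd set set" where
  "sources m = {v \<in> vertices m. \<forall>d\<in>v. d \<in> outs m}"

definition sinks :: "('d, 'z) oriented_map_scheme \<Rightarrow> 'd set set" where
  "sinks m = {v \<in> vertices m. \<forall>d\<in>v. d \<notin> outs m}"

definition acyclic_orientation :: "('d, 'z) oriented_map_scheme \<Rightarrow> bool" where
  "acyclic_orientation m \<longleftrightarrow>
     orientation m \<and> acyclic {(vertex_of m d, vertex_of m (opp m d)) |d. d \<in> outs m}"

definition plane_bipolar_orientation :: "('d, 'z) oriented_map_scheme \<Rightarrow> bool" where
  "plane_bipolar_orientation m \<longleftrightarrow>
     rooted_planar_map m \<and> acyclic_orientation m \<and>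
     sources m = {root_vertex m} \<and>
     (\<exists>N. sinks m = {N} \<and> N \<in> outer_vertices m)"

definition sink_vertex :: "('d, 'z) oriented_map_scheme \<Rightarrow> 'd set" where
  "sink_vertex m = (THE N. sinks m = {N})"

fun directed_path ::
    "('d, 'z) oriented_map_scheme \<Rightarrow> 'd set \<Rightarrow> 'd list \<Rightarrow> 'd set \<Rightarrow> bool" where
  "directed_path m u [] v \<longleftrightarrow> u = v"
| "directed_path m u (d # ds) v \<longleftrightarrow>
     d \<in> outs m \<and> vertex_of m d = u \<and> directed_path m (vertex_of m (opp m d)) ds v"

text \<open>
  \<open>path_on_right m f b t ds\<close>: the edges of the contour of \<open>f\<close> having \<open>f\<close> on their right form the
  directed path \<open>ds\<close> from \<open>b\<close> to \<open>t\<close>; similarly for \<open>path_on_left\<close>.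
\<close>

definition path_on_right ::
    "('d, 'z) oriented_map_scheme \<Rightarrow> 'd set \<Rightarrow> 'd set \<Rightarrow> 'd set \<Rightarrow> 'd list \<Rightarrow> bool" where
  "path_on_right m f b t ds \<longleftrightarrow>
     directed_path m b ds t \<and> distinct ds \<and> set ds = {d \<in> outs m. face_of m (opp m d) = f}"

definition path_on_left ::
    "('d, 'z) oriented_map_scheme \<Rightarrow> 'd set \<Rightarrow> 'd set \<Rightarrow> 'd set \<Rightarrow> 'd list \<Rightarrow> bool" where
  "path_on_left m f b t ds \<longleftrightarrow>
     directed_path m b ds t \<and> distinct ds \<and> set ds = {d \<in> outs m. face_of m d = f}"

text \<open>
  The inner face \<open>f\<close> has bottom vertex \<open>b\<close>, top vertex \<open>t\<close> and type \<open>(i, j)\<close>.  The left lateral path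
  is the one with \<open>f\<close> on its right.  For the outer face it is the other way round: the left outer
  boundary has the outer face on its left.  In a plane bipolar orientation, bottom, top and type of an
  inner face exist and are unique.
\<close>

definition face_has_type ::
    "('d, 'z) oriented_map_scheme \<Rightarrow> 'd set \<Rightarrow> 'd set \<Rightarrow> 'd set \<Rightarrow> nat \<Rightarrow> nat \<Rightarrow> bool" where
  "face_has_type m f b t i j \<longleftrightarrow>
     (\<exists>ls rs. path_on_right m f b t ls \<and> path_on_left m f b t rs \<and>
              length ls = i + 1 \<and> length rs = j + 1)"

definition has_outer_type :: "('d, 'z) oriented_map_scheme \<Rightarrow> nat \<Rightarrow> nat \<Rightarrow> bool" where
  "has_outer_type m i j \<longleftrightarrow>
     (\<exists>ls rs. path_on_left m (outer_face m) (root_vertex m) (sink_vertex m) ls \<and>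
              path_on_right m (outer_face m) (root_vertex m) (sink_vertex m) rs \<and>
              length ls = i + 1 \<and> length rs = j + 1)"

text \<open>
  \<open>W\<close> is the set of white vertices; the underlying map is bipartite iff some \<open>W\<close> exists, and it is
  then unique.
\<close>

definition vertex_bicoloring :: "('d, 'z) oriented_map_scheme \<Rightarrow> 'd set set \<Rightarrow> bool" where
  "vertex_bicoloring m W \<longleftrightarrow>
     W \<subseteq> vertices m \<and> sink_vertex m \<in> W \<and>
     (\<forall>d\<in>darts m. (vertex_of m d \<in> W) \<noteq> (vertex_of m (opp m d) \<in> W))"

definition P_admissible :: "('d, 'z) oriented_map_scheme \<Rightarrow> 'd set set \<Rightarrow> bool" where
  "P_admissible m W \<longleftrightarrow>
     plane_bipolar_orientation m \<and> vertex_bicoloring m W \<and>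
     (\<exists>k\<ge>2. even k \<and> has_outer_type m 0 k) \<and>
     (\<forall>f\<in>inner_faces m. \<forall>b t i j. face_has_type m f b t i j \<longrightarrow>
        (t \<notin> W \<longrightarrow> i \<ge> 1) \<and> (t \<in> W \<longrightarrow> j \<ge> 1))"

definition P_admissible_orientations ::
    "nat \<Rightarrow> nat \<Rightarrow> nat \<Rightarrow> nat \<Rightarrow> nat oriented_map set" where
  "P_admissible_orientations e w k f =
     {m. \<exists>W. P_admissible m W \<and> card (edges m) = e \<and>
             card W = w \<and> card (vertices m - W) = k \<and> card (inner_faces m) = f}"

end

theory Submission
  imports Defs
begin

text \<open>
  Deleting the green vertices of a polyhedral orientation leaves a bipartite plane map on the red
  (white) and blue (black) vertices, whose faces are the green vertices. Every dark corner is lateral,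
  so every dark triangle is a directed cycle and the orientation of the red-blue edges determines the
  others. Reading (PO1) and (PO2) on the red-blue map gives local conditions: one outer vertex is a
  source, another a sink, the direction changes exactly twice around every other vertex, and among the
  white darts around an inner face it changes exactly twice.

  By Euler's formula the numbers of direction changes around vertices and along faces add up to
  \<open>2(V - 2) + 2F\<close>. If the map is P-admissible, each vertex other than the source and the sink and each
  face has at least two changes, hence exactly two; conversely the local conditions force exactly two
  changes along each face, and the white ones express the conditions on the types.

  That the local conditions imply acyclicity is the planar part. A simple directed cycle separates
  the faces; on the side \<open>A\<close> away from the outer face the number of corners is at least
  \<open>2F + 2V + |C|\<close>, where \<open>F\<close>, \<open>V\<close> and \<open>E\<close> count the faces, vertices and edges in the interior of \<open>A\<close>, while it equals \<open>2E + |C|\<close>;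
  but \<open>F + V \<ge> E + 1\<close> by a rank duality between components of a set of edges and dual components
  of its complement.
\<close>

section \<open>Permutations of finite sets\<close>

text \<open>A green vertex sees only half of its face: its dark corners are lateral, and its light
  ones compare consecutive darts with white origin. So (PO2) bounds the number of direction changes
  along a face only from below. The gap closes because every corner of the red-blue map carries
  either a change at its vertex or one along its face: the total is the number of darts, and Euler's
  formula leaves no room for a surplus. The same count serves both directions and, restricted to the
  region cut off by a directed cycle, excludes such cycles. The outer triangle uses up the white
  sink, the black source and the outer face; this accounts for \<open>a + 1\<close>,
  \<open>b + 1\<close> and the \<open>c\<close> inner faces, and Euler's formula gives
  \<open>n + 1\<close> edges. The bound \<open>n \<ge> 1\<close> excludes the single edge, whose
  outer type is (0, 0). As the names of darts are arbitrary, the correspondence is a relation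
  between maps, \<open>star_pair\<close>, that is total on both sides and compatible with
  isomorphism.\<close>

lemma card_up_eq_down:
  assumes "finite S" "bij_betw g S S"
  shows "card {x\<in>S. x \<in> P \<and> g x \<notin> P} = card {x\<in>S. x \<notin> P \<and> g x \<in> P}"
proof -
  have "card {x\<in>S. g x \<in> P} = card {x\<in>S. x \<in> P}"
  proof (rule bij_betw_same_card[of g])
    show "bij_betw g {x\<in>S. g x \<in> P} {x\<in>S. x \<in> P}"
      using assms(2) unfolding bij_betw_def inj_on_def by auto
  qed
  moreover have "card {x\<in>S. g x \<in> P} = card {x\<in>S. x \<in> P \<and> g x \<in> P} + card {x\<in>S. x \<notin> P \<and> g x \<in> P}"
    using assms(1) by (subst card_Un_disjoint[symmetric]) (auto intro!: arg_cong[of _ _ card])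
  moreover have "card {x\<in>S. x \<in> P} = card {x\<in>S. x \<in> P \<and> g x \<in> P} + card {x\<in>S. x \<in> P \<and> g x \<notin> P}"
    using assms(1) by (subst card_Un_disjoint[symmetric]) (auto intro!: arg_cong[of _ _ card])
  ultimately show ?thesis by simp
qed

text \<open>Exits from \<open>P\<close> and entries into \<open>P\<close> are equally many, so the
  number of changes is even; later a positive number of changes is thereby at least 2.\<close>

lemma card_changes:
  assumes "finite S" "bij_betw g S S"
  shows "card {x\<in>S. (x \<in> P) \<noteq> (g x \<in> P)} = 2 * card {x\<in>S. x \<in> P \<and> g x \<notin> P}"
proof -
  have "{x\<in>S. (x \<in> P) \<noteq> (g x \<in> P)} = {x\<in>S. x \<in> P \<and> g x \<notin> P} \<union> {x\<in>S. x \<notin> P \<and> g x \<in> P}"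
    by auto
  then have "card {x\<in>S. (x \<in> P) \<noteq> (g x \<in> P)}
    = card {x\<in>S. x \<in> P \<and> g x \<notin> P} + card {x\<in>S. x \<notin> P \<and> g x \<in> P}"
    using assms(1) by (simp add: card_Un_disjoint disjoint_iff)
  with card_up_eq_down[OF assms, of P] show ?thesis by simp
qed

text \<open>Instantiated three times on the darts of a map, with \<open>succ\<close>,
  \<open>opp\<close> and \<open>next_in_face\<close>, whose orbits are the vertices, the edges and
  the faces.\<close>

locale finite_perm =
  fixes g :: "'a \<Rightarrow> 'a" and S :: "'a set"
  assumes fin: "finite S" and perm: "g permutes S"
begin

lemma permutation: "permutation g"
  using fin perm permutation_permutes by blast

lemma in_iff [simp]: "g x \<in> S \<longleftrightarrow> x \<in> S"
  using perm by (simp add: permutes_in_image)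

lemma inv_in_iff [simp]: "inv g x \<in> S \<longleftrightarrow> x \<in> S"
  using permutes_inv[OF perm] by (simp add: permutes_in_image)

lemma inv_cancel [simp]: "inv g (g x) = x" "g (inv g x) = x"
  using permutes_inverses[OF perm] by auto

lemma inj_iff [simp]: "g x = g y \<longleftrightarrow> x = y"
  by (metis inv_cancel(1))

lemma self_orbit [simp]: "x \<in> orbit g x"
  by (rule permutation_self_in_orbit[OF permutation])

lemma orbit_g [simp]: "orbit g (g x) = orbit g x"
  by (rule permutation_orbit_step[OF permutation])

lemma orbit_inv_g [simp]: "orbit g (inv g x) = orbit g x"
  by (metis inv_cancel(2) orbit_g)

lemma orbit_eq_iff: "orbit g x = orbit g y \<longleftrightarrow> x \<in> orbit g y"
  by (metis orbit_swap orbit_trans self_orbit subsetI subset_antisym)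

lemma orbit_eqI: "x \<in> orbit g y \<Longrightarrow> orbit g x = orbit g y"
  by (simp add: orbit_eq_iff)

lemma g_in_orbit [simp]: "g x \<in> orbit g y \<longleftrightarrow> x \<in> orbit g y"
  by (metis orbit_eq_iff orbit_g)

lemma inv_in_orbit [simp]: "inv g x \<in> orbit g y \<longleftrightarrow> x \<in> orbit g y"
  by (metis inv_cancel(2) g_in_orbit)

lemma orbit_sub: "x \<in> S \<Longrightarrow> orbit g x \<subseteq> S"
proof
  fix y assume "y \<in> orbit g x" "x \<in> S"
  then show "y \<in> S" by induct auto
qed

lemma finite_orbit': "finite (orbit g x)"
  by (rule finite_orbit) simp

lemma orbits_disjoint: "A \<in> orbit g ` S \<Longrightarrow> B \<in> orbit g ` S \<Longrightarrow> A \<noteq> B \<Longrightarrow> A \<inter> B = {}"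
  using orbit_eqI by blast

lemma Union_orbits: "\<Union> (orbit g ` S) = S"
  using orbit_sub self_orbit by blast

lemma sum_orbits:
  fixes h :: "'a \<Rightarrow> 'b::comm_monoid_add"
  shows "(\<Sum>A\<in>orbit g ` S. sum h A) = sum h S"
proof -
  have "sum h (\<Union>(orbit g ` S)) = (sum \<circ> sum) h (orbit g ` S)"
    by (rule sum.Union_disjoint) (use finite_orbit' orbits_disjoint in blast)+
  then show ?thesis by (simp add: Union_orbits)
qed

lemma card_filter_orbits:
  "(\<Sum>A\<in>orbit g ` S. card {x\<in>A. P x}) = card {x\<in>S. P x}"
proof -
  have "card {x\<in>A. P x} = (\<Sum>x\<in>A. if P x then 1 else 0)" if "finite A" for A
    using that by (simp add: sum.If_cases Int_def)
  then have "(\<Sum>A\<in>orbit g ` S. card {x\<in>A. P x}) = (\<Sum>A\<in>orbit g ` S. \<Sum>x\<in>A. if P x then 1 else 0)"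
    by (intro sum.cong) (auto simp: finite_orbit')
  then show ?thesis using sum_orbits[of "\<lambda>x. if P x then 1 else (0::nat)"] fin
    by (simp add: sum.If_cases Int_def)
qed

lemma bij_orbit: "bij_betw g (orbit g x) (orbit g x)"
  unfolding bij_betw_def inj_on_def
proof (intro conjI set_eqI iffI)
  fix y assume "y \<in> orbit g x"
  then have "inv g y \<in> orbit g x" "y = g (inv g y)" by auto
  then show "y \<in> g ` orbit g x" by blast
qed auto

lemma orbit_induct [consumes 1, case_names base step]:
  assumes "y \<in> orbit g x" "P x" "\<And>z. z \<in> orbit g x \<Longrightarrow> P z \<Longrightarrow> P (g z)"
  shows "P y"
  using assms(1) by induct (auto intro!: assms(2,3) simp: orbit.base)

end

section \<open>Number of classes of a relation\<close>

definition conn :: "('a \<times> 'a) set \<Rightarrow> ('a \<times> 'a) set" where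
  "conn R = (R \<union> R\<inverse>)\<^sup>*"

definition num_classes :: "'a set \<Rightarrow> ('a \<times> 'a) set \<Rightarrow> nat" where
  "num_classes D R = card ((\<lambda>x. conn R `` {x}) ` D)"

lemma conn_refl [simp]: "(x, x) \<in> conn R"
  by (simp add: conn_def)

lemma conn_trans: "(x, y) \<in> conn R \<Longrightarrow> (y, z) \<in> conn R \<Longrightarrow> (x, z) \<in> conn R"
  unfolding conn_def by (rule rtrancl_trans)

lemma conn_sym: "(x, y) \<in> conn R \<Longrightarrow> (y, x) \<in> conn R"
proof -
  have "sym (R \<union> R\<inverse>)" by (auto intro: symI)
  then have "sym ((R \<union> R\<inverse>)\<^sup>*)" by (rule sym_rtrancl)
  then show "(x, y) \<in> conn R \<Longrightarrow> (y, x) \<in> conn R"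
    unfolding conn_def by (rule symD)
qed

lemma conn_base: "(x, y) \<in> R \<Longrightarrow> (x, y) \<in> conn R"
  unfolding conn_def by blast

lemma conn_least:
  assumes "(x, y) \<in> conn R" "\<And>a b. (a, b) \<in> R \<Longrightarrow> (a, b) \<in> conn R'"
  shows "(x, y) \<in> conn R'"
  using assms(1) unfolding conn_def[of R]
proof (induction rule: rtrancl_induct)
  case (step y z)
  from step.hyps(2) have "(y, z) \<in> R \<or> (z, y) \<in> R" by auto
  then have "(y, z) \<in> conn R'" using assms(2)[of y z] assms(2)[of z y] conn_sym[of z y R'] by auto
  then show ?case by (rule conn_trans[OF step.IH])
qed simp

lemma conn_mono: "R \<subseteq> R' \<Longrightarrow> (x, y) \<in> conn R \<Longrightarrow> (x, y) \<in> conn R'"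
  by (erule conn_least) (blast intro: conn_base)

lemma conn_invariant:
  assumes "(x, y) \<in> conn R" "\<And>a b. (a, b) \<in> R \<Longrightarrow> P a \<longleftrightarrow> P b"
  shows "P x \<longleftrightarrow> P y"
  using assms(1) unfolding conn_def
  by (induction rule: rtrancl_induct) (use assms(2) in blast)+

lemma conn_eqI: "(\<And>a b. (a, b) \<in> R \<Longrightarrow> (a, b) \<in> conn R') \<Longrightarrow> (\<And>a b. (a, b) \<in> R' \<Longrightarrow> (a, b) \<in> conn R) \<Longrightarrow> conn R = conn R'"
  by (auto intro: conn_least)

lemma conn_class_eq: "conn R `` {x} = conn R `` {y} \<longleftrightarrow> (x, y) \<in> conn R"
  by (auto intro: conn_trans conn_sym)

lemma num_classes_cong: "conn R = conn R' \<Longrightarrow> num_classes D R = num_classes D R'"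
  by (simp add: num_classes_def)

lemma num_classes_eq_1:
  assumes "x \<in> D" "\<And>d. d \<in> D \<Longrightarrow> (x, d) \<in> conn R"
  shows "num_classes D R = 1"
proof -
  have "conn R `` {d} = conn R `` {x}" if "d \<in> D" for d
    unfolding conn_class_eq by (rule conn_sym, rule assms(2), rule that)
  then have "(\<lambda>d. conn R `` {d}) ` D = (\<lambda>d. conn R `` {x}) ` D"
    by (rule image_cong[OF refl])
  then show ?thesis using assms(1) by (simp only: num_classes_def image_constant) simp
qed

lemma num_classes_insert_same:
  assumes "(a, b) \<in> conn R" shows "num_classes D (insert (a, b) R) = num_classes D R"
  by (rule num_classes_cong, rule conn_eqI) (use assms in \<open>auto intro: conn_base\<close>)

text \<open>A new pair merges at most two classes. Applied edge by edge, this is the only estimate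
  on components that the planar argument needs besides the treatment of bridges.\<close>

lemma num_classes_insert:
  assumes "finite D"
  shows "num_classes D R \<le> num_classes D (insert (a, b) R) + 1"
proof -
  let ?R = "insert (a, b) R"
  let ?c = "\<lambda>x. conn R `` {x}" and ?C = "\<lambda>x. conn ?R `` {x}"
  \<comment> \<open>A path that uses the new pair can be shortened so as to cross it once.\<close>
  have key: "(x, y) \<in> conn R \<or> (x, a) \<in> conn R \<and> (b, y) \<in> conn R \<or> (x, b) \<in> conn R \<and> (a, y) \<in> conn R"
    if "(x, y) \<in> conn ?R" for x y
    using that unfolding conn_def[of ?R]
  proof (induction rule: rtrancl_induct)
    case (step y z)
    then have "(y, z) \<in> conn R \<or> (y, z) = (a, b) \<or> (y, z) = (b, a)"
      by (auto intro: conn_base conn_sym)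
    with step.IH show ?case
      using conn_trans[of x y R z] conn_trans[of a y R z] conn_trans[of b y R z] by auto
  qed simp
  have fin: "finite (?c ` D)" "finite (?C ` D)" using assms by auto
  \<comment> \<open>The class of \<open>b\<close> is set aside: by \<open>key\<close>, two distinct
    old classes merge only if one of them contains \<open>b\<close>.\<close>
  define B where "B = ?c ` D - {?c b}"
  define h where "h = (\<lambda>X. conn ?R `` X)"
  have h: "h (?c x) = ?C x" for x
    unfolding h_def by (auto intro: conn_trans conn_mono[of R ?R])
  have "inj_on h B"
  proof (rule inj_onI)
    fix X Y assume "X \<in> B" "Y \<in> B" "h X = h Y"
    then obtain x y where "X = ?c x" "Y = ?c y" "?c x \<noteq> ?c b" "?c y \<noteq> ?c b"
      unfolding B_def by blast
    then have xy: "X = ?c x" "Y = ?c y" "(x, b) \<notin> conn R" "(y, b) \<notin> conn R"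
      by (simp_all only: conn_class_eq conn_refl not_False_eq_True)
    then have "(x, y) \<in> conn ?R" using \<open>h X = h Y\<close> by (simp only: h conn_class_eq)
    then have "(x, y) \<in> conn R" using key[of x y] xy(3,4) conn_sym[of b y R] by auto
    then show "X = Y" unfolding xy(1,2) by (simp only: conn_class_eq)
  qed
  moreover have "h ` B \<subseteq> ?C ` D" unfolding B_def using h by auto
  ultimately have "card B \<le> card (?C ` D)" using fin(2) by (rule card_inj_on_le)
  moreover have "card (?c ` D) \<le> card (insert (?c b) B)"
    unfolding B_def by (rule card_mono) (use fin(1) in auto)
  then have "card (?c ` D) \<le> card B + 1"
    using fin(1) by (simp add: B_def card_insert_if split: if_splits)
  ultimately show ?thesis unfolding num_classes_def by simp
qed

text \<open>The orbits of a permutation of a finite set are cycles, so going forward along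
  \<open>g\<close> already reaches the whole class.\<close>

lemma (in finite_perm) conn_perm:
  assumes "x \<in> S" shows "conn {(d, g d) |d. d \<in> S} `` {x} = orbit g x"
proof (intro set_eqI iffI)
  fix y assume "y \<in> orbit g x"
  then have "(x, y) \<in> conn {(d, g d) |d. d \<in> S}"
  proof (induction rule: orbit_induct)
    case (step z)
    then have "z \<in> S" using assms orbit_sub by blast
    then have "(z, g z) \<in> conn {(d, g d) |d. d \<in> S}" by (intro conn_base) auto
    with step show ?case by (blast intro: conn_trans)
  qed simp
  then show "y \<in> conn {(d, g d) |d. d \<in> S} `` {x}" by simp
next
  fix y assume "y \<in> conn {(d, g d) |d. d \<in> S} `` {x}"
  then have "(x, y) \<in> conn {(d, g d) |d. d \<in> S}" by simp
  then have "x \<in> orbit g x \<longleftrightarrow> y \<in> orbit g x"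
    by (rule conn_invariant) auto
  then show "y \<in> orbit g x" by simp
qed

section \<open>Combinatorial maps\<close>

locale comb_map =
  fixes m :: "('d, 'z) rooted_map_scheme"
  assumes finite_darts: "finite (darts m)"
    and root_in [simp]: "root m \<in> darts m"
    and succ_permutes: "succ m permutes darts m"
    and opp_permutes: "opp m permutes darts m"
    and opp_neq: "d \<in> darts m \<Longrightarrow> opp m d \<noteq> d"
    and opp_opp_in: "d \<in> darts m \<Longrightarrow> opp m (opp m d) = d"
begin

sublocale s: finite_perm "succ m" "darts m"
  by unfold_locales (rule finite_darts, rule succ_permutes)

sublocale o: finite_perm "opp m" "darts m"
  by unfold_locales (rule finite_darts, rule opp_permutes)

lemma next_in_face_permutes: "next_in_face m permutes darts m"
  unfolding next_in_face_def by (intro permutes_compose opp_permutes permutes_inv succ_permutes)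

sublocale f: finite_perm "next_in_face m" "darts m"
  by unfold_locales (rule finite_darts, rule next_in_face_permutes)

lemma opp_opp [simp]: "opp m (opp m d) = d"
  using opp_opp_in permutes_not_in[OF opp_permutes] by (cases "d \<in> darts m") auto

lemma succ_next_in_face [simp]: "succ m (next_in_face m d) = opp m d"
  by (simp add: next_in_face_def)

lemma next_in_face_opp_succ [simp]: "next_in_face m (opp m (succ m d)) = d"
  by (simp add: next_in_face_def)

text \<open>The dart before \<open>d\<close> on the contour of its face arrives at the origin of
  \<open>d\<close>, along the edge that follows \<open>d\<close> counterclockwise.\<close>

lemma opp_succ: "opp m (succ m d) = inv (next_in_face m) d"
  by (metis f.inv_cancel(1) next_in_face_opp_succ)

lemma opp_inv_next: "opp m (inv (next_in_face m) d) = succ m d"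
  by (metis opp_succ opp_opp)

lemma vertex_succ [simp]: "vertex_of m (succ m d) = vertex_of m d"
  by (simp add: vertex_of_def)

lemma vertex_inv_succ [simp]: "vertex_of m (inv (succ m) d) = vertex_of m d"
  by (simp add: vertex_of_def)

lemma vertex_next [simp]: "vertex_of m (next_in_face m d) = vertex_of m (opp m d)"
  by (simp add: next_in_face_def)

lemma face_next [simp]: "face_of m (next_in_face m d) = face_of m d"
  by (simp add: face_of_def)

lemma in_vertex [simp]: "d \<in> vertex_of m d"
  by (simp add: vertex_of_def)

lemma in_face [simp]: "d \<in> face_of m d"
  by (simp add: face_of_def)

lemma vertex_eq_iff: "vertex_of m d = vertex_of m e \<longleftrightarrow> d \<in> vertex_of m e"
  by (simp add: vertex_of_def s.orbit_eq_iff)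

lemma face_eq_iff: "face_of m d = face_of m e \<longleftrightarrow> d \<in> face_of m e"
  by (simp add: face_of_def f.orbit_eq_iff)

lemma vertex_sub: "d \<in> darts m \<Longrightarrow> vertex_of m d \<subseteq> darts m"
  by (simp add: vertex_of_def s.orbit_sub)

lemma face_sub: "d \<in> darts m \<Longrightarrow> face_of m d \<subseteq> darts m"
  by (simp add: face_of_def f.orbit_sub)

lemma vertices_altdef: "vertices m = orbit (succ m) ` darts m"
  by (simp add: vertices_def vertex_of_def[abs_def])

lemma faces_altdef: "faces m = orbit (next_in_face m) ` darts m"
  by (simp add: faces_def face_of_def[abs_def])

lemma in_vertexD: "v \<in> vertices m \<Longrightarrow> d \<in> v \<Longrightarrow> d \<in> darts m \<and> v = vertex_of m d"
  unfolding vertices_def using vertex_sub vertex_eq_iff by blast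

lemma in_faceD: "f \<in> faces m \<Longrightarrow> d \<in> f \<Longrightarrow> d \<in> darts m \<and> f = face_of m d"
  unfolding faces_def using face_sub face_eq_iff by blast

lemma vertex_in [intro, simp]: "d \<in> darts m \<Longrightarrow> vertex_of m d \<in> vertices m"
  by (simp add: vertices_def)

lemma face_in [intro, simp]: "d \<in> darts m \<Longrightarrow> face_of m d \<in> faces m"
  by (simp add: faces_def)

lemma finite_vertices: "finite (vertices m)" and finite_faces: "finite (faces m)"
  unfolding vertices_def faces_def using finite_darts by auto

lemma finite_vertex: "v \<in> vertices m \<Longrightarrow> finite v"
  using in_vertexD finite_darts by (meson finite_subset subsetI)

lemma finite_face: "f \<in> faces m \<Longrightarrow> finite f"
  using in_faceD finite_darts by (meson finite_subset subsetI)

lemma sum_card_vertices: "(\<Sum>v\<in>vertices m. card {d\<in>v. P d}) = card {d\<in>darts m. P d}"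
  unfolding vertices_altdef by (rule s.card_filter_orbits)

lemma sum_card_faces: "(\<Sum>f\<in>faces m. card {d\<in>f. P d}) = card {d\<in>darts m. P d}"
  unfolding faces_altdef by (rule f.card_filter_orbits)

lemma outer_face_in: "outer_face m \<in> faces m"
  by (simp add: outer_face_def)

lemma card_darts: "card (darts m) = 2 * card (edges m)"
proof -
  have "card (darts m) = card (\<Union>(edges m))"
    unfolding edges_def by (rule arg_cong[of _ _ card]) auto
  also have "\<dots> = sum card (edges m)"
  proof (rule card_Union_disjoint)
    show "pairwise disjnt (edges m)"
      unfolding pairwise_def disjnt_def edges_def by auto
  qed (auto simp: edges_def)
  also have "\<dots> = (\<Sum>e\<in>edges m. 2)"
    by (rule sum.cong) (auto simp: edges_def opp_neq card_insert_if dest: opp_neq)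
  finally show ?thesis by simp
qed

section \<open>Primal and dual components of a set of edges\<close>

definition vertex_rel :: "'d set \<Rightarrow> ('d \<times> 'd) set" where
  "vertex_rel X = {(d, succ m d) |d. d \<in> darts m} \<union> {(d, opp m d) |d. d \<in> X}"

text \<open>Its classes are the components of the dual graph with the edges of \<open>Y\<close>, as
  those of \<open>vertex_rel X\<close> are the components of the spanning subgraph with the edges of
  \<open>X\<close>. Both relations live on the darts, so no dual map has to be built. One dart of
  each edge suffices, because \<open>conn\<close> symmetrizes.\<close>

definition face_rel :: "'d set \<Rightarrow> ('d \<times> 'd) set" where
  "face_rel Y = {(d, next_in_face m d) |d. d \<in> darts m} \<union> {(d, opp m d) |d. d \<in> Y}"

lemma vertex_rel_insert: "vertex_rel (insert e X) = insert (e, opp m e) (vertex_rel X)"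
  by (auto simp: vertex_rel_def)

lemma face_rel_insert: "face_rel (insert e Y) = insert (e, opp m e) (face_rel Y)"
  by (auto simp: face_rel_def)

lemma num_classes_vertices: "num_classes (darts m) (vertex_rel {}) = card (vertices m)"
  unfolding num_classes_def vertex_rel_def vertices_altdef
  by (intro arg_cong[of _ _ card] image_cong) (use s.conn_perm in auto)

lemma num_classes_faces: "num_classes (darts m) (face_rel {}) = card (faces m)"
  unfolding num_classes_def face_rel_def faces_altdef
  by (intro arg_cong[of _ _ card] image_cong) (use f.conn_perm in auto)

lemma conn_vertex_succ: "d \<in> darts m \<Longrightarrow> (e, succ m d) \<in> conn (vertex_rel X) \<longleftrightarrow> (e, d) \<in> conn (vertex_rel X)"
proof -
  assume "d \<in> darts m"
  then have "(d, succ m d) \<in> conn (vertex_rel X)"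
    by (intro conn_base) (auto simp: vertex_rel_def)
  then show ?thesis using conn_trans conn_sym by metis
qed

lemma conn_face_next: "d \<in> darts m \<Longrightarrow> (e, next_in_face m d) \<in> conn (face_rel X) \<longleftrightarrow> (e, d) \<in> conn (face_rel X)"
proof -
  assume "d \<in> darts m"
  then have "(d, next_in_face m d) \<in> conn (face_rel X)"
    by (intro conn_base) (auto simp: face_rel_def)
  then show ?thesis using conn_trans conn_sym by metis
qed

lemma conn_face_opp: "d \<in> X \<or> opp m d \<in> X \<Longrightarrow> (e, opp m d) \<in> conn (face_rel X) \<longleftrightarrow> (e, d) \<in> conn (face_rel X)"
proof -
  assume "d \<in> X \<or> opp m d \<in> X"
  then have "(d, opp m d) \<in> face_rel X \<or> (opp m d, d) \<in> face_rel X"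
    by (auto simp: face_rel_def)
  then have "(d, opp m d) \<in> conn (face_rel X)"
    using conn_base conn_sym by metis
  then show ?thesis using conn_trans conn_sym by metis
qed

lemma conn_vertex_opp: "d \<in> X \<or> opp m d \<in> X \<Longrightarrow> (e, opp m d) \<in> conn (vertex_rel X) \<longleftrightarrow> (e, d) \<in> conn (vertex_rel X)"
proof -
  assume "d \<in> X \<or> opp m d \<in> X"
  then have "(d, opp m d) \<in> vertex_rel X \<or> (opp m d, d) \<in> vertex_rel X"
    by (auto simp: vertex_rel_def)
  then have "(d, opp m d) \<in> conn (vertex_rel X)"
    using conn_base conn_sym by metis
  then show ?thesis using conn_trans conn_sym by metis
qed

text \<open>
  The dual of a cut is an even subgraph, so it has no bridge: deleting \<open>e\<close> from the edges crossing
  between the component of \<open>e\<close> and the rest leaves the two sides of \<open>e\<close> connected in the dual.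
\<close>

lemma bridge_dual_connected:
  assumes e: "e \<in> darts m" and cover: "\<And>d. d \<in> darts m \<Longrightarrow> d \<notin> {e, opp m e} \<Longrightarrow>
      d \<in> X \<or> opp m d \<in> X \<or> d \<in> Y \<or> opp m d \<in> Y"
    and nconn: "(e, opp m e) \<notin> conn (vertex_rel X)"
  shows "(e, opp m e) \<in> conn (face_rel Y)"
proof (rule ccontr)
  assume nface: "(e, opp m e) \<notin> conn (face_rel Y)"
  define U where "U = {d\<in>darts m. (e, d) \<in> conn (vertex_rel X)}"
  define Q where "Q = {d\<in>darts m. (e, d) \<in> conn (face_rel Y)}"
  have e_mem: "e \<in> U" "e \<in> Q" "opp m e \<notin> U" "opp m e \<notin> Q"
    using e nconn nface by (auto simp: U_def Q_def)
  have finQ: "finite Q" by (simp add: Q_def finite_darts)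
  have next_U: "next_in_face m d \<in> U \<longleftrightarrow> opp m d \<in> U" if "d \<in> darts m" for d
    using conn_vertex_succ[of "next_in_face m d" e X] that by (auto simp: U_def)
  have opp_Q: "opp m d \<in> Q \<longleftrightarrow> d \<in> Q"
    if "d \<in> darts m" "d \<notin> {e, opp m e}" "(d \<in> U) \<noteq> (opp m d \<in> U)" for d
  proof -
    have "\<not> (d \<in> X \<or> opp m d \<in> X)"
      using that conn_vertex_opp[of d X e] by (auto simp: U_def)
    then have "d \<in> Y \<or> opp m d \<in> Y" using cover[of d] that by auto
    then show ?thesis using conn_face_opp[of d Y e] that by (auto simp: Q_def)
  qed
  have "inj_on (next_in_face m) Q" by (simp add: inj_on_def)
  moreover have "next_in_face m ` Q \<subseteq> Q" using conn_face_next by (auto simp: Q_def)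
  ultimately have "bij_betw (next_in_face m) Q Q"
    using finQ by (simp add: bij_betw_def endo_inj_surj)
  from card_up_eq_down[OF finQ this, of U]
  have eq: "card {d\<in>Q. d \<in> U \<and> opp m d \<notin> U} = card {d\<in>Q. d \<notin> U \<and> opp m d \<in> U}"
    using next_U by (simp add: Q_def cong: conj_cong)
  let ?A = "{d\<in>Q. d \<in> U \<and> opp m d \<notin> U}" and ?B = "{d\<in>Q. d \<notin> U \<and> opp m d \<in> U}"
  have Qd: "Q \<subseteq> darts m" by (auto simp: Q_def)
  \<comment> \<open>Every crossing dart of \<open>Q\<close> is paired with its opposite, except
    \<open>e\<close>: it leaves \<open>U\<close>, but its opposite is not in \<open>Q\<close>. So
    exits exceed entries by one, against the balance along the faces.\<close>
  have "bij_betw (opp m) (?A - {e}) ?B"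
  proof (rule bij_betw_byWitness[where f' = "opp m"])
    show "opp m ` (?A - {e}) \<subseteq> ?B"
      using opp_Q Qd e_mem by auto
    show "opp m ` ?B \<subseteq> ?A - {e}"
    proof
      fix x assume "x \<in> opp m ` ?B"
      then obtain d where d: "x = opp m d" "d \<in> Q" "d \<notin> U" "opp m d \<in> U" by blast
      then have "d \<notin> {e, opp m e}" using e_mem by auto
      then have "opp m d \<in> Q" "opp m d \<noteq> e" using opp_Q[of d] d Qd by auto
      with d show "x \<in> ?A - {e}" by simp
    qed
  qed auto
  then have "card (?A - {e}) = card ?B" by (rule bij_betw_same_card)
  moreover have "card (?A - {e}) < card ?A"
    using finQ e_mem by (intro card_Diff1_less) auto
  ultimately show False using eq by simp
qed

end

section \<open>Oriented planar maps\<close>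

locale planar = comb_map +
  assumes connected: "map_connected m"
    and euler: "card (vertices m) + card (faces m) = card (edges m) + 2"
begin

lemma dart_induct [consumes 2, case_names base succ opp]:
  assumes "d \<in> darts m" "e \<in> darts m" "P e"
    "\<And>x. x \<in> darts m \<Longrightarrow> P x \<Longrightarrow> P (succ m x)" "\<And>x. x \<in> darts m \<Longrightarrow> P x \<Longrightarrow> P (opp m x)"
  shows "P d"
proof -
  have "(e, d) \<in> ({(d, succ m d) |d. d \<in> darts m} \<union> {(d, opp m d) |d. d \<in> darts m})\<^sup>*"
    using connected assms(1,2) unfolding map_connected_def by blast
  then show ?thesis by induction (use assms in auto)
qed

text \<open>A walk through the dual graph: \<open>succ m d\<close> is reached from \<open>d\<close>
  by one step back along the face of \<open>d\<close> and by crossing the edge found there.\<close>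

lemma dart_induct_face [consumes 2, case_names base face opp]:
  assumes "d \<in> darts m" "e \<in> darts m" "P e"
    "\<And>x. x \<in> darts m \<Longrightarrow> P (next_in_face m x) \<longleftrightarrow> P x" "\<And>x. x \<in> darts m \<Longrightarrow> P x \<Longrightarrow> P (opp m x)"
  shows "P d"
  using assms(1,2)
proof (induction rule: dart_induct)
  case (succ x)
  then have "P (opp m (succ m x))" using assms(4)[of "opp m (succ m x)"] by simp
  then show ?case using assms(5)[of "opp m (succ m x)"] succ by simp
qed (use assms in auto)

end

lemma rooted_planar_map_iff: "rooted_planar_map m \<longleftrightarrow> planar m"
  unfolding rooted_planar_map_def planar_def comb_map_def planar_axioms_def by blast

locale oriented_planar = planar m for m :: "('d, 'z) oriented_map_scheme" +
  assumes orientation: "orientation m"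
begin

lemma outs_sub: "outs m \<subseteq> darts m"
  and opp_outs [simp]: "d \<in> darts m \<Longrightarrow> opp m d \<in> outs m \<longleftrightarrow> d \<notin> outs m"
  using orientation unfolding orientation_def by blast+

lemma finite_outs: "finite (outs m)"
  using outs_sub finite_darts finite_subset by blast

lemma card_outs: "card (outs m) = card (edges m)"
proof (rule bij_betw_same_card)
  show "bij_betw (\<lambda>d. {d, opp m d}) (outs m) (edges m)"
    unfolding bij_betw_def
  proof (intro conjI set_eqI iffI)
    show "inj_on (\<lambda>d. {d, opp m d}) (outs m)"
      using outs_sub opp_outs by (auto simp: inj_on_def doubleton_eq_iff)
    fix x assume "x \<in> edges m"
    then obtain d where d: "d \<in> darts m" "x = {d, opp m d}" by (auto simp: edges_def)
    show "x \<in> (\<lambda>d. {d, opp m d}) ` outs m"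
    proof (cases "d \<in> outs m")
      case False
      then have "opp m d \<in> outs m" "x = {opp m d, opp m (opp m d)}" using d by auto
      then show ?thesis by blast
    qed (use d in blast)
  qed (use outs_sub in \<open>auto simp: edges_def\<close>)
qed

lemma num_classes_connected: "num_classes (darts m) (vertex_rel (outs m)) = 1"
proof -
  have reach: "(root m, d) \<in> conn (vertex_rel (outs m))" if "d \<in> darts m" for d
    using that root_in
  proof (induction rule: dart_induct)
    case (opp x)
    then have "x \<in> outs m \<or> opp m x \<in> outs m" by auto
    with opp show ?case using conn_vertex_opp by blast
  qed (auto simp: conn_vertex_succ)
  show ?thesis by (rule num_classes_eq_1[OF root_in reach])
qed

text \<open>
  Planar duality between the components of a set of edges and the dual components of its complement.
\<close>

lemma components_duality:
  assumes "Y \<subseteq> outs m"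
  shows "card (outs m - Y) + num_classes (darts m) (vertex_rel (outs m - Y)) + 1
    \<le> num_classes (darts m) (face_rel Y) + card (vertices m)"
proof -
  have "finite Y" using assms finite_outs finite_subset by blast
  then show ?thesis using assms
  proof (induction Y)
    case empty
    \<comment> \<open>For empty \<open>Y\<close> the inequality is Euler's formula for the connected
      map, and holds with equality.\<close>
    then show ?case using euler by (simp add: num_classes_faces num_classes_connected card_outs)
  next
    case (insert e Y)
    define X where "X = outs m - insert e Y"
    have X: "outs m - Y = insert e X" "e \<notin> X" "finite X" "e \<in> darts m"
      using insert finite_outs outs_sub by (auto simp: X_def)
    have IH: "card X + 1 + num_classes (darts m) (vertex_rel (insert e X)) + 1
        \<le> num_classes (darts m) (face_rel Y) + card (vertices m)"
      using insert X by simp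
    \<comment> \<open>Moving \<open>e\<close> from the primal to the dual side lowers
      \<open>card (outs m - Y)\<close> by one. If the ends of \<open>e\<close> remain connected, the
      primal classes stay and the dual ones drop by at most one; if \<open>e\<close> is a bridge,
      the primal classes grow by at most one and the dual ones stay.\<close>
    show ?case
    proof (cases "(e, opp m e) \<in> conn (vertex_rel X)")
      case True
      then have "num_classes (darts m) (vertex_rel (insert e X)) = num_classes (darts m) (vertex_rel X)"
        unfolding vertex_rel_insert by (rule num_classes_insert_same)
      moreover have "num_classes (darts m) (face_rel Y) \<le> num_classes (darts m) (face_rel (insert e Y)) + 1"
        unfolding face_rel_insert by (rule num_classes_insert) (rule finite_darts)
      ultimately show ?thesis using IH unfolding X_def by simp
    next
      case False
      have "(e, opp m e) \<in> conn (face_rel Y)"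
      proof (rule bridge_dual_connected)
        fix d assume d: "d \<in> darts m" "d \<notin> {e, opp m e}"
        show "d \<in> X \<or> opp m d \<in> X \<or> d \<in> Y \<or> opp m d \<in> Y"
        proof (cases "d \<in> outs m")
          case True
          then show ?thesis using d by (auto simp: X_def)
        next
          case False
          then have "opp m d \<in> outs m" using d by simp
          moreover have "opp m d \<noteq> e" using d by auto
          ultimately show ?thesis by (auto simp: X_def)
        qed
      qed (use X False in auto)
      then have "num_classes (darts m) (face_rel (insert e Y)) = num_classes (darts m) (face_rel Y)"
        unfolding face_rel_insert by (rule num_classes_insert_same)
      moreover have "num_classes (darts m) (vertex_rel X) \<le> num_classes (darts m) (vertex_rel (insert e X)) + 1"
        unfolding vertex_rel_insert by (rule num_classes_insert) (rule finite_darts)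
      ultimately show ?thesis using IH unfolding X_def by simp
    qed
  qed
qed

end

section \<open>Local conditions forcing acyclicity\<close>

lemma (in finite_perm) two_changes:
  assumes "\<not> orbit g x \<subseteq> P" "orbit g x \<inter> P \<noteq> {}"
  shows "card {d\<in>orbit g x. (d \<in> P) \<noteq> (g d \<in> P)} \<ge> 2"
proof -
  have "\<exists>d\<in>orbit g x. d \<in> P \<and> g d \<notin> P"
  proof (rule ccontr)
    assume none: "\<not> ?thesis"
    obtain y where y: "y \<in> orbit g x" "y \<in> P" using assms(2) by blast
    have "z \<in> P" if "z \<in> orbit g y" for z
      using that by (induction rule: orbit_induct) (use y none orbit_eqI in auto)
    then show False using assms(1) orbit_eqI[OF y(1)] by auto
  qed
  then have "{d\<in>orbit g x. d \<in> P \<and> g d \<notin> P} \<noteq> {}" by blast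
  then have "card {d\<in>orbit g x. d \<in> P \<and> g d \<notin> P} \<noteq> 0" using finite_orbit'[of x] by simp
  then show ?thesis using card_changes[OF finite_orbit' bij_orbit, of x P] by linarith
qed

abbreviation "vertex_change m d \<equiv> (d \<in> outs m) \<noteq> (succ m d \<in> outs m)"

abbreviation "face_change m d \<equiv> (d \<in> outs m) \<noteq> (next_in_face m d \<in> outs m)"

text \<open>Meant for darts with a white origin: in a bipartite map two steps along the face lead to
  the next such dart.\<close>

abbreviation "two_step_change m d \<equiv> (d \<in> outs m) \<noteq> (next_in_face m (next_in_face m d) \<in> outs m)"

context comb_map
begin

lemma same_vertex_conn:
  assumes "x \<in> darts m" "vertex_of m x = vertex_of m y" shows "(x, y) \<in> conn (vertex_rel X)"
proof -
  have "y \<in> orbit (succ m) x" using assms vertex_eq_iff vertex_of_def by (metis in_vertex)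
  then show ?thesis
  proof (induction rule: s.orbit_induct)
    case (step z)
    then have "z \<in> darts m" using assms s.orbit_sub by blast
    then show ?case using conn_vertex_succ step by blast
  qed simp
qed

lemma num_classes_vertex_rel_ge:
  assumes "finite S" shows "card (vertices m) \<le> num_classes (darts m) (vertex_rel S) + card S"
  using assms
proof (induction S)
  case (insert e S)
  have "num_classes (darts m) (vertex_rel S) \<le> num_classes (darts m) (vertex_rel (insert e S)) + 1"
    unfolding vertex_rel_insert by (rule num_classes_insert) (rule finite_darts)
  with insert show ?case by simp
qed (simp add: num_classes_vertices)

text \<open>The contour successor of \<open>opp m d\<close> is \<open>inv (succ m) d\<close>: the
  corner just clockwise of \<open>d\<close> lies in the face to the right of \<open>d\<close>. For a
  union \<open>A\<close> of faces, membership of darts is thus membership of corners.\<close>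

lemma opp_in_iff_inv_succ:
  assumes "\<And>d. d \<in> darts m \<Longrightarrow> next_in_face m d \<in> A \<longleftrightarrow> d \<in> A" "d \<in> darts m"
  shows "opp m d \<in> A \<longleftrightarrow> inv (succ m) d \<in> A"
  using assms(1)[of "opp m d"] assms(2) by (simp add: next_in_face_def)

end

text \<open>The induction rule encodes that \<open>nx\<close> runs through \<open>C\<close> as a
  single cycle. A loop is the case of one dart.\<close>

locale simple_directed_cycle = oriented_planar m for m :: "('d, 'z) oriented_map_scheme" +
  fixes C :: "'d set" and nx :: "'d \<Rightarrow> 'd"
  assumes C_nonempty: "C \<noteq> {}" and C_outs: "C \<subseteq> outs m"
    and inj_vertex: "inj_on (vertex_of m) C"
    and nx_in: "d \<in> C \<Longrightarrow> nx d \<in> C" and inj_nx: "inj_on nx C"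
    and vertex_nx: "d \<in> C \<Longrightarrow> vertex_of m (nx d) = vertex_of m (opp m d)"
    and cycle_induct: "d \<in> C \<Longrightarrow> P d \<Longrightarrow> (\<And>x. x \<in> C \<Longrightarrow> P x \<Longrightarrow> P (nx x)) \<Longrightarrow> e \<in> C \<Longrightarrow> P e"

text \<open>Consider nonempty sets of outgoing darts in which every dart is continued at its head by
  a dart of the set. One of least size is a simple cycle: dropping one of two darts with the same
  origin, or passing to a proper subset closed under \<open>nx\<close>, would give a smaller
  one.\<close>

lemma (in oriented_planar) directed_cycle_exists:
  assumes "\<not> acyclic_orientation m"
  shows "\<exists>C nx. simple_directed_cycle m C nx"
proof -
  let ?V = "vertex_of m"
  define r where "r = {(?V d, ?V (opp m d)) |d. d \<in> outs m}"
  define closed where "closed = (\<lambda>C. \<forall>d\<in>C. \<exists>d'\<in>C. ?V d' = ?V (opp m d))"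
  have "\<exists>C. C \<subseteq> outs m \<and> C \<noteq> {} \<and> closed C"
  proof -
    obtain v where "(v, v) \<in> r\<^sup>+"
      using assms orientation unfolding acyclic_orientation_def acyclic_def r_def by auto
    \<comment> \<open>The darts from whose head a directed walk leads back to their origin; the next
      dart of that walk has the same property.\<close>
    define C where "C = {d \<in> outs m. (?V (opp m d), ?V d) \<in> r\<^sup>*}"
    have step: "\<exists>d'\<in>C. ?V d' = x" if "(x, y) \<in> r" "(y, x) \<in> r\<^sup>*" for x y
      using that by (auto simp: r_def C_def)
    obtain w where "(v, w) \<in> r" "(w, v) \<in> r\<^sup>*" using \<open>(v, v) \<in> r\<^sup>+\<close> tranclD by metis
    then have "C \<noteq> {}" using step by blast
    moreover have "closed C" unfolding closed_def
    proof
      fix d assume d: "d \<in> C"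
      then have d': "d \<in> outs m" "(?V (opp m d), ?V d) \<in> r\<^sup>*" "(?V d, ?V (opp m d)) \<in> r"
        by (auto simp: C_def r_def)
      show "\<exists>d'\<in>C. ?V d' = ?V (opp m d)"
      proof (cases "?V (opp m d) = ?V d")
        case True then show ?thesis using d by metis
      next
        case False
        then obtain y where y: "(?V (opp m d), y) \<in> r" "(y, ?V d) \<in> r\<^sup>*"
          using converse_rtranclE[OF d'(2)] by blast
        have "(y, ?V (opp m d)) \<in> r\<^sup>*"
          by (rule rtrancl.rtrancl_into_rtrancl[OF y(2) d'(3)])
        then show ?thesis by (rule step[OF y(1)])
      qed
    qed
    moreover have "C \<subseteq> outs m" by (auto simp: C_def)
    ultimately show ?thesis by (intro exI[of _ C] conjI)
  qed
  then obtain C0 where C0: "C0 \<subseteq> outs m \<and> C0 \<noteq> {} \<and> closed C0" by blast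
  define C where "C = arg_min card (\<lambda>C. C \<subseteq> outs m \<and> C \<noteq> {} \<and> closed C)"
  have C: "C \<subseteq> outs m \<and> C \<noteq> {} \<and> closed C"
    unfolding C_def by (rule arg_min_natI) (rule C0)
  have least: "card C \<le> card C'" if "C' \<subseteq> outs m \<and> C' \<noteq> {} \<and> closed C'" for C'
    unfolding C_def by (rule arg_min_nat_le) (rule that)
  have finC: "finite C" using C finite_outs finite_subset by blast
  have minimal: "C' = C" if "C' \<subseteq> C" "C' \<noteq> {}" "closed C'" for C'
    using least[of C'] that C finC card_seteq by blast
  define nx where "nx = (\<lambda>d. SOME d'. d' \<in> C \<and> ?V d' = ?V (opp m d))"
  have nx: "nx d \<in> C \<and> ?V (nx d) = ?V (opp m d)" if "d \<in> C" for d
    unfolding nx_def by (rule someI_ex) (use C that in \<open>auto simp: closed_def\<close>)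
  have nx_closed: "S = C" if "S \<subseteq> C" "S \<noteq> {}" "\<And>x. x \<in> S \<Longrightarrow> nx x \<in> S" for S
  proof (rule minimal)
    show "closed S" unfolding closed_def
    proof
      fix d assume "d \<in> S"
      then show "\<exists>d'\<in>S. ?V d' = ?V (opp m d)" using that(1,3) nx[of d] by (intro bexI[of _ "nx d"]) auto
    qed
  qed (use that in auto)
  have "simple_directed_cycle m C nx"
  proof unfold_locales
    show "inj_on ?V C"
    proof (rule inj_onI, rule ccontr)
      fix x y assume xy: "x \<in> C" "y \<in> C" "?V x = ?V y" "x \<noteq> y"
      have "C - {y} = C"
      proof (rule minimal)
        show "closed (C - {y})" unfolding closed_def
        proof
          fix d assume "d \<in> C - {y}"
          then show "\<exists>d'\<in>C - {y}. ?V d' = ?V (opp m d)" using nx[of d] xy by (cases "nx d = y") auto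
        qed
      qed (use xy in auto)
      then show False using xy by blast
    qed
    have "nx ` C = C" by (rule nx_closed) (use nx C in auto)
    then show "inj_on nx C" using finC by (simp add: eq_card_imp_inj_on)
    fix P :: "'d \<Rightarrow> bool" and d e
    assume *: "d \<in> C" "P d" "\<And>x. x \<in> C \<Longrightarrow> P x \<Longrightarrow> P (nx x)" "e \<in> C"
    have "{x\<in>C. P x} = C" by (rule nx_closed) (use * nx in auto)
    then show "P e" using * by blast
  qed (use C nx in auto)
  then show ?thesis by blast
qed

section \<open>The region cut off by a simple directed cycle\<close>

context simple_directed_cycle
begin

lemma C_darts: "d \<in> C \<Longrightarrow> d \<in> darts m"
  using C_outs outs_sub by blast

lemma finite_C: "finite C"
  using C_outs finite_outs finite_subset by blast

text \<open>The remaining darts of the cycle already connect the ends of \<open>d0\<close>, so at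
  most \<open>card C - 1\<close> of its edges merge components.\<close>

lemma num_classes_C: "card (vertices m) + 1 \<le> num_classes (darts m) (vertex_rel C) + card C"
proof -
  obtain d0 where d0: "d0 \<in> C" using C_nonempty by blast
  define S where "S = C - {d0}"
  have C: "C = insert d0 S" "card C = card S + 1" using d0 card_Suc_Diff1[OF finite_C d0] by (auto simp: S_def)
  have base: "(opp m d0, nx d0) \<in> conn (vertex_rel S)"
    using d0 C_darts vertex_nx by (intro same_vertex_conn) auto
  have reach: "(opp m d0, x) \<in> conn (vertex_rel S)" if "x \<in> C" for x
  proof (rule cycle_induct[of "nx d0" "\<lambda>x. (opp m d0, x) \<in> conn (vertex_rel S)", OF nx_in[OF d0] base _ that])
    fix x assume x: "x \<in> C" "(opp m d0, x) \<in> conn (vertex_rel S)"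
    show "(opp m d0, nx x) \<in> conn (vertex_rel S)"
    proof (cases "x = d0")
      case False
      then have "(x, opp m x) \<in> conn (vertex_rel S)"
        using x by (intro conn_base) (auto simp: vertex_rel_def S_def)
      then have "(opp m d0, opp m x) \<in> conn (vertex_rel S)" by (rule conn_trans[OF x(2)])
      moreover have "(opp m x, nx x) \<in> conn (vertex_rel S)"
        using x C_darts vertex_nx by (intro same_vertex_conn) auto
      ultimately show ?thesis by (rule conn_trans)
    qed (use base in simp)
  qed
  have "(d0, opp m d0) \<in> conn (vertex_rel S)"
    by (rule conn_sym) (rule reach[OF d0])
  then have "num_classes (darts m) (vertex_rel C) = num_classes (darts m) (vertex_rel S)"
    unfolding C(1) vertex_rel_insert by (rule num_classes_insert_same)
  moreover have "finite S" using finite_C by (simp add: S_def)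
  ultimately show ?thesis using num_classes_vertex_rel_ge[of S] C(2) by linarith
qed

text \<open>\<open>A\<close> is the union of the faces separated from the outer face by the cycle.\<close>

definition A :: "'d set" where
  "A = {d\<in>darts m. (root m, d) \<notin> conn (face_rel (outs m - C))}"

lemma A_darts: "A \<subseteq> darts m" and root_notin_A: "root m \<notin> A"
  by (auto simp: A_def)

lemma finite_A: "finite A"
  using A_darts finite_darts finite_subset by blast

lemma next_in_A: "d \<in> darts m \<Longrightarrow> next_in_face m d \<in> A \<longleftrightarrow> d \<in> A"
  by (auto simp: A_def conn_face_next)

lemma opp_in_A_inv: "d \<in> darts m \<Longrightarrow> opp m d \<in> A \<longleftrightarrow> inv (succ m) d \<in> A"
  by (rule opp_in_iff_inv_succ) (rule next_in_A)

lemma opp_in_A: "d \<in> darts m \<Longrightarrow> d \<notin> C \<Longrightarrow> opp m d \<notin> C \<Longrightarrow> opp m d \<in> A \<longleftrightarrow> d \<in> A"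
  using conn_face_opp[of d "outs m - C" "root m"] by (auto simp: A_def)

lemma face_A: "d \<in> A \<Longrightarrow> face_of m d \<subseteq> A"
proof
  fix e assume d: "d \<in> A" and "e \<in> face_of m d"
  from this(2) show "e \<in> A" unfolding face_of_def
    by (induction rule: f.orbit_induct) (use d in \<open>auto simp: next_in_A A_darts[THEN subsetD]\<close>)
qed

text \<open>The separating half of the Jordan curve theorem. By \<open>num_classes_C\<close> the
  graph with edge set \<open>C\<close> has one component more than a forest of that size could
  guarantee, and \<open>components_duality\<close> passes the excess on to the dual: without
  \<open>C\<close> it has at least two components.\<close>

lemma A_nonempty: "A \<noteq> {}"
proof
  assume "A = {}"
  then have all: "\<And>d. d \<in> darts m \<Longrightarrow> (root m, d) \<in> conn (face_rel (outs m - C))"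
    by (auto simp: A_def)
  have "num_classes (darts m) (face_rel (outs m - C)) = 1"
    by (rule num_classes_eq_1[OF root_in all])
  moreover have "outs m - (outs m - C) = C" using C_outs by blast
  ultimately show False
    using components_duality[of "outs m - C"] num_classes_C by simp
qed

text \<open>Only edges of \<open>C\<close> separate \<open>A\<close> from its complement, and a
  simple cycle has one outgoing and one ingoing dart at each of its vertices.\<close>

lemma crossing_darts:
  assumes "d \<in> C" "x \<in> darts m" "vertex_of m x = vertex_of m (nx d)" "(x \<in> A) \<noteq> (opp m x \<in> A)"
  shows "x = nx d \<or> x = opp m d"
proof -
  have "x \<in> C \<or> opp m x \<in> C" using opp_in_A[of x] assms by blast
  then show ?thesis
  proof
    assume "x \<in> C" then show ?thesis using inj_vertex assms nx_in by (auto simp: inj_on_def)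
  next
    assume x: "opp m x \<in> C"
    then have "vertex_of m (nx (opp m x)) = vertex_of m (nx d)" using vertex_nx assms by simp
    then have "nx (opp m x) = nx d" using inj_vertex x assms(1) nx_in by (auto simp: inj_on_def)
    then have "opp m x = d" using inj_nx x assms(1) by (auto simp: inj_on_def)
    then show ?thesis by auto
  qed
qed

text \<open>Turning once around a vertex enters \<open>A\<close> as often as it leaves it; the two
  sides of a dart are the corners before and after it.\<close>

lemma boundary_balance:
  assumes "v \<in> vertices m"
  shows "card {x\<in>v. x \<in> A \<and> opp m x \<notin> A} = card {x\<in>v. x \<notin> A \<and> opp m x \<in> A}"
proof -
  obtain x where x: "v = orbit (succ m) x" "x \<in> darts m" using assms by (auto simp: vertices_altdef)
  have bij: "bij_betw (inv (succ m)) v v"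
    unfolding x using s.bij_orbit[of x] by (intro bij_betw_byWitness[where f'="succ m"]) auto
  have "opp m y \<in> A \<longleftrightarrow> inv (succ m) y \<in> A" if "y \<in> v" for y
    using that assms in_vertexD opp_in_A_inv by blast
  then show ?thesis
    using card_up_eq_down[OF finite_vertex[OF assms] bij, of A] by (simp cong: conj_cong)
qed

text \<open>At the head of \<open>d\<close> only \<open>opp m d\<close> and \<open>nx d\<close> can
  cross the boundary of \<open>A\<close>. The first one does, so the balance forces the second to
  cross in the other sense, which puts \<open>A\<close> on the same side of \<open>nx d\<close> as
  of \<open>d\<close>.\<close>

lemma boundary_step:
  assumes d: "d \<in> C" and cross: "(d \<in> A) \<noteq> (opp m d \<in> A)"
  shows "(nx d \<in> A \<longleftrightarrow> d \<in> A) \<and> (opp m (nx d) \<in> A \<longleftrightarrow> opp m d \<in> A)"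
proof -
  let ?v = "vertex_of m (nx d)"
  have dd: "d \<in> darts m" "nx d \<in> darts m" "nx d \<noteq> opp m d"
    using d nx_in C_darts C_outs opp_outs[of d] by (blast, blast, metis subsetD)
  have v: "?v \<in> vertices m" using dd by simp
  have od: "opp m d \<in> ?v" using vertex_nx[OF d] by (metis in_vertex)
  have mem: "x = nx d \<or> x = opp m d" if "x \<in> ?v" "(x \<in> A) \<noteq> (opp m x \<in> A)" for x
    using crossing_darts[OF d, of x] that v in_vertexD by metis
  let ?U = "{x\<in>?v. x \<in> A \<and> opp m x \<notin> A}" and ?W = "{x\<in>?v. x \<notin> A \<and> opp m x \<in> A}"
  have fin: "finite ?U" "finite ?W" using finite_vertex[OF v] by auto
  show ?thesis
  proof (cases "d \<in> A")
    case True
    then have "opp m d \<in> ?W" using cross od by simp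
    then have "card ?W \<noteq> 0" using fin by auto
    then have "card ?U \<noteq> 0" using boundary_balance[OF v] by linarith
    then have "?U \<noteq> {}" by (metis card.empty)
    then obtain x where x: "x \<in> ?U" by blast
    then have "x = nx d" using mem[of x] True cross by auto
    then show ?thesis using x True cross by auto
  next
    case False
    then have "opp m d \<in> ?U" using cross od by simp
    then have "card ?U \<noteq> 0" using fin by auto
    then have "card ?W \<noteq> 0" using boundary_balance[OF v] by linarith
    then have "?W \<noteq> {}" by (metis card.empty)
    then obtain x where x: "x \<in> ?W" by blast
    then have "x = nx d" using mem[of x] False cross by auto
    then show ?thesis using x False cross by auto
  qed
qed

text \<open>Some edge of \<open>C\<close> has \<open>A\<close> on just one side, since the dual
  graph is connected, \<open>A\<close> is nonempty and the root lies outside;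
  \<open>boundary_step\<close> carries its side around the cycle. Either side is possible, as the
  cycle may turn in either sense around the region.\<close>

lemma boundary_side:
  "(\<forall>x\<in>C. x \<in> A \<and> opp m x \<notin> A) \<or> (\<forall>x\<in>C. x \<notin> A \<and> opp m x \<in> A)"
proof -
  have "\<exists>d\<in>C. (d \<in> A) \<noteq> (opp m d \<in> A)"
  proof (rule ccontr)
    assume none: "\<not> ?thesis"
    have "x \<notin> A" if "x \<in> darts m" for x
      using that root_in
    proof (induction rule: dart_induct_face)
      case (opp x)
      then show ?case using opp_in_A[of x] none opp_opp by metis
    qed (use root_notin_A next_in_A in auto)
    then show False using A_nonempty A_darts by blast
  qed
  then obtain d where d: "d \<in> C" "(d \<in> A) \<noteq> (opp m d \<in> A)" by blast
  have "(x \<in> A \<longleftrightarrow> d \<in> A) \<and> (opp m x \<in> A \<longleftrightarrow> opp m d \<in> A)" if "x \<in> C" for x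
    by (rule cycle_induct[OF d(1) _ _ that]) (use d boundary_step in auto)
  then show ?thesis using d(2) by auto
qed

lemma crossing: "x \<in> C \<Longrightarrow> (x \<in> A) \<noteq> (opp m x \<in> A)"
  using boundary_side by blast

section \<open>Interior, boundary and exterior of the region\<close>

definition VI :: "'d set set" where "VI = {v\<in>vertices m. v \<subseteq> A}"
definition VB :: "'d set set" where "VB = {v\<in>vertices m. v \<inter> A \<noteq> {} \<and> \<not> v \<subseteq> A}"
definition VK :: "'d set set" where "VK = {v\<in>vertices m. v \<inter> A = {}}"
definition FA :: "'d set set" where "FA = {f\<in>faces m. f \<subseteq> A}"
text \<open>Since darts stand for corners, \<open>v \<subseteq> A\<close> above means that all
  corners at \<open>v\<close> lie in the region. Here an interior edge is one with both sides in the
  region, represented by its outgoing dart.\<close>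

definition EI :: "'d set" where "EI = {d\<in>outs m. d \<in> A \<and> opp m d \<in> A}"

text \<open>Where the turn around a mixed vertex leaves \<open>A\<close>, it passes an edge of
  \<open>C\<close>; conversely an edge of \<open>C\<close> has a corner of \<open>A\<close> on one
  side only.\<close>

lemma VB_eq: "VB = vertex_of m ` C"
proof (intro subset_antisym subsetI)
  fix v assume v: "v \<in> VB"
  then have vv: "v \<in> vertices m" by (simp add: VB_def)
  have "\<exists>d\<in>v. d \<in> A \<and> succ m d \<notin> A"
  proof (rule ccontr)
    assume none: "\<not> ?thesis"
    obtain y where y: "y \<in> v" "y \<in> A" using v by (auto simp: VB_def)
    then have vy: "v = orbit (succ m) y" using in_vertexD[OF vv] vertex_of_def by metis
    have "z \<in> A" if "z \<in> orbit (succ m) y" for z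
      using that by (induction rule: s.orbit_induct) (use y none vy in auto)
    then show False using v vy by (auto simp: VB_def)
  qed
  then obtain d where d: "d \<in> v" "d \<in> A" "succ m d \<notin> A" by blast
  have dd: "d \<in> darts m" "v = vertex_of m d" using in_vertexD[OF vv d(1)] by auto
  have "opp m (succ m d) \<in> A" using opp_in_A_inv[of "succ m d"] dd d by simp
  then have "succ m d \<in> C \<or> opp m (succ m d) \<in> C" using opp_in_A[of "succ m d"] d dd by auto
  then show "v \<in> vertex_of m ` C"
  proof
    assume "succ m d \<in> C"
    then show ?thesis using dd by (metis imageI vertex_succ)
  next
    assume *: "opp m (succ m d) \<in> C"
    then have "vertex_of m (nx (opp m (succ m d))) = v" using vertex_nx[OF *] dd by simp
    then show ?thesis using nx_in[OF *] by blast
  qed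
next
  fix v assume "v \<in> vertex_of m ` C"
  then obtain d where d: "d \<in> C" "v = vertex_of m d" by blast
  have "(d \<in> A) \<noteq> (inv (succ m) d \<in> A)" using crossing[OF d(1)] opp_in_A_inv C_darts[OF d(1)] by metis
  moreover have "d \<in> v" "inv (succ m) d \<in> v" using d in_vertex vertex_eq_iff vertex_inv_succ by metis+
  ultimately show "v \<in> VB" using C_darts[OF d(1)] d unfolding VB_def by auto
qed

lemma card_VB: "card VB = card C"
  unfolding VB_eq by (rule card_image) (rule inj_vertex)

lemma card_vertices_split: "card (vertices m) = card VI + card VB + card VK"
proof -
  have "vertices m = (VI \<union> VB) \<union> VK" by (auto simp: VI_def VB_def VK_def)
  moreover have "VI \<inter> VB = {}" by (auto simp: VI_def VB_def)
  moreover have "(VI \<union> VB) \<inter> VK = {}"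
  proof -
    have "v \<noteq> {}" if "v \<in> vertices m" for v using that in_vertex unfolding vertices_def by blast
    then show ?thesis by (auto simp: VI_def VB_def VK_def)
  qed
  moreover have "finite VI" "finite VB" "finite VK" using finite_vertices by (auto simp: VI_def VB_def VK_def)
  ultimately show ?thesis by (metis card_Un_disjoint finite_Un)
qed

lemma outs_A_split:
  "(\<forall>x\<in>C. x \<in> A \<and> opp m x \<notin> A) \<Longrightarrow> {d\<in>outs m. d \<in> A} = EI \<union> C \<and> {d\<in>outs m. opp m d \<in> A} = EI"
  "(\<forall>x\<in>C. x \<notin> A \<and> opp m x \<in> A) \<Longrightarrow> {d\<in>outs m. d \<in> A} = EI \<and> {d\<in>outs m. opp m d \<in> A} = EI \<union> C"
proof -
  have *: "opp m d \<in> A \<longleftrightarrow> d \<in> A" if "d \<in> outs m" "d \<notin> C" for d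
    using that opp_in_A[of d] C_outs outs_sub opp_outs by blast
  show "(\<forall>x\<in>C. x \<in> A \<and> opp m x \<notin> A) \<Longrightarrow> {d\<in>outs m. d \<in> A} = EI \<union> C \<and> {d\<in>outs m. opp m d \<in> A} = EI"
    "(\<forall>x\<in>C. x \<notin> A \<and> opp m x \<in> A) \<Longrightarrow> {d\<in>outs m. d \<in> A} = EI \<and> {d\<in>outs m. opp m d \<in> A} = EI \<union> C"
    unfolding EI_def using * C_outs by blast+
qed

lemma EI_C: "EI \<inter> C = {}" "finite EI"
  using crossing finite_outs by (auto simp: EI_def)

text \<open>The corners of the region counted by edges: an interior edge has both of its sides in
  \<open>A\<close>, an edge of the cycle one.\<close>

lemma card_A: "card A = 2 * card EI + card C"
proof -
  have "card A = card ({d\<in>outs m. d \<in> A} \<union> (A - outs m))"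
    by (rule arg_cong[of _ _ card]) auto
  also have "\<dots> = card {d\<in>outs m. d \<in> A} + card (A - outs m)"
    using finite_outs finite_A by (intro card_Un_disjoint) auto
  also have "card (A - outs m) = card {d\<in>outs m. opp m d \<in> A}"
  proof (rule bij_betw_same_card)
    show "bij_betw (opp m) (A - outs m) {d\<in>outs m. opp m d \<in> A}"
      by (rule bij_betw_byWitness[where f'="opp m"]) (use A_darts outs_sub in auto)
  qed
  also have "card {d\<in>outs m. d \<in> A} + card {d\<in>outs m. opp m d \<in> A} = 2 * card EI + card C"
    using boundary_side outs_A_split card_Un_disjoint[OF EI_C(2) finite_C EI_C(1)] by auto
  finally show ?thesis .
qed

text \<open>The edges with both sides outside the region. Their complement consists of the interior
  edges and the cycle, which is the split to which \<open>components_duality\<close> is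
  applied.\<close>

definition Y :: "'d set" where "Y = {d\<in>outs m. d \<notin> A \<and> opp m d \<notin> A}"

lemma card_outs_Y: "card (outs m - Y) = card EI + card C"
proof -
  have "outs m - Y = {d\<in>outs m. d \<in> A} \<union> {d\<in>outs m. opp m d \<in> A}" by (auto simp: Y_def)
  also have "\<dots> = EI \<union> C" using boundary_side outs_A_split by auto
  finally show ?thesis using card_Un_disjoint[OF EI_C(2) finite_C EI_C(1)] by simp
qed

text \<open>No edge of the closed region touches an exterior vertex, so each of these is a component
  of its own; the component of a corner of \<open>A\<close> is one more.\<close>

lemma vertex_components: "card VK + 1 \<le> num_classes (darts m) (vertex_rel (outs m - Y))"
proof -
  let ?R = "vertex_rel (outs m - Y)"
  obtain a where a: "a \<in> A" using A_nonempty by blast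
  have cls: "conn ?R `` {d} = vertex_of m d" if d: "d \<in> darts m" "vertex_of m d \<inter> A = {}" for d
  proof (intro set_eqI iffI)
    fix e assume "e \<in> vertex_of m d"
    then have "vertex_of m d = vertex_of m e" using vertex_eq_iff by metis
    then show "e \<in> conn ?R `` {d}" using same_vertex_conn[OF d(1)] by simp
  next
    fix e assume "e \<in> conn ?R `` {d}"
    then have "(d, e) \<in> conn ?R" by simp
    then have "d \<in> vertex_of m d \<longleftrightarrow> e \<in> vertex_of m d"
    proof (rule conn_invariant)
      fix x y assume "(x, y) \<in> ?R"
      then consider "x \<in> darts m" "y = succ m x" | "x \<in> outs m - Y" "y = opp m x"
        by (auto simp: vertex_rel_def)
      then show "x \<in> vertex_of m d \<longleftrightarrow> y \<in> vertex_of m d"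
      proof cases
        case 1 then show ?thesis by (simp flip: vertex_eq_iff)
      next
        case 2
        then have xa: "x \<in> darts m" "x \<in> A \<or> opp m x \<in> A" using outs_sub by (auto simp: Y_def)
        have "z \<notin> vertex_of m d" if "z \<in> darts m" "z \<in> A \<or> opp m z \<in> A" for z
        proof
          assume z: "z \<in> vertex_of m d"
          then have "inv (succ m) z \<in> vertex_of m d" by (metis vertex_eq_iff vertex_inv_succ)
          then show False using z d(2) that opp_in_A_inv[OF that(1)] by blast
        qed
        from this[of x] this[of y] xa 2 show ?thesis by auto
      qed
    qed
    then show "e \<in> vertex_of m d" by simp
  qed
  have "insert (conn ?R `` {a}) VK \<subseteq> (\<lambda>x. conn ?R `` {x}) ` darts m"
  proof (intro insert_subsetI subsetI)
    fix v assume v: "v \<in> VK"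
    then obtain d where "d \<in> darts m" "v = vertex_of m d" by (auto simp: VK_def vertices_def)
    moreover from this have "v = conn ?R `` {d}" using v cls by (simp add: VK_def)
    ultimately show "v \<in> (\<lambda>x. conn ?R `` {x}) ` darts m" by blast
  qed (use a A_darts in auto)
  then have "card (insert (conn ?R `` {a}) VK) \<le> num_classes (darts m) ?R"
    unfolding num_classes_def by (rule card_mono[rotated]) (use finite_darts in simp)
  moreover have "conn ?R `` {a} \<notin> VK"
  proof -
    have "a \<in> conn ?R `` {a}" by simp
    then show ?thesis using a unfolding VK_def by blast
  qed
  moreover have "finite VK" using finite_vertices by (simp add: VK_def)
  ultimately show ?thesis by simp
qed

text \<open>Exterior edges do not touch the faces of \<open>A\<close>, so these are isolated in the
  dual graph. All other darts form one class: a dual walk from the root that avoids \<open>C\<close>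
  never enters \<open>A\<close>, hence uses exterior edges only.\<close>

lemma face_components: "num_classes (darts m) (face_rel Y) \<le> card FA + 1"
proof -
  let ?R = "face_rel Y"
  have cls: "conn ?R `` {d} = face_of m d" if d: "d \<in> A" for d
  proof (intro set_eqI iffI)
    fix e assume "e \<in> face_of m d"
    then have "e \<in> conn {(d, next_in_face m d) |d. d \<in> darts m} `` {d}"
      using f.conn_perm[of d] d A_darts by (auto simp: face_of_def)
    then have "(d, e) \<in> conn {(d, next_in_face m d) |d. d \<in> darts m}" by simp
    then have "(d, e) \<in> conn ?R" by (rule conn_mono[rotated]) (auto simp: face_rel_def)
    then show "e \<in> conn ?R `` {d}" by simp
  next
    fix e assume "e \<in> conn ?R `` {d}"
    then have "(d, e) \<in> conn ?R" by simp
    then have "d \<in> face_of m d \<longleftrightarrow> e \<in> face_of m d"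
    proof (rule conn_invariant)
      fix x y assume "(x, y) \<in> ?R"
      then consider "x \<in> darts m" "y = next_in_face m x" | "x \<in> Y" "y = opp m x"
        by (auto simp: face_rel_def)
      then show "x \<in> face_of m d \<longleftrightarrow> y \<in> face_of m d"
      proof cases
        case 1 then show ?thesis by (simp flip: face_eq_iff)
      next
        case 2 then show ?thesis using face_A[OF d] by (auto simp: Y_def)
      qed
    qed
    then show "e \<in> face_of m d" by simp
  qed
  have root: "(root m, d) \<in> conn ?R" if "d \<in> darts m" "d \<notin> A" for d
  proof -
    have "(root m, d) \<in> conn (face_rel (outs m - C))" using that by (auto simp: A_def)
    then have "(root m \<notin> A \<and> (root m, root m) \<in> conn ?R) \<longleftrightarrow> (d \<notin> A \<and> (root m, d) \<in> conn ?R)"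
    proof (rule conn_invariant)
      fix x y assume "(x, y) \<in> face_rel (outs m - C)"
      then consider "x \<in> darts m" "y = next_in_face m x" | "x \<in> outs m - C" "y = opp m x"
        by (auto simp: face_rel_def)
      then show "(x \<notin> A \<and> (root m, x) \<in> conn ?R) \<longleftrightarrow> (y \<notin> A \<and> (root m, y) \<in> conn ?R)"
      proof cases
        case 1 then show ?thesis by (simp add: next_in_A conn_face_next)
      next
        case 2
        then have "x \<in> darts m" "x \<notin> C" "opp m x \<notin> C"
          using outs_sub C_outs opp_outs by blast+
        then have "y \<in> A \<longleftrightarrow> x \<in> A" using opp_in_A 2 by simp
        moreover have "(root m, opp m x) \<in> conn ?R \<longleftrightarrow> (root m, x) \<in> conn ?R" if "x \<notin> A"
          using that 2 \<open>y \<in> A \<longleftrightarrow> x \<in> A\<close> by (intro conn_face_opp) (auto simp: Y_def)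
        ultimately show ?thesis using 2 by auto
      qed
    qed
    then show ?thesis using root_notin_A by simp
  qed
  have "(\<lambda>x. conn ?R `` {x}) ` darts m \<subseteq> insert (conn ?R `` {root m}) FA"
  proof (intro subsetI, elim imageE)
    fix X d assume X: "X = conn ?R `` {d}" "d \<in> darts m"
    show "X \<in> insert (conn ?R `` {root m}) FA"
    proof (cases "d \<in> A")
      case True
      then have "X \<in> FA" using X cls[OF True] face_A[OF True] by (simp add: FA_def)
      then show ?thesis by simp
    next
      case False
      then have "conn ?R `` {root m} = X" unfolding X(1) conn_class_eq using root X by blast
      then show ?thesis by blast
    qed
  qed
  moreover have fin: "finite FA" using finite_faces by (simp add: FA_def)
  ultimately have "num_classes (darts m) ?R \<le> card (insert (conn ?R `` {root m}) FA)"
    unfolding num_classes_def by (intro card_mono) auto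
  also have "\<dots> \<le> card FA + 1" using fin by (simp add: card_insert_if)
  finally show ?thesis .
qed

text \<open>In \<open>components_duality\<close> for \<open>Y\<close> the exterior vertices cancel,
  and so do the equally many boundary edges and vertices. What remains is one half of Euler's
  formula for a disk.\<close>

lemma euler_excess: "card EI + 1 \<le> card FA + card VI"
  using components_duality[of Y] card_outs_Y vertex_components face_components
    card_vertices_split card_VB by (simp add: Y_def)

text \<open>If no corner of \<open>A\<close> at \<open>v\<close> were a change, turning by
  \<open>succ m\<close> would match the outgoing darts with \<open>A\<close> on the left to those
  with \<open>A\<close> on the right. But the dart \<open>c\<close> of the cycle is the only
  outgoing dart at \<open>v\<close> with \<open>A\<close> on just one side, so these numbers differ
  by one.\<close>

lemma boundary_vertex_change:
  assumes "v \<in> VB"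
  shows "\<exists>d\<in>v. d \<in> A \<and> vertex_change m d"
proof (rule ccontr)
  assume none: "\<not> ?thesis"
  have v: "v \<in> vertices m" using assms by (simp add: VB_def)
  obtain c where c: "c \<in> C" "v = vertex_of m c" using assms unfolding VB_eq by blast
  have c': "c \<in> v" "c \<in> outs m" using c C_outs by auto
  have fin: "finite v" using v finite_vertex by blast
  have vD: "x \<in> darts m" "succ m x \<in> v" "inv (succ m) x \<in> v" if "x \<in> v" for x
  proof -
    show "x \<in> darts m" using that v in_vertexD by blast
    have "v = vertex_of m x" using that v in_vertexD by blast
    then show "succ m x \<in> v" "inv (succ m) x \<in> v" by (metis in_vertex vertex_succ vertex_inv_succ)+
  qed
  have "card {x\<in>v. x \<in> A \<and> x \<in> outs m} = card {x\<in>v. x \<in> A \<and> succ m x \<in> outs m}"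
    by (rule arg_cong[of _ _ card]) (use none in blast)
  also have "\<dots> = card {x\<in>v. opp m x \<in> A \<and> x \<in> outs m}"
  proof (rule bij_betw_same_card)
    show "bij_betw (succ m) {x\<in>v. x \<in> A \<and> succ m x \<in> outs m} {x\<in>v. opp m x \<in> A \<and> x \<in> outs m}"
      by (rule bij_betw_byWitness[where f'="inv (succ m)"]) (auto simp: opp_in_A_inv vD)
  qed
  finally have eq: "card {x\<in>v. x \<in> A \<and> x \<in> outs m} = card {x\<in>v. opp m x \<in> A \<and> x \<in> outs m}" .
  let ?S = "{x\<in>v. x \<in> A \<and> x \<in> outs m}" and ?T = "{x\<in>v. opp m x \<in> A \<and> x \<in> outs m}"
  have other: "opp m x \<in> A \<longleftrightarrow> x \<in> A" if x: "x \<in> v" "x \<in> outs m" "x \<noteq> c" for x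
  proof (rule opp_in_A)
    show "x \<in> darts m" using vD x by blast
    show "x \<notin> C" using x c inj_vertex v in_vertexD by (metis inj_onD)
    show "opp m x \<notin> C" using x C_outs opp_outs vD by blast
  qed
  show False
  proof (cases "c \<in> A")
    case True
    then have "?S = insert c ?T" "c \<notin> ?T" using other crossing[OF c(1)] c' by blast+
    then show False using eq fin by simp
  next
    case False
    then have "?T = insert c ?S" "c \<notin> ?S" using other crossing[OF c(1)] c' by blast+
    then show False using eq fin by simp
  qed
qed

end

section \<open>Corners as direction changes\<close>

context comb_map
begin

text \<open>The corner of \<open>next_in_face m e\<close> lies between that dart and
  \<open>opp m e\<close>. It is a change at the vertex iff \<open>e\<close> and
  \<open>next_in_face m e\<close> are oriented alike, that is, iff there is no change along the face
  at \<open>e\<close>. The shift by \<open>next_in_face m\<close> thus makes the two kinds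
  complementary on \<open>A\<close>.\<close>

lemma closed_corner_count:
  fixes P :: "'d set"
  assumes "A \<subseteq> darts m" "\<And>d. d \<in> darts m \<Longrightarrow> next_in_face m d \<in> A \<longleftrightarrow> d \<in> A"
    and opp: "\<And>d. d \<in> darts m \<Longrightarrow> opp m d \<in> P \<longleftrightarrow> d \<notin> P"
  shows "card {d\<in>A. (d \<in> P) \<noteq> (succ m d \<in> P)} + card {d\<in>A. (d \<in> P) \<noteq> (next_in_face m d \<in> P)} = card A"
proof -
  have finA: "finite A" using assms(1) finite_darts finite_subset by blast
  have "card {d\<in>A. (d \<in> P) \<noteq> (next_in_face m d \<in> P)} = card {d\<in>A. (d \<in> P) = (succ m d \<in> P)}"
  proof (rule bij_betw_same_card[of "next_in_face m"], rule bij_betw_byWitness[where f'="inv (next_in_face m)"])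
    show "next_in_face m ` {d\<in>A. (d \<in> P) \<noteq> (next_in_face m d \<in> P)} \<subseteq> {d\<in>A. (d \<in> P) = (succ m d \<in> P)}"
      using assms by (auto simp: subset_iff)
    show "inv (next_in_face m) ` {d\<in>A. (d \<in> P) = (succ m d \<in> P)} \<subseteq> {d\<in>A. (d \<in> P) \<noteq> (next_in_face m d \<in> P)}"
    proof
      fix x assume "x \<in> inv (next_in_face m) ` {d\<in>A. (d \<in> P) = (succ m d \<in> P)}"
      then obtain d where d: "x = inv (next_in_face m) d" "d \<in> A" "(d \<in> P) = (succ m d \<in> P)" by blast
      have "x \<in> A" using assms(2)[of x] assms(1) d by auto
      moreover have "x \<in> P \<longleftrightarrow> succ m d \<notin> P" using opp[of "succ m d"] d assms(1) by (auto simp: opp_succ)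
      ultimately show "x \<in> {d\<in>A. (d \<in> P) \<noteq> (next_in_face m d \<in> P)}" using d by auto
    qed
  qed auto
  moreover have "card A = card {d\<in>A. (d \<in> P) \<noteq> (succ m d \<in> P)} + card {d\<in>A. (d \<in> P) = (succ m d \<in> P)}"
    using finA by (subst card_Un_disjoint[symmetric]) (auto intro!: arg_cong[of _ _ card])
  ultimately show ?thesis by simp
qed

lemma vertex_two_changes:
  assumes "v \<in> vertices m" "\<not> v \<subseteq> P" "v \<inter> P \<noteq> {}"
  shows "card {d\<in>v. (d \<in> P) \<noteq> (succ m d \<in> P)} \<ge> 2"
  using assms s.two_changes unfolding vertices_altdef by blast

lemma face_two_changes:
  assumes "f \<in> faces m" "\<not> f \<subseteq> P" "f \<inter> P \<noteq> {}"
  shows "card {d\<in>f. (d \<in> P) \<noteq> (next_in_face m d \<in> P)} \<ge> 2"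
  using assms f.two_changes unfolding faces_altdef by blast

end

lemma (in oriented_planar) acyclicI:
  assumes faces: "\<And>f. f \<in> inner_faces m \<Longrightarrow> \<not> f \<subseteq> outs m \<and> f \<inter> outs m \<noteq> {}"
    and verts: "\<And>v. v \<in> inner_vertices m \<Longrightarrow> \<not> v \<subseteq> outs m \<and> v \<inter> outs m \<noteq> {}"
  shows "acyclic_orientation m"
proof (rule ccontr)
  assume "\<not> acyclic_orientation m"
  then obtain C nx where "simple_directed_cycle m C nx" using directed_cycle_exists by blast
  then interpret simple_directed_cycle m C nx .
  have outer: "d \<notin> A" if "d \<in> outer_face m" for d
  proof
    assume "d \<in> A"
    then have "face_of m d \<subseteq> A" by (rule face_A)
    moreover have "face_of m d = face_of m (root m)" using that face_eq_iff by (simp add: outer_face_def)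
    ultimately show False using root_notin_A in_face by blast
  qed
  have "2 * card FA \<le> card {d\<in>A. face_change m d}"
  proof -
    let ?c = "\<lambda>f. card {d\<in>f. d \<in> A \<and> face_change m d}"
    have "2 * card FA = (\<Sum>f\<in>FA. 2)" by simp
    also have "\<dots> \<le> sum ?c FA"
    proof (rule sum_mono)
      fix f assume f: "f \<in> FA"
      then have "f \<in> faces m" "f \<subseteq> A" by (auto simp: FA_def)
      moreover from this have "f \<in> inner_faces m"
        using outer in_face[of "root m"] unfolding inner_faces_def outer_face_def by blast
      moreover have "{d\<in>f. d \<in> A \<and> face_change m d}
          = {d\<in>f. face_change m d}" using \<open>f \<subseteq> A\<close> by blast
      ultimately show "2 \<le> ?c f" using face_two_changes faces by simp
    qed
    also have "\<dots> \<le> sum ?c (faces m)"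
      using finite_faces by (intro sum_mono2) (auto simp: FA_def)
    also have "\<dots> = card {d\<in>darts m. d \<in> A \<and> face_change m d}"
      by (rule sum_card_faces)
    also have "\<dots> = card {d\<in>A. face_change m d}"
      using A_darts by (intro arg_cong[of _ _ card]) blast
    finally show ?thesis .
  qed
  moreover have "2 * card VI + card VB \<le> card {d\<in>A. vertex_change m d}"
  proof -
    let ?c = "\<lambda>v. card {d\<in>v. d \<in> A \<and> vertex_change m d}"
    have fin: "finite VI" "finite VB" using finite_vertices by (auto simp: VI_def VB_def)
    have "2 * card VI + card VB = (\<Sum>v\<in>VI. 2) + (\<Sum>v\<in>VB. 1)" by simp
    also have "\<dots> \<le> sum ?c VI + sum ?c VB"
    proof (intro add_mono sum_mono)
      fix v assume v: "v \<in> VI"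
      then have vA: "v \<in> vertices m" "v \<subseteq> A" by (auto simp: VI_def)
      \<comment> \<open>An outer vertex has a corner in the outer face, hence outside
        \<open>A\<close>. This keeps a source or a sink on the outer face out of the count.\<close>
      have "v \<in> inner_vertices m" unfolding inner_vertices_def outer_vertices_def
        using vA outer in_vertex by blast
      moreover have "{d\<in>v. d \<in> A \<and> vertex_change m d}
          = {d\<in>v. vertex_change m d}" using vA by blast
      ultimately show "2 \<le> ?c v" using vertex_two_changes verts vA by simp
    next
      fix v assume v: "v \<in> VB"
      then have "finite v" using finite_vertex by (simp add: VB_def)
      moreover have "{d\<in>v. d \<in> A \<and> vertex_change m d} \<noteq> {}"
        using boundary_vertex_change[OF v] by blast
      ultimately have "?c v \<noteq> 0" by simp
      then show "1 \<le> ?c v" by linarith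
    qed
    also have "\<dots> = sum ?c (VI \<union> VB)"
      using fin by (subst sum.union_disjoint) (auto simp: VI_def VB_def)
    also have "\<dots> \<le> sum ?c (vertices m)"
      using finite_vertices by (intro sum_mono2) (auto simp: VI_def VB_def)
    also have "\<dots> = card {d\<in>darts m. d \<in> A \<and> vertex_change m d}"
      by (rule sum_card_vertices)
    also have "\<dots> = card {d\<in>A. vertex_change m d}"
      using A_darts by (intro arg_cong[of _ _ card]) blast
    finally show ?thesis .
  qed
  moreover have "card {d\<in>A. vertex_change m d}
      + card {d\<in>A. face_change m d} = card A"
    by (rule closed_corner_count) (use A_darts next_in_A in auto)
  ultimately show False using euler_excess card_A card_VB by linarith
qed

section \<open>Local description of P-admissible orientations\<close>

lemma (in finite_perm) orbit_period:
  obtains n where "0 < n" "(g ^^ n) y = y" "inj_on (\<lambda>k. (g ^^ k) y) {..<n}"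
    "orbit g y = (\<lambda>k. (g ^^ k) y) ` {..<n}"
proof -
  have "\<exists>n>0. (g ^^ n) y = y" using self_orbit[of y] unfolding orbit_altdef by force
  define n where "n = (LEAST n. 0 < n \<and> (g ^^ n) y = y)"
  have n: "0 < n \<and> (g ^^ n) y = y"
    unfolding n_def by (rule LeastI_ex) (use \<open>\<exists>n>0. (g ^^ n) y = y\<close> in blast)
  have n_least: "(g ^^ k) y \<noteq> y" if "0 < k" "k < n" for k
    using not_less_Least[of k "\<lambda>n. 0 < n \<and> (g ^^ n) y = y"] that unfolding n_def by blast
  have inj: "inj_on (\<lambda>k. (g ^^ k) y) {..<n}"
    using inj_on_funpow_least[of n g y] n n_least by (simp add: atLeast0LessThan)
  have orb_eq: "orbit g y = (\<lambda>k. (g ^^ k) y) ` {..<n}"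
    using orbit_altdef_bounded[of n g y] n by auto
  show thesis using that n inj orb_eq by blast
qed

text \<open>Two changes cut the cyclic orbit into one block inside \<open>P\<close> and one outside.
  Their lengths are written \<open>j + 1\<close> and \<open>i + 1\<close> to agree with the type of
  a face.\<close>

lemma (in finite_perm) two_changes_interval:
  assumes "card {d\<in>orbit g x. (d \<in> P) \<noteq> (g d \<in> P)} = 2"
  obtains y j i where "y \<in> orbit g x" "orbit g x = (\<lambda>k. (g ^^ k) y) ` {..<j + i + 2}"
    "inj_on (\<lambda>k. (g ^^ k) y) {..<j + i + 2}" "(g ^^ (j + i + 2)) y = y"
    "\<And>k. k \<le> j \<Longrightarrow> (g ^^ k) y \<in> P" "\<And>k. j < k \<Longrightarrow> k < j + i + 2 \<Longrightarrow> (g ^^ k) y \<notin> P"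
proof -
  have "card {d\<in>orbit g x. d \<notin> P \<and> g d \<in> P} = 1"
    using assms card_changes[OF finite_orbit' bij_orbit, of x P]
      card_up_eq_down[OF finite_orbit' bij_orbit, of x P] by simp
  \<comment> \<open>\<open>w\<close> is the only point from which \<open>P\<close> is entered, so
    the block inside \<open>P\<close> starts at its image \<open>y\<close>.\<close>
  then obtain w where w: "{d\<in>orbit g x. d \<notin> P \<and> g d \<in> P} = {w}" by (rule card_1_singletonE)
  define y where "y = g w"
  have y: "y \<in> orbit g x" "y \<in> P" "w \<notin> P" "g w = y" using w by (auto simp: y_def)
  have orb: "orbit g x = orbit g y" using orbit_eqI[OF y(1)] by simp
  obtain n where n0: "0 < n" "(g ^^ n) y = y" and inj: "inj_on (\<lambda>k. (g ^^ k) y) {..<n}"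
    and orb_eq: "orbit g y = (\<lambda>k. (g ^^ k) y) ` {..<n}"
    by (rule orbit_period)
  then have n: "0 < n \<and> (g ^^ n) y = y" by blast
  have "g ((g ^^ (n - 1)) y) = g w" using n y by (metis Suc_diff_1 comp_apply funpow.simps(2))
  then have last: "(g ^^ (n - 1)) y = w" by simp
  define j where "j = (LEAST k. (g ^^ Suc k) y \<notin> P)"
  have "n \<noteq> 1" using last y by auto
  then have ex: "(g ^^ Suc (n - 2)) y \<notin> P" using last y n by (metis Suc_1 Suc_diff_Suc Suc_lessI One_nat_def)
  have j: "(g ^^ Suc j) y \<notin> P" unfolding j_def by (rule LeastI) (rule ex)
  have "j \<le> n - 2" unfolding j_def by (rule Least_le) (rule ex)
  then obtain i where i: "n = j + i + 2" using n \<open>n \<noteq> 1\<close> by (metis add.assoc add.commute le_add_diff_inverse2 le_Suc_ex One_nat_def Suc_1 Suc_leI less_Suc_eq_le not_less_eq_eq nat_neq_iff)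
  have up: "(g ^^ k) y \<in> P" if "k \<le> j" for k
  proof (cases k)
    case (Suc k')
    then show ?thesis using not_less_Least[of k' "\<lambda>k. (g ^^ Suc k) y \<notin> P"] that unfolding j_def by auto
  qed (use y in simp)
  \<comment> \<open>Returning to \<open>P\<close> before the period is over would be an entry from a
    point other than \<open>w\<close>, which is the last of the orbit.\<close>
  have down: "Suc j + l < n \<Longrightarrow> (g ^^ (Suc j + l)) y \<notin> P" for l
  proof (induction l)
    case (Suc l)
    show ?case
    proof
      assume "(g ^^ (Suc j + Suc l)) y \<in> P"
      moreover have "(g ^^ (Suc j + l)) y \<in> orbit g x" by (rule funpow_in_orbit) (rule y(1))
      moreover have "(g ^^ (Suc j + l)) y \<notin> P" using Suc by simp
      ultimately have "(g ^^ (Suc j + l)) y \<in> {d\<in>orbit g x. d \<notin> P \<and> g d \<in> P}"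
        by simp
      then have "(g ^^ (Suc j + l)) y = (g ^^ (n - 1)) y" unfolding w last by simp
      then have "Suc j + l = n - 1" using inj_onD[OF inj] Suc.prems by simp
      then show False using Suc.prems by simp
    qed
  qed (use j in simp)
  show thesis
  proof (rule that[of y j i])
    fix k assume "j < k" "k < j + i + 2"
    then show "(g ^^ k) y \<notin> P" using down[of "k - Suc j"] i by simp
  qed (use y orb orb_eq inj n up i in auto)
qed

section \<open>Lateral paths of a face\<close>

lemma directed_path_append:
  "directed_path m u (xs @ ys) v \<longleftrightarrow> (\<exists>w. directed_path m u xs w \<and> directed_path m w ys v)"
  by (induction xs arbitrary: u) auto

lemma directed_path_map:
  assumes "\<And>k. k \<le> n \<Longrightarrow> h k \<in> outs m"
    "\<And>k. k < n \<Longrightarrow> vertex_of m (opp m (h k)) = vertex_of m (h (Suc k))"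
  shows "directed_path m (vertex_of m (h 0)) (map h [0..<Suc n]) (vertex_of m (opp m (h n)))"
  using assms
proof (induction n)
  case (Suc n)
  then have "directed_path m (vertex_of m (h 0)) (map h [0..<Suc n]) (vertex_of m (opp m (h n)))"
    by simp
  then have "directed_path m (vertex_of m (h 0)) (map h [0..<Suc n] @ [h (Suc n)]) (vertex_of m (opp m (h (Suc n))))"
    unfolding directed_path_append using Suc.prems by auto
  then show ?case by simp
qed simp

abbreviation vertex_changes :: "('d, 'z) oriented_map_scheme \<Rightarrow> 'd set \<Rightarrow> nat" where
  "vertex_changes m v \<equiv> card {d\<in>v. vertex_change m d}"

abbreviation face_changes :: "('d, 'z) oriented_map_scheme \<Rightarrow> 'd set \<Rightarrow> nat" where
  "face_changes m f \<equiv> card {d\<in>f. face_change m d}"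

context oriented_planar
begin

text \<open>The outgoing block of the contour has the face on its left and is the right lateral
  path; the ingoing block, read backwards with every dart reversed, is the left lateral path. The
  top vertex is the origin of the first ingoing dart.\<close>

lemma face_interval:
  assumes f: "f \<in> faces m" and two: "face_changes m f = 2"
  obtains y j i where "y \<in> f" "f = (\<lambda>k. (next_in_face m ^^ k) y) ` {..<j + i + 2}"
    "\<And>k. k \<le> j \<Longrightarrow> (next_in_face m ^^ k) y \<in> outs m"
    "\<And>k. j < k \<Longrightarrow> k < j + i + 2 \<Longrightarrow> (next_in_face m ^^ k) y \<notin> outs m"
    "card f = j + i + 2"
    "\<exists>ls rs. path_on_right m f (vertex_of m y) (vertex_of m ((next_in_face m ^^ Suc j) y)) ls \<and>
       path_on_left m f (vertex_of m y) (vertex_of m ((next_in_face m ^^ Suc j) y)) rs \<and>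
       length ls = i + 1 \<and> length rs = j + 1"
proof -
  let ?n = "next_in_face m" and ?V = "vertex_of m"
  obtain x where x: "x \<in> darts m" "f = orbit ?n x" using f by (auto simp: faces_altdef)
  obtain y j i where y: "y \<in> f" and f_eq: "f = (\<lambda>k. (?n ^^ k) y) ` {..<j + i + 2}"
    and inj: "inj_on (\<lambda>k. (?n ^^ k) y) {..<j + i + 2}" and period: "(?n ^^ (j + i + 2)) y = y"
    and up: "\<And>k. k \<le> j \<Longrightarrow> (?n ^^ k) y \<in> outs m"
    and down: "\<And>k. j < k \<Longrightarrow> k < j + i + 2 \<Longrightarrow> (?n ^^ k) y \<notin> outs m"
    by (rule f.two_changes_interval[OF two[unfolded x(2)], folded x(2)]) (rule that; blast)
  have yD: "(?n ^^ k) y \<in> darts m" for k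
  proof -
    have "y \<in> darts m" using y f in_faceD by blast
    then show ?thesis by (induction k) auto
  qed
  have in_f: "face_of m d = f \<longleftrightarrow> d \<in> f" if "d \<in> darts m" for d
    using that f in_faceD in_face by metis
  \<comment> \<open>The ingoing block from its end: \<open>h 0\<close> starts at the origin of
    \<open>y\<close>, the bottom vertex, and \<open>h i\<close> is the reverse of the first ingoing
    dart and ends at the top.\<close>
  define h where "h = (\<lambda>k. opp m ((?n ^^ (j + i + 1 - k)) y))"
  define rs where "rs = map (\<lambda>k. (?n ^^ k) y) [0..<Suc j]"
  define ls where "ls = map h [0..<Suc i]"
  have "directed_path m (?V ((?n ^^ 0) y)) rs (?V (opp m ((?n ^^ j) y)))"
    unfolding rs_def by (rule directed_path_map) (use up in auto)
  then have rs: "directed_path m (?V y) rs (?V ((?n ^^ Suc j) y))" by simp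
  have "directed_path m (?V (h 0)) ls (?V (opp m (h i)))"
    unfolding ls_def
  proof (rule directed_path_map)
    fix k assume "k \<le> i"
    then show "h k \<in> outs m" using down[of "j + i + 1 - k"] yD by (simp add: h_def)
  next
    fix k assume "k < i"
    then have "j + i + 1 - k = Suc (j + i + 1 - Suc k)" by simp
    then have "?V (opp m (h k)) = ?V (?n ((?n ^^ (j + i + 1 - Suc k)) y))"
      unfolding h_def by (simp only: opp_opp funpow.simps comp_apply)
    then show "?V (opp m (h k)) = ?V (h (Suc k))" by (simp add: h_def)
  qed
  moreover have "?V (h 0) = ?V y"
  proof -
    have "?n ((?n ^^ (j + i + 1)) y) = y" using period by simp
    then show ?thesis unfolding h_def by (metis vertex_next diff_zero)
  qed
  moreover have "opp m (h i) = (?n ^^ Suc j) y" by (simp add: h_def)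
  ultimately have ls: "directed_path m (?V y) ls (?V ((?n ^^ Suc j) y))" by simp
  have "distinct rs" unfolding rs_def distinct_map
    by (intro conjI inj_on_subset[OF inj]) auto
  moreover have "distinct ls"
    unfolding ls_def distinct_map
  proof (intro conjI inj_onI)
    fix k l assume "k \<in> set [0..<Suc i]" "l \<in> set [0..<Suc i]" "h k = h l"
    then have kl: "k \<le> i" "l \<le> i"
      and eq: "(?n ^^ (j + i + 1 - k)) y = (?n ^^ (j + i + 1 - l)) y" by (auto simp: h_def)
    have "j + i + 1 - k \<in> {..<j + i + 2}" "j + i + 1 - l \<in> {..<j + i + 2}" by auto
    then have "j + i + 1 - k = j + i + 1 - l" by (rule inj_onD[OF inj eq])
    then show "k = l" using kl by linarith
  qed simp
  moreover have "set rs = {d \<in> outs m. face_of m d = f}"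
  proof (intro set_eqI iffI)
    fix d assume "d \<in> set rs"
    then obtain k where k: "k \<le> j" "d = (?n ^^ k) y" by (auto simp: rs_def less_Suc_eq_le simp del: upt_Suc)
    then have "d \<in> f" unfolding f_eq by auto
    then show "d \<in> {d \<in> outs m. face_of m d = f}" using k up in_f yD by auto
  next
    fix d assume d: "d \<in> {d \<in> outs m. face_of m d = f}"
    then have "d \<in> f" by auto
    then obtain k where k: "k < j + i + 2" "d = (?n ^^ k) y" unfolding f_eq by blast
    then have "k \<le> j" using down[of k] d by (intro leI) auto
    then show "d \<in> set rs" unfolding rs_def using k(2) by (auto simp del: upt_Suc)
  qed
  moreover have "set ls = {d \<in> outs m. face_of m (opp m d) = f}"
  proof (intro set_eqI iffI)
    fix d assume "d \<in> set ls"
    then obtain k where k: "k \<le> i" "d = h k" by (auto simp: ls_def less_Suc_eq_le simp del: upt_Suc)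
    then have od: "opp m d \<in> f" unfolding f_eq h_def by auto
    moreover have "d \<in> outs m" using k down[of "j + i + 1 - k"] yD by (simp add: h_def)
    moreover from this have "face_of m (opp m d) = f" using in_f[of "opp m d"] od f in_faceD[of f "opp m d"] by simp
    ultimately show "d \<in> {d \<in> outs m. face_of m (opp m d) = f}" by simp
  next
    fix d assume d: "d \<in> {d \<in> outs m. face_of m (opp m d) = f}"
    then have "opp m d \<in> f" by auto
    then obtain k where k: "k < j + i + 2" "opp m d = (?n ^^ k) y" unfolding f_eq by blast
    have "opp m d \<notin> outs m" using d outs_sub by auto
    then have "j < k" using k up[of k] by (metis not_le)
    then have "d = h (j + i + 1 - k)" "j + i + 1 - k < Suc i"
      using k by (simp_all add: h_def flip: k(2))
    then show "d \<in> set ls" unfolding ls_def by (auto simp del: upt_Suc)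
  qed
  moreover have "card f = j + i + 2" unfolding f_eq card_image[OF inj] by simp
  moreover have "length ls = i + 1" "length rs = j + 1" by (simp_all add: ls_def rs_def)
  ultimately have card_f: "card f = j + i + 2"
    and paths: "\<exists>ls rs. path_on_right m f (?V y) (?V ((?n ^^ Suc j) y)) ls \<and>
       path_on_left m f (?V y) (?V ((?n ^^ Suc j) y)) rs \<and> length ls = i + 1 \<and> length rs = j + 1"
    unfolding path_on_left_def path_on_right_def using rs ls by blast+
  show thesis by (rule that[OF y f_eq up down card_f paths])
qed

text \<open>Euler's formula with \<open>card (darts m) = 2 * card (edges m)\<close>. The 4 is twice
  the 2 of that formula: it pays for a source and a sink that have no change.\<close>

lemma changes_total:
  "(\<Sum>v\<in>vertices m. vertex_changes m v) + (\<Sum>f\<in>faces m. face_changes m f) + 4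
    = 2 * card (vertices m) + 2 * card (faces m)"
proof -
  have "card {d\<in>darts m. vertex_change m d}
      + card {d\<in>darts m. face_change m d} = card (darts m)"
    by (rule closed_corner_count) auto
  then show ?thesis using euler card_darts by (simp add: sum_card_vertices sum_card_faces)
qed

text \<open>By \<open>changes_total\<close> the lower bounds already exhaust the total, whatever
  \<open>S\<close> and \<open>N\<close> contribute, so each of them is attained.\<close>

lemma changes_exact:
  assumes "S \<in> vertices m" "N \<in> vertices m" "S \<noteq> N"
    and v2: "\<And>v. v \<in> vertices m \<Longrightarrow> v \<notin> {S, N} \<Longrightarrow> vertex_changes m v \<ge> 2"
    and f2: "\<And>f. f \<in> faces m \<Longrightarrow> face_changes m f \<ge> 2"
  shows "v \<in> vertices m \<Longrightarrow> v \<notin> {S, N} \<Longrightarrow> vertex_changes m v = 2"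
    and "f \<in> faces m \<Longrightarrow> face_changes m f = 2"
proof -
  let ?U = "vertices m - {S, N}"
  have fin: "finite ?U" "finite (faces m)" using finite_vertices finite_faces by auto
  have "card {S, N} = 2" "{S, N} \<subseteq> vertices m" using assms by auto
  then have cU: "card ?U + 2 = card (vertices m)"
    using finite_vertices by (metis card_Diff_subset card_mono finite.emptyI finite_insert le_add_diff_inverse2)
  have "sum (vertex_changes m) ?U \<le> sum (vertex_changes m) (vertices m)"
    using finite_vertices by (intro sum_mono2) auto
  then have le: "sum (vertex_changes m) ?U + sum (face_changes m) (faces m) \<le> 2 * card ?U + 2 * card (faces m)"
    using changes_total cU by linarith
  have sv: "sum (vertex_changes m) ?U = 2 * card ?U + (\<Sum>v\<in>?U. vertex_changes m v - 2)"
  proof -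
    have "sum (vertex_changes m) ?U = (\<Sum>v\<in>?U. 2 + (vertex_changes m v - 2))"
      by (rule sum.cong) (use v2 in force)+
    then show ?thesis by (simp only: sum.distrib sum_constant of_nat_id mult.commute)
  qed
  have sf: "sum (face_changes m) (faces m) = 2 * card (faces m) + (\<Sum>f\<in>faces m. face_changes m f - 2)"
  proof -
    have "sum (face_changes m) (faces m) = (\<Sum>f\<in>faces m. 2 + (face_changes m f - 2))"
      by (rule sum.cong) (use f2 in force)+
    then show ?thesis by (simp only: sum.distrib sum_constant of_nat_id mult.commute)
  qed
  from le sv sf have "(\<Sum>v\<in>?U. vertex_changes m v - 2) = 0" "(\<Sum>f\<in>faces m. face_changes m f - 2) = 0"
    by linarith+
  then have *: "\<forall>v\<in>?U. vertex_changes m v - 2 = 0" "\<forall>f\<in>faces m. face_changes m f - 2 = 0"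
    using fin by (simp_all only: sum_eq_0_iff)
  show "v \<in> vertices m \<Longrightarrow> v \<notin> {S, N} \<Longrightarrow> vertex_changes m v = 2"
  proof -
    assume v: "v \<in> vertices m" "v \<notin> {S, N}"
    then have "vertex_changes m v - 2 = 0" using *(1) by blast
    then show "vertex_changes m v = 2" using v2[OF v] by linarith
  qed
  show "f \<in> faces m \<Longrightarrow> face_changes m f = 2"
  proof -
    assume f: "f \<in> faces m"
    then have "face_changes m f - 2 = 0" using *(2) by blast
    then show "face_changes m f = 2" using f2[OF f] by linarith
  qed
qed

text \<open>A contour all of whose darts are outgoing is a closed directed walk; if all are ingoing,
  it is one when read backwards.\<close>

lemma acyclic_face:
  assumes acyc: "acyclic_orientation m" and f: "f \<in> faces m"
  shows "\<not> f \<subseteq> outs m \<and> f \<inter> outs m \<noteq> {}"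
proof -
  define r where "r = {(vertex_of m d, vertex_of m (opp m d)) |d. d \<in> outs m}"
  have acr: "acyclic r" using acyc by (simp add: acyclic_orientation_def r_def)
  obtain x where x: "x \<in> darts m" "f = orbit (next_in_face m) x" using f by (auto simp: faces_altdef)
  have fD: "z \<in> darts m" if "z \<in> f" for z using that f in_faceD by blast
  have "(vertex_of m x, vertex_of m z) \<in> r\<^sup>+" if "f \<subseteq> outs m" "z \<in> orbit (next_in_face m) x" for z
    using that(2)
  proof induction
    case base
    have "x \<in> outs m" using that(1) x by auto
    then have "(vertex_of m x, vertex_of m (opp m x)) \<in> r" unfolding r_def by blast
    then show ?case by auto
  next
    case (step z)
    have "z \<in> outs m" using that(1) x step by auto
    then have "(vertex_of m z, vertex_of m (opp m z)) \<in> r" unfolding r_def by blast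
    with step.IH show ?case by (simp add: trancl_into_trancl)
  qed
  moreover have "(vertex_of m z, vertex_of m x) \<in> r\<^sup>+"
    if "f \<inter> outs m = {}" "z \<in> orbit (next_in_face m) x" for z
    using that(2)
  proof induction
    case base
    have "opp m x \<in> outs m" using that(1) x by auto
    then have "(vertex_of m (opp m x), vertex_of m (opp m (opp m x))) \<in> r" unfolding r_def by blast
    then show ?case by auto
  next
    case (step z)
    have "opp m z \<in> outs m" using that(1) x step fD by auto
    then have "(vertex_of m (opp m z), vertex_of m (opp m (opp m z))) \<in> r" unfolding r_def by blast
    with step.IH show ?case by (simp add: trancl_into_trancl2)
  qed
  ultimately show ?thesis using acr f.self_orbit[of x] unfolding acyclic_def by blast
qed

end

text \<open>\<open>W\<close> is the set of darts with a white origin; the root edge joins the black source to the white sink.\<close>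

locale bicolored_map = oriented_planar m for m :: "('d, 'z) oriented_map_scheme" +
  fixes W :: "'d set"
  assumes W_darts: "W \<subseteq> darts m" and root_black: "root m \<notin> W"
    and succ_W [simp]: "d \<in> darts m \<Longrightarrow> succ m d \<in> W \<longleftrightarrow> d \<in> W"
    and opp_W [simp]: "d \<in> darts m \<Longrightarrow> opp m d \<in> W \<longleftrightarrow> d \<notin> W"
begin

lemma next_W [simp]: "d \<in> darts m \<Longrightarrow> next_in_face m d \<in> W \<longleftrightarrow> d \<notin> W"
  using succ_W[of "next_in_face m d"] by simp

lemma inv_next_W [simp]: "d \<in> darts m \<Longrightarrow> inv (next_in_face m) d \<in> W \<longleftrightarrow> d \<notin> W"
  using next_W[of "inv (next_in_face m) d"] by auto

lemma funpow_next_darts [simp]: "d \<in> darts m \<Longrightarrow> (next_in_face m ^^ k) d \<in> darts m"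
  by (induction k) auto

lemma funpow_next_W: "d \<in> darts m \<Longrightarrow> (next_in_face m ^^ k) d \<in> W \<longleftrightarrow> (d \<in> W \<longleftrightarrow> even k)"
  by (induction k) auto

lemma vertex_subset_W: "d \<in> darts m \<Longrightarrow> vertex_of m d \<subseteq> W \<longleftrightarrow> d \<in> W"
proof
  assume d: "d \<in> darts m" "d \<in> W"
  show "vertex_of m d \<subseteq> W"
  proof
    fix z assume "z \<in> vertex_of m d"
    then have "z \<in> W \<and> z \<in> darts m" unfolding vertex_of_def
      by (induction rule: s.orbit_induct) (use d in auto)
    then show "z \<in> W" by simp
  qed
qed (use in_vertex in blast)

abbreviation white_changes :: "'d set \<Rightarrow> nat" where
  "white_changes f \<equiv> card {d\<in>f. d \<in> W \<and> two_step_change m d}"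

definition mixed :: "'d set \<Rightarrow> bool" where
  "mixed f \<longleftrightarrow> (\<exists>d\<in>f. d \<in> W \<and> d \<in> outs m) \<and> (\<exists>d\<in>f. d \<in> W \<and> d \<notin> outs m)"

text \<open>What (PO1) and (PO2) say about the triangulation, read on the red-blue map. The sink is
  the head of the root edge, written as the origin of the next contour dart. The last clause comes
  from the green vertex of the outer face, which has no extremal corner.\<close>

definition balanced :: bool where
  "balanced \<longleftrightarrow>
     vertex_of m (root m) \<subseteq> outs m \<and> vertex_of m (next_in_face m (root m)) \<inter> outs m = {} \<and>
     (\<forall>v\<in>vertices m. v \<noteq> vertex_of m (root m) \<longrightarrow> v \<noteq> vertex_of m (next_in_face m (root m)) \<longrightarrow>
        vertex_changes m v = 2) \<and>
     (\<forall>f\<in>inner_faces m. white_changes f = 2) \<and>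
     outer_face m \<inter> W \<inter> outs m = {}"

lemma face_next_in: "f \<in> faces m \<Longrightarrow> d \<in> f \<Longrightarrow> next_in_face m d \<in> f"
  unfolding faces_altdef by auto

text \<open>A change over two steps contains a change in one of them, at \<open>d\<close> or at
  \<open>next_in_face m d\<close>. The first dart is white and the second black, so no single step
  is charged twice.\<close>

lemma white_changes_le:
  assumes "f \<in> faces m" shows "white_changes f \<le> face_changes m f"
proof (rule card_inj_on_le)
  let ?n = "next_in_face m"
  define h where "h = (\<lambda>d. if face_change m d then d else ?n d)"
  let ?A = "{d\<in>f. d \<in> W \<and> two_step_change m d}"
  have D: "d \<in> darts m" if "d \<in> f" for d using that assms in_faceD by blast
  show "inj_on h ?A"
  proof (rule inj_onI)
    fix x y assume xy: "x \<in> ?A" "y \<in> ?A" "h x = h y"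
    then have "?n x \<notin> W" "?n y \<notin> W" "x \<in> W" "y \<in> W" using D by auto
    with xy(3) show "x = y" unfolding h_def by (auto split: if_splits)
  qed
  show "h ` ?A \<subseteq> {d\<in>f. face_change m d}"
    using face_next_in[OF assms] unfolding h_def by auto
  show "finite {d\<in>f. face_change m d}" using finite_face[OF assms] by simp
qed

lemma mixedI:
  assumes "f \<in> faces m" "white_changes f = 2" shows "mixed f"
proof -
  have "{d\<in>f. d \<in> W \<and> two_step_change m d} \<noteq> {}"
    using assms(2) by (metis card.empty zero_neq_numeral)
  then obtain d where d: "d \<in> f" "d \<in> W" "two_step_change m d"
    by blast
  let ?e = "next_in_face m (next_in_face m d)"
  have "?e \<in> f" "?e \<in> W" using d face_next_in[OF assms(1)] W_darts by auto
  then show ?thesis unfolding mixed_def using d by blast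
qed

lemma mixed_white_changes:
  assumes f: "f \<in> faces m" and "mixed f" shows "0 < white_changes f"
proof -
  let ?n = "next_in_face m"
  let ?F = "f \<inter> W"
  obtain x where x: "x \<in> darts m" "f = orbit ?n x" using f by (auto simp: faces_altdef)
  have D: "d \<in> darts m" if "d \<in> f" for d using that f in_faceD by blast
  have "\<exists>d\<in>?F. two_step_change m d"
  proof (rule ccontr)
    assume none: "\<not> ?thesis"
    obtain d e where de: "d \<in> f" "d \<in> W" "d \<in> outs m" "e \<in> f" "e \<in> W" "e \<notin> outs m"
      using assms(2) by (auto simp: mixed_def)
    then have "e \<in> orbit ?n d" "f = orbit ?n d" using x f.orbit_eqI by blast+
    \<comment> \<open>The orbit also meets black darts; there the invariant speaks of the white dart
      that follows.\<close>
    from this(1) have "if e \<in> W then e \<in> outs m else ?n e \<in> outs m"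
    proof (induction rule: f.orbit_induct)
      case (step z)
      then have "z \<in> f" using \<open>f = orbit ?n d\<close> by simp
      then have "z \<in> darts m" "z \<in> W \<Longrightarrow> z \<in> outs m \<longleftrightarrow> ?n (?n z) \<in> outs m"
        using none D by blast+
      then show ?case using step.IH by (simp split: if_split_asm)
    qed (use de in simp)
    then show False using de by simp
  qed
  then show ?thesis using finite_face[OF f] by (auto simp: card_gt_0_iff)
qed

text \<open>The number of white changes is even, as the white darts of a face form a cycle of their
  own; it is positive because the face is mixed, and at most
  \<open>face_changes m f\<close>.\<close>

lemma white_changes_eq_2:
  assumes f: "f \<in> faces m" and "mixed f" "face_changes m f = 2"
  shows "white_changes f = 2"
proof -
  let ?n = "next_in_face m"
  let ?F = "f \<inter> W"
  have D: "d \<in> darts m" if "d \<in> f" for d using that f in_faceD by blast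
  have fin: "finite ?F" using finite_face[OF f] by simp
  have "inj_on (\<lambda>d. ?n (?n d)) ?F" by (simp add: inj_on_def)
  moreover have sub: "(\<lambda>d. ?n (?n d)) ` ?F \<subseteq> ?F" using face_next_in[OF f] D by auto
  ultimately have bij: "bij_betw (\<lambda>d. ?n (?n d)) ?F ?F"
    unfolding bij_betw_def using endo_inj_surj[OF fin sub] by blast
  have "{d\<in>?F. two_step_change m d} = {d\<in>f. d \<in> W \<and> two_step_change m d}"
    by blast
  then have even: "white_changes f = 2 * card {d\<in>?F. d \<in> outs m \<and> ?n (?n d) \<notin> outs m}"
    using card_changes[OF fin bij, of "outs m"] by simp
  with mixed_white_changes[OF assms(1,2)]
  have "1 \<le> card {d\<in>?F. d \<in> outs m \<and> ?n (?n d) \<notin> outs m}" by linarith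
  then show ?thesis using even white_changes_le[OF f] assms(3) by linarith
qed

lemma root_outer [simp]: "root m \<in> outer_face m" "next_in_face m (root m) \<in> outer_face m"
  using face_next_in[OF outer_face_in] by (auto simp: outer_face_def)

lemma inner_face_in: "f \<in> inner_faces m \<Longrightarrow> f \<in> faces m"
  by (simp add: inner_faces_def)

text \<open>The first ingoing dart starts at the top. If the top is white, this is an ingoing white
  dart, and \<open>j \<ge> 1\<close> provides an outgoing one two steps earlier. If it is black, the
  last outgoing dart is white, and \<open>i \<ge> 1\<close> provides an ingoing white dart two steps
  later.\<close>

lemma face_mixed_if_type:
  assumes f: "f \<in> faces m" and two: "face_changes m f = 2"
    and type: "\<And>b t i j. face_has_type m f b t i j \<Longrightarrow> (\<not> t \<subseteq> W \<longrightarrow> i \<ge> 1) \<and> (t \<subseteq> W \<longrightarrow> j \<ge> 1)"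
  shows "mixed f"
proof -
  let ?n = "next_in_face m"
  obtain y j i where y: "y \<in> f" "f = (\<lambda>k. (?n ^^ k) y) ` {..<j + i + 2}"
    and up: "\<And>k. k \<le> j \<Longrightarrow> (?n ^^ k) y \<in> outs m"
    and down: "\<And>k. j < k \<Longrightarrow> k < j + i + 2 \<Longrightarrow> (?n ^^ k) y \<notin> outs m"
    and ty: "\<exists>ls rs. path_on_right m f (vertex_of m y) (vertex_of m ((?n ^^ Suc j) y)) ls \<and>
       path_on_left m f (vertex_of m y) (vertex_of m ((?n ^^ Suc j) y)) rs \<and>
       length ls = i + 1 \<and> length rs = j + 1"
    using face_interval[OF f two] by metis
  have yD: "y \<in> darts m" using y(1) f in_faceD by blast
  have "face_has_type m f (vertex_of m y) (vertex_of m ((?n ^^ Suc j) y)) i j"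
    using ty unfolding face_has_type_def .
  note type = type[OF this, unfolded vertex_subset_W[OF funpow_next_darts[OF yD]]]
  have col: "(?n ^^ k) y \<in> W \<longleftrightarrow> (y \<in> W \<longleftrightarrow> even k)" for k by (rule funpow_next_W[OF yD])
  have mixed: "mixed f" if "k \<le> j" "j < l" "l < j + i + 2" "(?n ^^ k) y \<in> W" "(?n ^^ l) y \<in> W" for k l
    unfolding mixed_def using that up[of k] down[of l] y(2) by (intro conjI bexI) auto
  show ?thesis
  proof (cases "(?n ^^ Suc j) y \<in> W")
    case True
    then have "j \<ge> 1" using type by blast
    then have "(?n ^^ (j - 1)) y \<in> W" using True unfolding col by simp
    then show ?thesis using True by (intro mixed[of "j - 1" "Suc j"]) auto
  next
    case False
    then have "i \<ge> 1" using type by blast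
    then show ?thesis using False unfolding col
      by (intro mixed[of j "Suc (Suc j)"]) (auto simp: col simp del: funpow.simps)
  qed
qed

end

section \<open>From balance to P-admissibility\<close>

context bicolored_map
begin

definition white_vertices :: "'d set set" where
  "white_vertices = {v\<in>vertices m. v \<subseteq> W}"

lemma vertex_white [simp]: "d \<in> darts m \<Longrightarrow> vertex_of m d \<in> white_vertices \<longleftrightarrow> d \<in> W"
  by (simp add: white_vertices_def vertex_subset_W)

abbreviation "source \<equiv> vertex_of m (root m)"
abbreviation "sink \<equiv> vertex_of m (next_in_face m (root m))"

lemma source_neq_sink: "source \<noteq> sink"
proof
  assume "source = sink"
  then have "source \<subseteq> W \<longleftrightarrow> sink \<subseteq> W" by simp
  then show False by (simp add: vertex_subset_W root_black)
qed

text \<open>Balance prescribes the changes among white darts only, but these give at least two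
  changes along an inner face; on the outer face the root dart and its successor are oriented
  differently. The Euler count turns the bounds into equalities.\<close>

lemma balanced_all_two:
  assumes balanced and f: "f \<in> faces m"
  shows "face_changes m f = 2"
proof (rule changes_exact(2)[of source sink])
  show "source \<noteq> sink" by (rule source_neq_sink)
  show "2 \<le> vertex_changes m v" if "v \<in> vertices m" "v \<notin> {source, sink}" for v
    using assms(1) that unfolding balanced_def by auto
  show "2 \<le> face_changes m f" if "f \<in> faces m" for f
  proof (cases "f = outer_face m")
    case True
    have "root m \<in> outs m" "next_in_face m (root m) \<notin> outs m"
      using assms(1) in_vertex unfolding balanced_def by blast+
    then have "\<not> f \<subseteq> outs m" "f \<inter> outs m \<noteq> {}" using True root_outer by blast+
    then show ?thesis using face_two_changes that by blast
  next
    case False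
    then have "white_changes f = 2" using assms(1) that by (auto simp: balanced_def inner_faces_def)
    then show ?thesis using white_changes_le[OF that] by simp
  qed
qed (use f in auto)

lemma balanced_inner_mixed:
  assumes balanced "f \<in> inner_faces m" shows "mixed f"
  using assms by (intro mixedI) (auto simp: balanced_def inner_face_in)

lemma balanced_root:
  assumes balanced shows "root m \<in> outs m" "next_in_face m (root m) \<notin> outs m"
  using assms in_vertex unfolding balanced_def by blast+

lemma changes_2_imp:
  assumes "vertex_changes m v = 2" "v \<in> vertices m"
  shows "\<not> v \<subseteq> outs m \<and> v \<inter> outs m \<noteq> {}"
proof -
  have "{d\<in>v. vertex_change m d} \<noteq> {}"
    using assms(1) by (metis card.empty zero_neq_numeral)
  then obtain d where d: "d \<in> v" "vertex_change m d" by blast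
  moreover have "succ m d \<in> v" using d(1) assms(2) in_vertexD in_vertex vertex_succ by metis
  ultimately show ?thesis by blast
qed

lemma balanced_inner_vertex:
  assumes balanced "v \<in> vertices m" "v \<noteq> source" "v \<noteq> sink"
  shows "\<not> v \<subseteq> outs m \<and> v \<inter> outs m \<noteq> {}"
  using assms by (intro changes_2_imp) (auto simp: balanced_def)

lemma balanced_acyclic:
  assumes balanced shows "acyclic_orientation m"
proof (rule acyclicI)
  fix f assume "f \<in> inner_faces m"
  then show "\<not> f \<subseteq> outs m \<and> f \<inter> outs m \<noteq> {}"
    using balanced_inner_mixed[OF assms] unfolding mixed_def by blast
next
  fix v assume "v \<in> inner_vertices m"
  then have "v \<in> vertices m" "v \<noteq> source" "v \<noteq> sink"
    using root_outer unfolding inner_vertices_def outer_vertices_def by blast+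
  then show "\<not> v \<subseteq> outs m \<and> v \<inter> outs m \<noteq> {}" by (rule balanced_inner_vertex[OF assms])
qed

lemma balanced_sources: assumes balanced shows "sources m = {source}"
proof -
  have "\<not> v \<subseteq> outs m" if "v \<in> vertices m" "v \<noteq> source" for v
  proof (cases "v = sink")
    case True then show ?thesis using balanced_root[OF assms] in_vertex by blast
  qed (use balanced_inner_vertex[OF assms] that in blast)
  moreover have "source \<subseteq> outs m" using assms by (simp add: balanced_def)
  ultimately show ?thesis by (auto simp: sources_def)
qed

lemma balanced_sinks: assumes balanced shows "sinks m = {sink}"
proof -
  have "v \<inter> outs m \<noteq> {}" if "v \<in> vertices m" "v \<noteq> sink" for v
  proof (cases "v = source")
    case True then show ?thesis using balanced_root[OF assms] in_vertex by blast
  qed (use balanced_inner_vertex[OF assms] that in blast)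
  moreover have "sink \<inter> outs m = {}" using assms by (simp add: balanced_def)
  ultimately show ?thesis by (auto simp: sinks_def)
qed

lemma balanced_sink_vertex: assumes balanced shows "sink_vertex m = sink"
  using balanced_sinks[OF assms] by (simp add: sink_vertex_def)

lemma even_card_face: assumes "f \<in> faces m" shows "card f = 2 * card (f \<inter> W)"
proof -
  have fin: "finite f" using assms finite_face by blast
  have D: "d \<in> darts m" if "d \<in> f" for d using that assms in_faceD by blast
  have "card (f \<inter> W) = card (f - W)"
  proof (rule bij_betw_same_card[of "next_in_face m"], rule bij_betw_byWitness[where f'="inv (next_in_face m)"])
    show "next_in_face m ` (f \<inter> W) \<subseteq> f - W" using face_next_in[OF assms] D by auto
    show "inv (next_in_face m) ` (f - W) \<subseteq> f \<inter> W"
      using D assms by (auto simp: faces_altdef)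
  qed auto
  moreover have "card f = card (f \<inter> W) + card (f - W)"
    using fin by (subst card_Un_disjoint[symmetric]) (auto intro!: arg_cong[of _ _ card])
  ultimately show ?thesis by simp
qed

text \<open>
  If the outer face had degree 2, the edge parallel to the root edge would be a right lateral path of
  length 1 of an inner face with white top.
\<close>

lemma balanced_outer_degree:
  assumes bal: balanced and E: "card (edges m) \<ge> 2"
  shows "card (outer_face m) \<noteq> 2"
proof
  let ?n = "next_in_face m"
  assume two: "card (outer_face m) = 2"
  have rn: "?n (root m) \<noteq> root m" using root_black next_W[OF root_in] by metis
  have "outer_face m = {root m, ?n (root m)}"
    using two rn root_outer finite_face[OF outer_face_in]
    by (intro card_subset_eq[symmetric]) auto
  then have outer: "outer_face m = {root m, ?n (root m)}" "?n (?n (root m)) = root m"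
    using face_next_in[OF outer_face_in, of "?n (root m)"] rn f.inj_iff by auto
  \<comment> \<open>The other contour edge of the digon, directed from the source to the sink; it
    may be the root edge itself, in which case the map is a single edge.\<close>
  define e where "e = opp m (?n (root m))"
  have e: "e \<in> darts m" "e \<notin> W" "e \<in> outs m" using balanced_root[OF bal] root_black by (auto simp: e_def)
  have Ve: "vertex_of m e = source" unfolding e_def using outer(2) vertex_next by metis
  have Voe: "vertex_of m (opp m e) = sink" by (simp add: e_def)
  show False
  proof (cases "face_of m e = outer_face m")
    case True
    then have "e \<in> outer_face m" using in_face by metis
    then have er: "e = root m" using outer e root_black by auto
    have *: "opp m (root m) = ?n (root m)" using er e_def opp_opp by metis
    have s1: "succ m (root m) = root m" using succ_next_in_face[of "?n (root m)"] outer(2) * by (metis opp_opp)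
    have s2: "succ m (opp m (root m)) = opp m (root m)" using * by simp
    have "d \<in> {root m, opp m (root m)}" if "d \<in> darts m" for d
      using that root_in by (induction rule: dart_induct) (use s1 s2 in auto)
    then have "card (darts m) \<le> card {root m, opp m (root m)}" by (intro card_mono) auto
    also have "\<dots> \<le> 2" by (simp add: card_insert_if)
    finally show False using E card_darts by simp
  next
    case False
    define f where "f = face_of m e"
    have f: "f \<in> faces m" "f \<in> inner_faces m" using False e by (auto simp: f_def inner_faces_def)
    obtain y j i where y: "y \<in> f" "f = (\<lambda>k. (?n ^^ k) y) ` {..<j + i + 2}"
      and up: "\<And>k. k \<le> j \<Longrightarrow> (?n ^^ k) y \<in> outs m"
      and down: "\<And>k. j < k \<Longrightarrow> k < j + i + 2 \<Longrightarrow> (?n ^^ k) y \<notin> outs m"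
      using face_interval[OF f(1) balanced_all_two[OF bal f(1)]] by metis
    have yD: "y \<in> darts m" using y(1) f in_faceD by blast
    obtain k where k: "k < j + i + 2" "e = (?n ^^ k) y" using y in_face[of e] unfolding f_def[symmetric] by auto
    have kj: "k \<le> j" using down[of k] k e by (metis not_le)
    have "?n e \<in> sink" using Voe in_vertex vertex_next by metis
    then have ne: "?n e \<notin> outs m" using bal unfolding balanced_def by blast
    \<comment> \<open>The dart after \<open>e\<close> starts at the sink, and an outgoing dart
      before \<open>e\<close> would end at the source. So \<open>e\<close> alone is the outgoing
      block of \<open>f\<close>; as it is black, \<open>f\<close> has no outgoing white dart and is
      not mixed.\<close>
    have "k = j"
    proof (rule ccontr)
      assume "k \<noteq> j"
      then have "(?n ^^ Suc k) y \<in> outs m" using kj by (intro up) simp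
      then show False using ne k by simp
    qed
    have "j = 0"
    proof (rule ccontr)
      assume "j \<noteq> 0"
      then have "(?n ^^ (j - 1)) y \<in> outs m" by (intro up) simp
      moreover have "?n ((?n ^^ (j - 1)) y) = e" using \<open>j \<noteq> 0\<close> k \<open>k = j\<close>
        by (metis Suc_pred comp_apply funpow.simps(2) neq0_conv One_nat_def)
      ultimately have "inv ?n e \<in> outs m" by (metis f.inv_cancel(1))
      then have "succ m e \<notin> outs m" using opp_outs[of "inv ?n e"] e by (simp add: opp_inv_next)
      moreover have "succ m e \<in> source" using Ve in_vertex vertex_succ by metis
      ultimately show False using bal unfolding balanced_def by blast
    qed
    obtain d where d: "d \<in> f" "d \<in> W" "d \<in> outs m"
      using balanced_inner_mixed[OF bal f(2)] by (auto simp: mixed_def)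
    then obtain l where l: "l < j + i + 2" "d = (?n ^^ l) y" using y by auto
    then have "l = 0" using down[of l] d \<open>j = 0\<close> by (metis neq0_conv)
    then show False using l d e k \<open>k = j\<close> \<open>j = 0\<close> by simp
  qed
qed

text \<open>The root dart is the whole outgoing block of the outer contour: its successor starts at
  the sink, and an outgoing predecessor would be white, against the last clause of
  \<open>balanced\<close>. Having the outer face on its left, this block is the left outer boundary.
  The other block has length \<open>i + 1\<close>, with \<open>i\<close> even because faces of a
  bipartite map have even degree.\<close>

lemma balanced_outer_type:
  assumes bal: balanced and E: "card (edges m) \<ge> 2"
  shows "\<exists>k\<ge>2. even k \<and> has_outer_type m 0 k"
proof -
  let ?n = "next_in_face m"
  let ?f = "outer_face m"
  obtain y j i where y: "y \<in> ?f" "?f = (\<lambda>k. (?n ^^ k) y) ` {..<j + i + 2}"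
    and up: "\<And>k. k \<le> j \<Longrightarrow> (?n ^^ k) y \<in> outs m"
    and down: "\<And>k. j < k \<Longrightarrow> k < j + i + 2 \<Longrightarrow> (?n ^^ k) y \<notin> outs m"
    and cf: "card ?f = j + i + 2"
    and ty: "\<exists>ls rs. path_on_right m ?f (vertex_of m y) (vertex_of m ((?n ^^ Suc j) y)) ls \<and>
       path_on_left m ?f (vertex_of m y) (vertex_of m ((?n ^^ Suc j) y)) rs \<and>
       length ls = i + 1 \<and> length rs = j + 1"
    using face_interval[OF outer_face_in balanced_all_two[OF bal outer_face_in]] by metis
  have yD: "y \<in> darts m" using y(1) outer_face_in in_faceD by blast
  obtain k where k: "k < j + i + 2" "root m = (?n ^^ k) y" using y root_outer(1) by auto
  have kj: "k \<le> j" using down[of k] k balanced_root[OF bal] by (metis not_le)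
  have "k = j"
  proof (rule ccontr)
    assume "k \<noteq> j"
    then have "(?n ^^ Suc k) y \<in> outs m" using kj by (intro up) simp
    then show False using k balanced_root[OF bal] by simp
  qed
  have "j = 0"
  proof (rule ccontr)
    assume "j \<noteq> 0"
    then have "(?n ^^ (j - 1)) y \<in> outs m" by (intro up) simp
    moreover have nr: "?n ((?n ^^ (j - 1)) y) = root m" using \<open>j \<noteq> 0\<close> k \<open>k = j\<close>
      by (metis Suc_pred comp_apply funpow.simps(2) neq0_conv One_nat_def)
    moreover have "(?n ^^ (j - 1)) y \<in> ?f" unfolding y(2) by auto
    moreover have "(?n ^^ (j - 1)) y \<in> W" using nr root_black next_W[of "(?n ^^ (j - 1)) y"] yD by simp
    ultimately show False using bal unfolding balanced_def by blast
  qed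
  have yr: "y = root m" using k \<open>k = j\<close> \<open>j = 0\<close> by simp
  obtain ls rs where "path_on_right m ?f source sink ls" "path_on_left m ?f source sink rs"
    "length ls = i + 1" "length rs = 1"
    using ty unfolding yr \<open>j = 0\<close> by auto
  then have "has_outer_type m 0 i"
    unfolding has_outer_type_def root_vertex_def balanced_sink_vertex[OF bal] by auto
  moreover have "even i" using even_card_face[OF outer_face_in] cf \<open>j = 0\<close> by presburger
  moreover have "i \<noteq> 0" using balanced_outer_degree[OF bal E] cf \<open>j = 0\<close> by simp
  ultimately show ?thesis by (intro exI[of _ i]) auto
qed

text \<open>The face has an ingoing and an outgoing white dart. A left lateral path of length 1
  would be the reverse of the former, so the top would be white; a right one would be the latter, so
  the top would be black.\<close>

lemma balanced_inner_type:
  assumes bal: balanced and f: "f \<in> inner_faces m" and type: "face_has_type m f b t i j"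
  shows "(t \<notin> white_vertices \<longrightarrow> i \<ge> 1) \<and> (t \<in> white_vertices \<longrightarrow> j \<ge> 1)"
proof -
  obtain ls rs where ls: "directed_path m b ls t" "set ls = {d \<in> outs m. face_of m (opp m d) = f}" "length ls = i + 1"
    and rs: "directed_path m b rs t" "set rs = {d \<in> outs m. face_of m d = f}" "length rs = j + 1"
    using type unfolding face_has_type_def path_on_right_def path_on_left_def by blast
  obtain d e where de: "d \<in> f" "d \<in> W" "d \<in> outs m" "e \<in> f" "e \<in> W" "e \<notin> outs m"
    using balanced_inner_mixed[OF bal f] by (auto simp: mixed_def)
  have fD: "face_of m x = f \<and> x \<in> darts m" if "x \<in> f" for x
    using inner_face_in[OF f] that in_faceD by blast
  have "i \<ge> 1" if "t \<notin> white_vertices"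
  proof (rule ccontr)
    assume "\<not> i \<ge> 1"
    then have "length ls = Suc 0" using ls(3) by simp
    then obtain x where x: "ls = [x]" by (auto simp: length_Suc_conv)
    have "opp m e \<in> set ls" using ls(2) de fD by auto
    then have "t = vertex_of m e" using ls(1) x by auto
    then show False using that de fD by auto
  qed
  moreover have "j \<ge> 1" if "t \<in> white_vertices"
  proof (rule ccontr)
    assume "\<not> j \<ge> 1"
    then have "length rs = Suc 0" using rs(3) by simp
    then obtain x where x: "rs = [x]" by (auto simp: length_Suc_conv)
    have "d \<in> set rs" using rs(2) de fD by auto
    then have "t = vertex_of m (opp m d)" using rs(1) x by auto
    then show False using that de fD by auto
  qed
  ultimately show ?thesis by blast
qed

text \<open>The bound on the edges excludes the single edge, which is balanced but has no right
  boundary of length at least 3.\<close>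

lemma balanced_imp_P_admissible:
  assumes bal: balanced and E: "card (edges m) \<ge> 2"
  shows "P_admissible m white_vertices"
  unfolding P_admissible_def
proof (intro conjI ballI allI impI)
  show "plane_bipolar_orientation m"
    unfolding plane_bipolar_orientation_def rooted_planar_map_iff root_vertex_def
    using planar_axioms balanced_acyclic[OF bal] balanced_sources[OF bal] balanced_sinks[OF bal] root_outer
    unfolding outer_vertices_def by blast
  show "vertex_bicoloring m white_vertices"
    unfolding vertex_bicoloring_def balanced_sink_vertex[OF bal]
    using root_black by (auto simp: white_vertices_def vertex_subset_W simp flip: vertex_next)
  show "\<exists>k\<ge>2. even k \<and> has_outer_type m 0 k" by (rule balanced_outer_type[OF bal E])
next
  fix f b t i j assume f: "f \<in> inner_faces m" "face_has_type m f b t i j"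
  show "t \<notin> white_vertices \<Longrightarrow> i \<ge> 1" "t \<in> white_vertices \<Longrightarrow> j \<ge> 1"
    using balanced_inner_type[OF bal f] by blast+
qed

end

text \<open>Acyclicity gives two changes along each face, uniqueness of source and sink gives two at
  every other vertex, and \<open>changes_exact\<close> makes both exact. Then the conditions on the
  types say that the inner faces are mixed.\<close>

lemma P_admissible_imp_balanced:
  assumes adm: "P_admissible m WV"
  defines "W \<equiv> {d\<in>darts m. vertex_of m d \<in> WV}"
  shows "bicolored_map m W" "bicolored_map.balanced m W" "bicolored_map.white_vertices m W = WV"
proof -
  have bip: "plane_bipolar_orientation m" and col: "vertex_bicoloring m WV"
    and outer: "\<exists>k. has_outer_type m 0 k"
    and inner: "\<And>f b t i j. f \<in> inner_faces m \<Longrightarrow> face_has_type m f b t i j \<Longrightarrow>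
      (t \<notin> WV \<longrightarrow> i \<ge> 1) \<and> (t \<in> WV \<longrightarrow> j \<ge> 1)"
    using adm unfolding P_admissible_def by blast+
  have acyc: "acyclic_orientation m" using bip by (simp add: plane_bipolar_orientation_def)
  interpret oriented_planar m
    using bip unfolding plane_bipolar_orientation_def rooted_planar_map_iff acyclic_orientation_def
    by (intro oriented_planar.intro) (simp_all add: oriented_planar_axioms_def)
  have src: "sources m = {vertex_of m (root m)}"
    using bip by (simp add: plane_bipolar_orientation_def root_vertex_def)
  obtain N where N: "sinks m = {N}" using bip by (auto simp: plane_bipolar_orientation_def)
  have sinkv: "sink_vertex m = N" using N by (simp add: sink_vertex_def)
  have S_outs: "vertex_of m (root m) \<subseteq> outs m" using src by (auto simp: sources_def)
  have root_outs: "root m \<in> outs m" using S_outs in_vertex by blast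
  obtain ls where ls: "directed_path m (root_vertex m) ls N" "set ls = {d \<in> outs m. face_of m d = outer_face m}" "length ls = 1"
    using outer unfolding has_outer_type_def path_on_left_def sinkv by auto
  obtain x where x: "ls = [x]" using ls(3) by (auto simp: length_Suc_conv)
  \<comment> \<open>The root dart is outgoing and has the outer face on its left. As the left outer
    boundary has length 1, it consists of this dart, and the sink is its head.\<close>
  have "root m \<in> set ls" using ls(2) root_outs by (simp add: outer_face_def)
  then have xr: "x = root m" using x by simp
  then have N_eq: "N = vertex_of m (next_in_face m (root m))" using ls(1) x by simp
  have opp_WV: "(vertex_of m d \<in> WV) \<noteq> (vertex_of m (opp m d) \<in> WV)" if "d \<in> darts m" for d
    using col that unfolding vertex_bicoloring_def by blast
  have NW: "N \<in> WV" using col sinkv unfolding vertex_bicoloring_def by blast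
  have WVsub: "WV \<subseteq> vertices m" using col unfolding vertex_bicoloring_def by blast
  show bm: "bicolored_map m W"
  proof unfold_locales
    show "root m \<notin> W" using opp_WV[of "root m"] NW N_eq by (simp add: W_def)
    show "opp m d \<in> W \<longleftrightarrow> d \<notin> W" if "d \<in> darts m" for d
      using opp_WV[OF that] that by (auto simp: W_def)
  qed (auto simp: W_def)
  then interpret bicolored_map m W .
  show WV: "white_vertices = WV"
  proof (intro set_eqI iffI)
    fix v assume v: "v \<in> white_vertices"
    then obtain d where d: "d \<in> darts m" "v = vertex_of m d" by (auto simp: white_vertices_def vertices_def)
    then have "d \<in> W" using v by simp
    then show "v \<in> WV" using d unfolding W_def by simp
  next
    fix v assume v: "v \<in> WV"
    then obtain d where d: "d \<in> darts m" "v = vertex_of m d" using WVsub by (auto simp: vertices_def)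
    then have "d \<in> W" using v unfolding W_def by simp
    then show "v \<in> white_vertices" using d by simp
  qed
  have f2: "face_changes m f \<ge> 2" if "f \<in> faces m" for f
    using acyclic_face[OF acyc that] face_two_changes[OF that] by blast
  have v2: "vertex_changes m v \<ge> 2" if "v \<in> vertices m" "v \<notin> {source, sink}" for v
  proof (rule vertex_two_changes[OF that(1)])
    show "\<not> v \<subseteq> outs m" using src that by (auto simp: sources_def)
    show "v \<inter> outs m \<noteq> {}" using N N_eq that by (auto simp: sinks_def)
  qed
  note exact = changes_exact[of source sink, OF _ _ source_neq_sink v2 f2, simplified]
  show balanced
    unfolding balanced_def
  proof (intro conjI ballI impI)
    show "source \<subseteq> outs m" by (rule S_outs)
    show "sink \<inter> outs m = {}" using N N_eq by (auto simp: sinks_def)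
    show "vertex_changes m v = 2" if "v \<in> vertices m" "v \<noteq> source" "v \<noteq> sink" for v
      using exact(1) that by simp
    show "outer_face m \<inter> W \<inter> outs m = {}"
    proof -
      have "d = root m" if "d \<in> outer_face m" "d \<in> outs m" for d
      proof -
        have "face_of m d = outer_face m" using that in_faceD[OF outer_face_in] by blast
        then have "d \<in> set ls" using ls(2) that by simp
        then show ?thesis using x xr by simp
      qed
      then show ?thesis using root_black by blast
    qed
    fix f assume f: "f \<in> inner_faces m"
    have fc: "face_changes m f = 2" using exact(2) inner_face_in[OF f] by simp
    have "mixed f"
    proof (rule face_mixed_if_type[OF inner_face_in[OF f] fc])
      fix b t i j assume ty: "face_has_type m f b t i j"
      then obtain ls where "directed_path m b ls t" "length ls = Suc i"
        "set ls = {d \<in> outs m. face_of m (opp m d) = f}"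
        unfolding face_has_type_def path_on_right_def by auto
      then have "\<exists>d\<in>outs m. t = vertex_of m (opp m d)"
        by (cases ls rule: rev_cases) (auto simp: directed_path_append)
      then have "t \<in> vertices m" using outs_sub by auto
      then have "t \<subseteq> W \<longleftrightarrow> t \<in> WV" unfolding WV[symmetric] by (simp add: white_vertices_def)
      then show "(\<not> t \<subseteq> W \<longrightarrow> i \<ge> 1) \<and> (t \<subseteq> W \<longrightarrow> j \<ge> 1)" using inner[OF f ty] by simp
    qed
    then show "white_changes f = 2" by (rule white_changes_eq_2[OF inner_face_in[OF f] _ fc])
  qed
qed

section \<open>The triangulation obtained by placing a green vertex in every face\<close>

text \<open>
  \<open>p d\<close> is the dart \<open>d\<close> itself, \<open>q d\<close> the dart that leads from the corner of \<open>d\<close> to the green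
  vertex of its face, and \<open>r d\<close> the reverse of \<open>q d\<close>. The triangle to the left of \<open>p d\<close> is
  \<open>p d, q (next_in_face M d), r d\<close>; it is dark iff \<open>d\<close> is white, and the formula for \<open>outs T\<close> says
  that dark triangles are directed cycles.
\<close>

locale star_pair = M: comb_map M + T: comb_map T
  for M :: "('d, 'z) oriented_map_scheme" and T :: "('e, 'y) oriented_map_scheme" +
  fixes p q r :: "'d \<Rightarrow> 'e" and W :: "'d set"
  assumes inj_p: "inj_on p (darts M)" and inj_q: "inj_on q (darts M)" and inj_r: "inj_on r (darts M)"
    and pq: "p ` darts M \<inter> q ` darts M = {}" and pr: "p ` darts M \<inter> r ` darts M = {}"
    and qr: "q ` darts M \<inter> r ` darts M = {}"
    and darts_T: "darts T = p ` darts M \<union> q ` darts M \<union> r ` darts M"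
    and succ_p [simp]: "d \<in> darts M \<Longrightarrow> succ T (p d) = q d"
    and succ_q [simp]: "d \<in> darts M \<Longrightarrow> succ T (q d) = p (succ M d)"
    and succ_r [simp]: "d \<in> darts M \<Longrightarrow> succ T (r d) = r (next_in_face M d)"
    and opp_p [simp]: "d \<in> darts M \<Longrightarrow> opp T (p d) = p (opp M d)"
    and opp_q [simp]: "d \<in> darts M \<Longrightarrow> opp T (q d) = r d"
    and root_T: "root T = q (next_in_face M (root M))"
    and W_sub: "W \<subseteq> darts M" and root_W: "root M \<notin> W"
    and W_succ: "d \<in> darts M \<Longrightarrow> succ M d \<in> W \<longleftrightarrow> d \<in> W"
    and W_opp: "d \<in> darts M \<Longrightarrow> opp M d \<in> W \<longleftrightarrow> d \<notin> W"
    and outs_M_sub: "outs M \<subseteq> darts M" and outs_T_sub: "outs T \<subseteq> darts T"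
    and outs_p [simp]: "d \<in> darts M \<Longrightarrow> p d \<in> outs T \<longleftrightarrow> d \<in> outs M"
    and outs_q [simp]: "d \<in> darts M \<Longrightarrow> q d \<in> outs T \<longleftrightarrow> (if d \<in> W then d \<notin> outs M else succ M d \<notin> outs M)"
    and outs_r [simp]: "d \<in> darts M \<Longrightarrow> r d \<in> outs T \<longleftrightarrow> q d \<notin> outs T"
begin

lemma opp_r [simp]: "d \<in> darts M \<Longrightarrow> opp T (r d) = q d"
  by (metis opp_q T.opp_opp)

lemma in_T [simp]: "d \<in> darts M \<Longrightarrow> p d \<in> darts T" "d \<in> darts M \<Longrightarrow> q d \<in> darts T" "d \<in> darts M \<Longrightarrow> r d \<in> darts T"
  by (auto simp: darts_T)

lemma dart_cases [consumes 1, case_names p q r]: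
  assumes "x \<in> darts T"
  obtains d where "d \<in> darts M" "x = p d" | d where "d \<in> darts M" "x = q d" | d where "d \<in> darts M" "x = r d"
  using assms by (auto simp: darts_T)

lemma eq_iffs [simp]:
  assumes "d \<in> darts M" "e \<in> darts M"
  shows "p d = p e \<longleftrightarrow> d = e" "q d = q e \<longleftrightarrow> d = e" "r d = r e \<longleftrightarrow> d = e"
    "p d \<noteq> q e" "q e \<noteq> p d" "p d \<noteq> r e" "r e \<noteq> p d" "q d \<noteq> r e" "r e \<noteq> q d"
  using assms inj_p inj_q inj_r pq pr qr by (auto simp: inj_on_def)

lemma next_p [simp]: "d \<in> darts M \<Longrightarrow> next_in_face T (p d) = q (next_in_face M d)"
proof -
  assume d: "d \<in> darts M"
  then have "succ T (next_in_face T (p d)) = succ T (q (next_in_face M d))" by simp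
  then show ?thesis by (simp only: T.s.inj_iff)
qed

lemma next_r [simp]: "d \<in> darts M \<Longrightarrow> next_in_face T (r d) = p d"
proof -
  assume d: "d \<in> darts M"
  then have "succ T (next_in_face T (r d)) = succ T (p d)" by simp
  then show ?thesis by (simp only: T.s.inj_iff)
qed

lemma next_q [simp]: "d \<in> darts M \<Longrightarrow> next_in_face T (q (next_in_face M d)) = r d"
proof -
  assume d: "d \<in> darts M"
  then have "succ T (next_in_face T (q (next_in_face M d))) = succ T (r d)" by simp
  then show ?thesis by (simp only: T.s.inj_iff)
qed

section \<open>Vertices, faces and Euler characteristic of the triangulation\<close>

definition rb_vertex :: "'d set \<Rightarrow> 'e set" where "rb_vertex v = p ` v \<union> q ` v"

lemma p_in_rb: "d \<in> darts M \<Longrightarrow> v \<subseteq> darts M \<Longrightarrow> p d \<in> rb_vertex v \<longleftrightarrow> d \<in> v"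
  and r_in_rb: "d \<in> darts M \<Longrightarrow> v \<subseteq> darts M \<Longrightarrow> r d \<notin> rb_vertex v"
  and r_in_green: "d \<in> darts M \<Longrightarrow> v \<subseteq> darts M \<Longrightarrow> r d \<in> r ` v \<longleftrightarrow> d \<in> v"
  unfolding rb_vertex_def by (auto simp: subset_iff)

lemma vertex_p: assumes d: "d \<in> darts M" shows "vertex_of T (p d) = rb_vertex (vertex_of M d)"
proof (intro set_eqI iffI)
  fix x assume "x \<in> vertex_of T (p d)"
  then show "x \<in> rb_vertex (vertex_of M d)" unfolding vertex_of_def[of T]
  proof (induction rule: T.s.orbit_induct)
    case base then show ?case by (simp add: rb_vertex_def)
  next
    case (step z)
    then obtain e where e: "e \<in> vertex_of M d" "z = p e \<or> z = q e" by (auto simp: rb_vertex_def)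
    then have "e \<in> darts M" "succ M e \<in> vertex_of M d"
      using M.vertex_sub[OF d] by (auto simp flip: M.vertex_eq_iff)
    then show ?case using e by (auto simp: rb_vertex_def)
  qed
next
  fix x assume "x \<in> rb_vertex (vertex_of M d)"
  then obtain e where e: "e \<in> orbit (succ M) d" "x = p e \<or> x = q e"
    by (auto simp: rb_vertex_def vertex_of_def)
  from e(1) have "vertex_of T (p e) = vertex_of T (p d)"
  proof (induction rule: M.s.orbit_induct)
    case (step z)
    then have z: "z \<in> darts M" using M.s.orbit_sub[OF d] by blast
    have "vertex_of T (p (succ M z)) = vertex_of T (succ T (succ T (p z)))" using z by simp
    then show ?case using step by (simp only: T.vertex_succ)
  qed simp
  moreover have "vertex_of T (q e) = vertex_of T (p e)"
  proof -
    have "e \<in> darts M" using e(1) M.s.orbit_sub[OF d] by blast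
    then have "q e = succ T (p e)" by simp
    then show ?thesis by (simp only: T.vertex_succ)
  qed
  ultimately show "x \<in> vertex_of T (p d)" using e(2) T.in_vertex by metis
qed

lemma vertex_q: "d \<in> darts M \<Longrightarrow> vertex_of T (q d) = rb_vertex (vertex_of M d)"
  using vertex_p T.vertex_succ[of "p d"] by simp

lemma vertex_r: assumes d: "d \<in> darts M" shows "vertex_of T (r d) = r ` face_of M d"
proof (intro set_eqI iffI)
  fix x assume "x \<in> vertex_of T (r d)"
  then show "x \<in> r ` face_of M d" unfolding vertex_of_def[of T]
  proof (induction rule: T.s.orbit_induct)
    case (step z)
    then obtain e where e: "e \<in> face_of M d" "z = r e" by auto
    then have "e \<in> darts M" "next_in_face M e \<in> face_of M d"
      using M.face_sub[OF d] by (auto simp flip: M.face_eq_iff)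
    then show ?case using e by auto
  qed simp
next
  fix x assume "x \<in> r ` face_of M d"
  then obtain e where e: "e \<in> orbit (next_in_face M) d" "x = r e"
    by (auto simp: face_of_def)
  from e(1) have "vertex_of T (r e) = vertex_of T (r d)"
  proof (induction rule: M.f.orbit_induct)
    case (step z)
    then have z: "z \<in> darts M" using M.f.orbit_sub[OF d] by blast
    then show ?case using step T.vertex_succ[of "r z"] by simp
  qed simp
  then show "x \<in> vertex_of T (r d)" using e(2) T.in_vertex by metis
qed

lemma face_p: assumes d: "d \<in> darts M" shows "face_of T (p d) = {p d, q (next_in_face M d), r d}"
proof (intro set_eqI iffI)
  fix x assume "x \<in> face_of T (p d)"
  then show "x \<in> {p d, q (next_in_face M d), r d}" unfolding face_of_def[of T]
    by (induction rule: T.f.orbit_induct) (use d in auto)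
next
  fix x assume x: "x \<in> {p d, q (next_in_face M d), r d}"
  have "face_of T (q (next_in_face M d)) = face_of T (p d)" using T.face_next[of "p d"] d by simp
  moreover have "face_of T (r d) = face_of T (p d)" using T.face_next[of "r d"] d by simp
  ultimately show "x \<in> face_of T (p d)" using x T.in_face by (metis insertE singletonD)
qed

lemma face_r: "d \<in> darts M \<Longrightarrow> face_of T (r d) = face_of T (p d)"
  using T.face_next[of "r d"] by simp

lemma face_q: "d \<in> darts M \<Longrightarrow> face_of T (q (next_in_face M d)) = face_of T (p d)"
  using T.face_next[of "p d"] by simp

lemma face_q': "d \<in> darts M \<Longrightarrow> face_of T (q d) = face_of T (p (inv (next_in_face M) d))"
  using face_q[of "inv (next_in_face M) d"] by simp

lemma vertices_T: "vertices T = rb_vertex ` vertices M \<union> (`) r ` faces M"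
proof -
  have "vertices T = vertex_of T ` p ` darts M \<union> vertex_of T ` q ` darts M \<union> vertex_of T ` r ` darts M"
    by (simp add: vertices_def darts_T image_Un)
  also have "\<dots> = rb_vertex ` vertices M \<union> (`) r ` faces M"
    unfolding vertices_def[of M] faces_def[of M] image_image using vertex_p vertex_q vertex_r by force
  finally show ?thesis .
qed

lemma vertex_M_sub: "v \<in> vertices M \<Longrightarrow> v \<subseteq> darts M"
  using M.in_vertexD by blast

lemma face_M_sub: "f \<in> faces M \<Longrightarrow> f \<subseteq> darts M"
  using M.in_faceD by blast

lemma inj_rb: "inj_on rb_vertex (vertices M)"
proof (rule inj_onI)
  fix v w assume vw: "v \<in> vertices M" "w \<in> vertices M" "rb_vertex v = rb_vertex w"
  then have "d \<in> v \<longleftrightarrow> d \<in> w" if "d \<in> darts M" for d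
    using p_in_rb[OF that] vertex_M_sub by blast
  then show "v = w" using vw vertex_M_sub by blast
qed

lemma inj_green: "inj_on ((`) r) (faces M)"
proof (rule inj_onI)
  fix v w assume vw: "v \<in> faces M" "w \<in> faces M" "r ` v = r ` w"
  then have "d \<in> v \<longleftrightarrow> d \<in> w" if "d \<in> darts M" for d
    using r_in_green[OF that] face_M_sub by blast
  then show "v = w" using vw face_M_sub by blast
qed

lemma rb_neq_green: "v \<in> vertices M \<Longrightarrow> f \<in> faces M \<Longrightarrow> rb_vertex v \<noteq> r ` f"
proof
  assume vf: "v \<in> vertices M" "f \<in> faces M" "rb_vertex v = r ` f"
  then obtain d where "d \<in> darts M" "f = face_of M d" by (auto simp: faces_def)
  then show False using r_in_rb[of d v] vf vertex_M_sub M.in_face by blast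
qed

lemma card_vertices_T: "card (vertices T) = card (vertices M) + card (faces M)"
proof -
  have "rb_vertex ` vertices M \<inter> (`) r ` faces M = {}" using rb_neq_green by blast
  then show ?thesis unfolding vertices_T
    by (simp add: card_Un_disjoint M.finite_vertices M.finite_faces card_image inj_rb inj_green)
qed

lemma faces_T: "faces T = (\<lambda>d. face_of T (p d)) ` darts M"
proof (intro subset_antisym subsetI)
  fix f assume "f \<in> faces T"
  then obtain x where x: "x \<in> darts T" "f = face_of T x" by (auto simp: faces_def)
  from x(1) show "f \<in> (\<lambda>d. face_of T (p d)) ` darts M"
  proof (cases rule: dart_cases)
    case (q d)
    then have "f = face_of T (p (inv (next_in_face M) d))" using x face_q' by simp
    then show ?thesis using q(1) by (intro image_eqI[of _ _ "inv (next_in_face M) d"]) auto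
  qed (use x face_r in auto)
qed auto

lemma card_faces_T: "card (faces T) = card (darts M)"
proof -
  have "inj_on (\<lambda>d. face_of T (p d)) (darts M)"
  proof (rule inj_onI)
    fix d e assume de: "d \<in> darts M" "e \<in> darts M" "face_of T (p d) = face_of T (p e)"
    then have "p d \<in> {p e, q (next_in_face M e), r e}" using face_p by blast
    then show "d = e" using de by auto
  qed
  then show ?thesis unfolding faces_T by (rule card_image)
qed

lemma card_edges_T: "card (edges T) = 3 * card (edges M)"
proof -
  have "card (darts T) = card (p ` darts M \<union> q ` darts M) + card (r ` darts M)"
    unfolding darts_T using M.finite_darts pr qr by (intro card_Un_disjoint) auto
  also have "card (p ` darts M \<union> q ` darts M) = card (p ` darts M) + card (q ` darts M)"
    using M.finite_darts pq by (intro card_Un_disjoint) auto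
  finally have "card (darts T) = 3 * card (darts M)"
    by (simp add: card_image inj_p inj_q inj_r)
  then show ?thesis using M.card_darts T.card_darts by simp
qed

text \<open>With \<open>V\<close>, \<open>E\<close> and \<open>F\<close> counting the vertices,
  edges and faces of \<open>M\<close>, the triangulation has \<open>V + F\<close> vertices,
  \<open>3E\<close> edges and \<open>2E\<close> faces.\<close>

lemma euler_iff: "card (vertices T) + card (faces T) = card (edges T) + 2
    \<longleftrightarrow> card (vertices M) + card (faces M) = card (edges M) + 2"
  using card_vertices_T card_faces_T card_edges_T M.card_darts by linarith

lemma planar_T_if_M: assumes "planar M" shows "planar T"
proof -
  interpret MP: planar M by (rule assms)
  let ?R = "{(d, succ T d) |d. d \<in> darts T} \<union> {(d, opp T d) |d. d \<in> darts T}"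
  have step: "(x, succ T y) \<in> ?R\<^sup>*" "(x, opp T y) \<in> ?R\<^sup>*" if "(x, y) \<in> ?R\<^sup>*" "y \<in> darts T" for x y
    using that by (auto intro: rtrancl_into_rtrancl)
  have all_p: "(x, p d) \<in> ?R\<^sup>*" if "(x, p e) \<in> ?R\<^sup>*" "d \<in> darts M" "e \<in> darts M" for x d e
    using that(2,3)
  proof (induction rule: MP.dart_induct)
    case (succ d)
    then have "(x, succ T (succ T (p d))) \<in> ?R\<^sup>*" by (intro step) auto
    then show ?case using succ by simp
  next
    case (opp d)
    then have "(x, opp T (p d)) \<in> ?R\<^sup>*" by (intro step) auto
    then show ?case using opp by simp
  qed (rule that(1))
  have "(x, y) \<in> ?R\<^sup>*" if "x \<in> darts T" "y \<in> darts T" for x y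
  proof -
    from that(1) have "\<exists>e\<in>darts M. (x, p e) \<in> ?R\<^sup>*"
    proof (cases rule: dart_cases)
      case (q d)
      then have "(x, succ T x) \<in> ?R\<^sup>*" by (intro step) auto
      then show ?thesis using q by (intro bexI[of _ "succ M d"]) simp_all
    next
      case (r d)
      then have "(x, succ T (opp T x)) \<in> ?R\<^sup>*" by (intro step) auto
      then show ?thesis using r by (intro bexI[of _ "succ M d"]) simp_all
    qed blast
    then obtain e where e: "e \<in> darts M" "(x, p e) \<in> ?R\<^sup>*" by blast
    from that(2) show ?thesis
    proof (cases rule: dart_cases)
      case (p d)
      then show ?thesis using all_p[OF e(2) _ e(1)] by simp
    next
      case (q d)
      then have "(x, succ T (p d)) \<in> ?R\<^sup>*" using all_p[OF e(2) q(1) e(1)] by (intro step) auto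
      then show ?thesis using q by simp
    next
      case (r d)
      then have "(x, opp T (succ T (p d))) \<in> ?R\<^sup>*" using all_p[OF e(2) r(1) e(1)] by (intro step) auto
      then show ?thesis using r by simp
    qed
  qed
  then show ?thesis
    using euler_iff MP.euler by unfold_locales (auto simp: map_connected_def)
qed

text \<open>Sending \<open>p d\<close>, \<open>q d\<close> and \<open>r d\<close> all to
  \<open>d\<close> projects every step in \<open>T\<close> to a walk in \<open>M\<close>.\<close>

lemma planar_M_if_T: assumes "planar T" shows "planar M"
proof -
  interpret TP: planar T by (rule assms)
  let ?R = "{(d, succ M d) |d. d \<in> darts M} \<union> {(d, opp M d) |d. d \<in> darts M}"
  have step: "(x, succ M y) \<in> ?R\<^sup>*" "(x, opp M y) \<in> ?R\<^sup>*" if "(x, y) \<in> ?R\<^sup>*" "y \<in> darts M" for x y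
    using that by (auto intro: rtrancl_into_rtrancl)
  \<comment> \<open>Steps against \<open>succ M\<close> are reached going forward, its orbits being
    finite.\<close>
  have inv_step: "(x, inv (succ M) y) \<in> ?R\<^sup>*" if xy: "(x, y) \<in> ?R\<^sup>*" "y \<in> darts M" for x y
  proof -
    have "inv (succ M) y \<in> orbit (succ M) y" by simp
    then show ?thesis
    proof (induction rule: M.s.orbit_induct)
      case (step z)
      then have "z \<in> darts M" using M.s.orbit_sub[OF xy(2)] by blast
      then show ?case using \<open>(x, z) \<in> ?R\<^sup>*\<close> by (auto intro: rtrancl_into_rtrancl)
    qed (rule xy(1))
  qed
  have next_step: "(x, next_in_face M y) \<in> ?R\<^sup>*" if "(x, y) \<in> ?R\<^sup>*" "y \<in> darts M" for x y
    unfolding next_in_face_def comp_apply using that by (intro inv_step step) auto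
  have "(x, y) \<in> ?R\<^sup>*" if x: "x \<in> darts M" and y: "y \<in> darts M" for x y
  proof -
    have "\<forall>d\<in>darts M. z = p d \<or> z = q d \<or> z = r d \<longrightarrow> (x, d) \<in> ?R\<^sup>*" if "z \<in> darts T" for z
      using that in_T(1)[OF x]
    proof (induction rule: TP.dart_induct)
      case base then show ?case using x by auto
    next
      case (succ z)
      from succ(1) show ?case
      proof (cases rule: dart_cases)
        case (p d) then show ?thesis using succ by auto
      next
        case (q d) then show ?thesis using succ step by auto
      next
        case (r d) then show ?thesis using succ next_step by auto
      qed
    next
      case (opp z)
      from opp(1) show ?case
      proof (cases rule: dart_cases)
        case (p d) then show ?thesis using opp step by auto
      next
        case (q d) then show ?thesis using opp by auto
      next
        case (r d) then show ?thesis using opp by auto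
      qed
    qed
    then show ?thesis using y in_T(1)[OF y] by blast
  qed
  then show ?thesis
    using euler_iff TP.euler by unfold_locales (auto simp: map_connected_def)
qed

lemma orientation_iff: "orientation T \<longleftrightarrow> orientation M"
proof
  assume T: "orientation T"
  have "(d \<in> outs M) \<noteq> (opp M d \<in> outs M)" if d: "d \<in> darts M" for d
  proof -
    have "(p d \<in> outs T) \<noteq> (opp T (p d) \<in> outs T)"
      using T in_T(1)[OF d] unfolding orientation_def by blast
    then show ?thesis using d by (simp only: opp_p outs_p M.o.in_iff) simp
  qed
  then show "orientation M" using outs_M_sub unfolding orientation_def by blast
next
  assume M: "orientation M"
  have "(x \<in> outs T) \<noteq> (opp T x \<in> outs T)" if "x \<in> darts T" for x
    using that
  proof (cases rule: dart_cases)
    case (p d)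
    then have "(d \<in> outs M) \<noteq> (opp M d \<in> outs M)" using M unfolding orientation_def by blast
    then show ?thesis using p by (simp only: opp_p outs_p M.o.in_iff) simp
  qed simp_all
  then show "orientation T" using outs_T_sub unfolding orientation_def by blast
qed

section \<open>Extremal corners of the triangulation\<close>

lemma lateral_p: "d \<in> darts M \<Longrightarrow> lateral T (p d) \<longleftrightarrow> d \<in> W \<or> (d \<in> outs M) = (succ M d \<in> outs M)"
  by (auto simp: lateral_def)

text \<open>The edge to the green vertex halves the corner of \<open>d\<close>. The half at
  \<open>p d\<close> is light iff \<open>d\<close> is black, the half at \<open>q d\<close> iff
  \<open>d\<close> is white; a change at \<open>d\<close> shows as one extremal corner, in the light
  half.\<close>

lemma lateral_q: "d \<in> darts M \<Longrightarrow> lateral T (q d) \<longleftrightarrow> d \<notin> W \<or> (d \<in> outs M) = (succ M d \<in> outs M)"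
  by (auto simp: lateral_def)

text \<open>For black \<open>d\<close> the corner is light, and the dark triangles on either side of
  it transfer the orientations of the two neighbouring contour darts, both white, to its two
  edges.\<close>

lemma lateral_r:
  assumes "orientation M" "d \<in> darts M"
  shows "lateral T (r d) \<longleftrightarrow> d \<in> W \<or> (inv (next_in_face M) d \<in> outs M) = (next_in_face M d \<in> outs M)"
proof -
  have opp: "opp M e \<in> outs M \<longleftrightarrow> e \<notin> outs M" if "e \<in> darts M" for e
    using assms(1) that unfolding orientation_def by blast
  have nW: "next_in_face M d \<in> W \<longleftrightarrow> d \<notin> W"
    using W_succ[of "next_in_face M d"] W_opp assms(2) by simp
  have "succ M d \<in> outs M \<longleftrightarrow> inv (next_in_face M) d \<notin> outs M"
    using opp[of "inv (next_in_face M) d"] assms(2) by (simp add: M.opp_inv_next)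
  then show ?thesis using assms(2) nW opp[of d] by (auto simp: lateral_def)
qed

text \<open>The light triangle of the root edge. From the root corner its contour visits the sink,
  the green vertex of the outer face and the source, in the prescribed order red, green,
  blue.\<close>

lemma outer_face_T: "outer_face T = {p (root M), q (next_in_face M (root M)), r (root M)}"
  unfolding outer_face_def root_T using face_q face_p by simp

lemma outer_vertices_T: "outer_vertices T = {rb_vertex (vertex_of M (root M)),
    rb_vertex (vertex_of M (next_in_face M (root M))), r ` outer_face M}"
  unfolding outer_vertices_def outer_face_T outer_face_def[of M]
  by (auto simp: vertex_p vertex_q vertex_r simp del: M.vertex_next)

lemma inner_vertices_T:
  "inner_vertices T = rb_vertex ` (vertices M - {vertex_of M (root M), vertex_of M (next_in_face M (root M))})
    \<union> (`) r ` inner_faces M"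
proof -
  have *: "vertex_of M (root M) \<in> vertices M" "vertex_of M (next_in_face M (root M)) \<in> vertices M"
    "outer_face M \<in> faces M" using M.outer_face_in by auto
  have "inner_vertices T = (rb_vertex ` vertices M
      - rb_vertex ` {vertex_of M (root M), vertex_of M (next_in_face M (root M))})
      \<union> ((`) r ` faces M - (`) r ` {outer_face M})"
    unfolding inner_vertices_def vertices_T outer_vertices_T using rb_neq_green * by (auto simp del: M.vertex_next; metis)
  also have "\<dots> = rb_vertex ` (vertices M - {vertex_of M (root M), vertex_of M (next_in_face M (root M))})
      \<union> (`) r ` (faces M - {outer_face M})"
    using inj_on_image_set_diff[OF inj_rb, of "vertices M" "{vertex_of M (root M), vertex_of M (next_in_face M (root M))}"]
      inj_on_image_set_diff[OF inj_green, of "faces M" "{outer_face M}"] * by simp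
  finally show ?thesis by (simp add: inner_faces_def)
qed

lemma rooted_triangulation_T: assumes "planar T" shows "rooted_triangulation T"
proof -
  have "card f = 3" if f: "f \<in> faces T" for f
  proof -
    obtain d where d: "d \<in> darts M" "f = face_of T (p d)" using f faces_T by auto
    then show ?thesis unfolding d(2) face_p[OF d(1)] by simp
  qed
  then show ?thesis using assms by (simp add: rooted_triangulation_def rooted_planar_map_iff)
qed

lemma card_rb: assumes "v \<in> vertices M" shows "card (rb_vertex v) = 2 * card v"
proof -
  have v: "v \<subseteq> darts M" "finite v" using assms vertex_M_sub M.finite_vertex by auto
  then have "card (rb_vertex v) = card (p ` v) + card (q ` v)"
    unfolding rb_vertex_def using pq by (intro card_Un_disjoint) auto
  then show ?thesis using v inj_p inj_q by (simp add: card_image inj_on_subset)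
qed

lemma card_green: "f \<in> faces M \<Longrightarrow> card (r ` f) = card f"
  using inj_r face_M_sub by (simp add: card_image inj_on_subset)

lemma bicolored: assumes "planar M" "orientation M" shows "bicolored_map M W"
proof -
  interpret planar M by (rule assms)
  show ?thesis using assms(2) W_sub root_W W_succ W_opp by unfold_locales auto
qed

lemma eulerian_T: assumes "planar M" "orientation M" shows "eulerian_triangulation T"
proof -
  interpret B: bicolored_map M W by (rule bicolored[OF assms])
  have "even (card v)" if "v \<in> vertices T" for v
    using that card_rb card_green B.even_card_face by (auto simp: vertices_T)
  then show ?thesis unfolding eulerian_triangulation_def
    using rooted_triangulation_T planar_T_if_M assms by blast
qed

definition light_faces :: "'e set set" where
  "light_faces = (\<lambda>d. face_of T (p d)) ` (darts M - W)"

lemma face_p_light: assumes "d \<in> darts M" shows "face_of T (p d) \<in> light_faces \<longleftrightarrow> d \<notin> W"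
proof
  assume "face_of T (p d) \<in> light_faces"
  then obtain e where e: "e \<in> darts M" "e \<notin> W" "face_of T (p d) = face_of T (p e)"
    by (auto simp: light_faces_def)
  then have "p d \<in> {p e, q (next_in_face M e), r e}" using face_p T.in_face by metis
  then show "d \<notin> W" using e assms by auto
qed (use assms in \<open>auto simp: light_faces_def\<close>)

lemma inv_next_W: "d \<in> darts M \<Longrightarrow> inv (next_in_face M) d \<in> W \<longleftrightarrow> d \<notin> W"
  using W_opp[of "succ M d"] W_succ M.opp_succ by simp

lemma face_q_light: "d \<in> darts M \<Longrightarrow> face_of T (q d) \<in> light_faces \<longleftrightarrow> d \<in> W"
  by (simp add: face_q' face_p_light inv_next_W)

lemma light_bicoloring: "face_bicoloring T light_faces"
  unfolding face_bicoloring_def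
proof (intro conjI ballI)
  show "light_faces \<subseteq> faces T" by (auto simp: light_faces_def)
  show "outer_face T \<in> light_faces"
    unfolding outer_face_def root_T using face_q face_p_light root_W by simp
  fix x assume "x \<in> darts T"
  then show "(face_of T x \<in> light_faces) \<noteq> (face_of T (opp T x) \<in> light_faces)"
    by (cases rule: dart_cases) (auto simp: face_p_light face_q_light face_r W_opp)
qed

lemma extremal_light:
  assumes "orientation M" "x \<in> darts T" "extremal T x" shows "face_of T x \<in> light_faces"
  using assms(2)
  by (cases rule: dart_cases)
    (use assms in \<open>auto simp: face_p_light face_q_light face_r lateral_p lateral_q lateral_r\<close>)

lemma rb_extremal:
  assumes v: "v \<in> vertices M"
  shows "card {x \<in> rb_vertex v. extremal T x} = vertex_changes M v"
proof -
  have vD: "v \<subseteq> darts M" using v vertex_M_sub by blast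
  \<comment> \<open>Selects the light half of the corner of \<open>d\<close>.\<close>
  define h where "h = (\<lambda>d. if d \<in> W then q d else p d)"
  have "{x \<in> rb_vertex v. extremal T x} = h ` {d\<in>v. vertex_change M d}"
  proof (intro set_eqI iffI)
    fix x assume x: "x \<in> {x \<in> rb_vertex v. extremal T x}"
    then obtain d where d: "d \<in> v" "x = p d \<or> x = q d" by (auto simp: rb_vertex_def)
    then have "x = h d \<and> vertex_change M d"
      using x vD lateral_p[of d] lateral_q[of d] unfolding h_def by auto
    then show "x \<in> h ` {d\<in>v. vertex_change M d}" using d(1) by blast
  next
    fix x assume "x \<in> h ` {d\<in>v. vertex_change M d}"
    then obtain d where d: "d \<in> v" "x = h d" "vertex_change M d" by blast
    then show "x \<in> {x \<in> rb_vertex v. extremal T x}"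
      using vD lateral_p[of d] lateral_q[of d] unfolding h_def by (auto simp: rb_vertex_def)
  qed
  moreover have "inj_on h v"
  proof (rule inj_onI)
    fix d e assume "d \<in> v" "e \<in> v" "h d = h e"
    then show "d = e" using vD unfolding h_def by (auto split: if_splits simp: subset_iff)
  qed
  ultimately show ?thesis by (simp add: card_image inj_on_subset)
qed

text \<open>The extremal corner belonging to a white change at \<open>d\<close> sits at the black
  dart between the two white ones, whence the shift by \<open>next_in_face M\<close>.\<close>

lemma green_extremal:
  assumes f: "f \<in> faces M" and o: "orientation M"
  shows "card {x \<in> r ` f. extremal T x} =
    card {d\<in>f. d \<in> W \<and> two_step_change M d}"
proof -
  let ?n = "next_in_face M"
  have fD: "f \<subseteq> darts M" using f face_M_sub by blast
  have nf: "?n d \<in> f \<longleftrightarrow> d \<in> f" for d using f by (auto simp: M.faces_altdef)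
  have "{x \<in> r ` f. extremal T x}
      = (\<lambda>d. r (?n d)) ` {d\<in>f. d \<in> W \<and> two_step_change M d}"
  proof (intro set_eqI iffI)
    fix x assume x: "x \<in> {x \<in> r ` f. extremal T x}"
    then obtain d where d: "d \<in> f" "x = r d" by auto
    let ?e = "inv ?n d"
    have "?e \<in> f" using nf[of ?e] d by simp
    moreover have "d \<notin> W \<and> (?e \<in> outs M) \<noteq> (?n d \<in> outs M)"
      using x d fD lateral_r[OF o, of d] by auto
    ultimately have "?e \<in> {d\<in>f. d \<in> W \<and> two_step_change M d}"
      using d fD inv_next_W[of d] by auto
    moreover have "x = r (?n ?e)" using d by simp
    ultimately show "x \<in> (\<lambda>d. r (?n d)) ` {d\<in>f. d \<in> W \<and> two_step_change M d}"
      by blast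
  next
    fix x assume "x \<in> (\<lambda>d. r (?n d)) ` {d\<in>f. d \<in> W \<and> two_step_change M d}"
    then obtain d where d: "d \<in> f" "d \<in> W" "two_step_change M d" "x = r (?n d)" by blast
    then have "d \<in> darts M" using fD by blast
    then show "x \<in> {x \<in> r ` f. extremal T x}"
      using d nf lateral_r[OF o, of "?n d"] inv_next_W[of "?n d"] by auto
  qed
  moreover have "inj_on (\<lambda>d. r (?n d)) f"
    using fD by (intro inj_onI) (auto simp: subset_iff)
  ultimately show ?thesis by (simp add: card_image inj_on_subset)
qed

end

section \<open>The conditions (PO1) and (PO2) on the red-blue map\<close>

context star_pair
begin

abbreviation (input) "N_vertex \<equiv> vertex_of M (next_in_face M (root M))"
abbreviation (input) "S_vertex \<equiv> vertex_of M (root M)"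

lemma vertex_T_in_iff:
  assumes "v \<in> vertices T" shows "(\<forall>x\<in>v. lateral T x) \<longleftrightarrow> card {x\<in>v. extremal T x} = 0"
  using T.finite_vertex[OF assms] by auto

lemma no_outer_extremal_iff:
  assumes o: "orientation M"
  shows "(\<forall>x\<in>darts T. vertex_of T x \<in> outer_vertices T \<longrightarrow> lateral T x) \<longleftrightarrow>
    vertex_changes M S_vertex = 0 \<and> vertex_changes M N_vertex = 0 \<and>
    card {d\<in>outer_face M. d \<in> W \<and> two_step_change M d} = 0"
proof -
  have sub: "outer_vertices T \<subseteq> vertices T"
    unfolding outer_vertices_T vertices_T using M.outer_face_in by (auto simp del: M.vertex_next)
  have "(\<forall>x\<in>darts T. vertex_of T x \<in> outer_vertices T \<longrightarrow> lateral T x)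
      \<longleftrightarrow> (\<forall>v\<in>outer_vertices T. \<forall>x\<in>v. lateral T x)"
  proof (intro iffI ballI impI)
    fix v x assume "\<forall>x\<in>darts T. vertex_of T x \<in> outer_vertices T \<longrightarrow> lateral T x" "v \<in> outer_vertices T" "x \<in> v"
    then show "lateral T x" using sub T.in_vertexD[of v x] by blast
  next
    fix x assume "\<forall>v\<in>outer_vertices T. \<forall>x\<in>v. lateral T x" "vertex_of T x \<in> outer_vertices T"
    then show "lateral T x" using T.in_vertex by blast
  qed
  also have "\<dots> \<longleftrightarrow> (\<forall>v\<in>outer_vertices T. card {x\<in>v. extremal T x} = 0)"
    using vertex_T_in_iff sub by blast
  also have "\<dots> \<longleftrightarrow> card {x\<in>rb_vertex S_vertex. extremal T x} = 0 \<and>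
      card {x\<in>rb_vertex N_vertex. extremal T x} = 0 \<and> card {x\<in>r ` outer_face M. extremal T x} = 0"
    unfolding outer_vertices_T by (simp only: ball_simps simp_thms)
  finally show ?thesis
    by (simp only: rb_extremal[OF M.vertex_in[OF M.root_in]] green_extremal[OF M.outer_face_in o]
        rb_extremal[OF M.vertex_in[OF M.f.in_iff[THEN iffD2, OF M.root_in]]])
qed

lemma outer_face_outs_iff:
  "outer_face T \<subseteq> outs T \<longleftrightarrow>
     root M \<in> outs M \<and> next_in_face M (root M) \<notin> outs M \<and> succ M (root M) \<in> outs M"
proof -
  have "next_in_face M (root M) \<in> W" using inv_next_W[of "next_in_face M (root M)"] root_W by simp
  then show ?thesis unfolding outer_face_T using root_W by auto
qed

lemma inner_extremal_iff:
  assumes o: "orientation M"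
  shows "(\<forall>v\<in>inner_vertices T. card {d\<in>v. extremal T d} = 2) \<longleftrightarrow>
    (\<forall>v\<in>vertices M. v \<noteq> S_vertex \<longrightarrow> v \<noteq> N_vertex \<longrightarrow> vertex_changes M v = 2) \<and>
    (\<forall>f\<in>inner_faces M. card {d\<in>f. d \<in> W \<and> two_step_change M d} = 2)"
proof -
  have "(\<forall>v\<in>inner_vertices T. card {d\<in>v. extremal T d} = 2) \<longleftrightarrow>
      (\<forall>v\<in>vertices M - {S_vertex, N_vertex}. card {d\<in>rb_vertex v. extremal T d} = 2) \<and>
      (\<forall>f\<in>inner_faces M. card {d\<in>r ` f. extremal T d} = 2)"
    unfolding inner_vertices_T by blast
  also have "(\<forall>v\<in>vertices M - {S_vertex, N_vertex}. card {d\<in>rb_vertex v. extremal T d} = 2) \<longleftrightarrow>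
      (\<forall>v\<in>vertices M - {S_vertex, N_vertex}. vertex_changes M v = 2)"
    by (intro ball_cong refl) (simp add: rb_extremal)
  also have "(\<forall>f\<in>inner_faces M. card {d\<in>r ` f. extremal T d} = 2) \<longleftrightarrow>
      (\<forall>f\<in>inner_faces M. card {d\<in>f. d \<in> W \<and> two_step_change M d} = 2)"
    by (intro ball_cong refl) (simp add: green_extremal[OF _ o] inner_faces_def)
  finally show ?thesis by blast
qed

text \<open>Without changes, one dart decides for all: the outgoing root dart for the source, the
  ingoing dart after it for the sink and, being white, also for the white darts of the outer
  face.\<close>

lemma polyhedral_imp_balanced:
  assumes poly: "polyhedral_orientation T"
  shows "bicolored_map M W" "bicolored_map.balanced M W"
proof -
  have "planar M"
    using poly planar_M_if_T
    by (simp add: polyhedral_orientation_def eulerian_triangulation_def rooted_triangulation_def rooted_planar_map_iff)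
  moreover have o: "orientation M" using poly orientation_iff by (simp add: polyhedral_orientation_def)
  ultimately show bm: "bicolored_map M W" by (rule bicolored)
  interpret B: bicolored_map M W by (rule bm)
  have outer: "vertex_changes M S_vertex = 0" "vertex_changes M N_vertex = 0" "B.white_changes (outer_face M) = 0"
    using poly no_outer_extremal_iff[OF o] unfolding polyhedral_orientation_def by blast+
  have root: "root M \<in> outs M" "next_in_face M (root M) \<notin> outs M"
    using poly outer_face_outs_iff unfolding polyhedral_orientation_def by blast+
  have inner: "\<forall>v\<in>vertices M. v \<noteq> S_vertex \<longrightarrow> v \<noteq> N_vertex \<longrightarrow> vertex_changes M v = 2"
    "\<forall>f\<in>inner_faces M. B.white_changes f = 2"
    using poly inner_extremal_iff[OF o] unfolding polyhedral_orientation_def by blast+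
  have S: "S_vertex \<subseteq> outs M"
    using outer(1) M.vertex_two_changes[of S_vertex "outs M"] root(1) M.in_vertex[of "root M"]
      M.vertex_in[OF M.root_in] by fastforce
  have N: "N_vertex \<inter> outs M = {}"
  proof (rule ccontr)
    assume "N_vertex \<inter> outs M \<noteq> {}"
    moreover have "\<not> N_vertex \<subseteq> outs M" using root(2) M.in_vertex by blast
    moreover have "N_vertex \<in> vertices M" by (intro M.vertex_in) simp
    ultimately have "2 \<le> vertex_changes M N_vertex" using M.vertex_two_changes by blast
    then show False using outer(2) by linarith
  qed
  have "outer_face M \<inter> W \<inter> outs M = {}"
  proof (rule ccontr)
    assume "outer_face M \<inter> W \<inter> outs M \<noteq> {}"
    moreover have "next_in_face M (root M) \<in> W" using root_W by (simp add: B.next_W)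
    ultimately have "B.mixed (outer_face M)"
      unfolding B.mixed_def using root(2) B.root_outer(2) by blast
    then show False using B.mixed_white_changes[OF M.outer_face_in] outer(3) by linarith
  qed
  then show B.balanced unfolding B.balanced_def using S N inner by blast
qed

lemma balanced_imp_polyhedral:
  assumes bm: "bicolored_map M W" and bal: "bicolored_map.balanced M W"
  shows "polyhedral_orientation T"
proof -
  interpret B: bicolored_map M W by (rule bm)
  have o: "orientation M" by (rule B.orientation)
  have S: "S_vertex \<subseteq> outs M" and N: "N_vertex \<inter> outs M = {}" and W0: "outer_face M \<inter> W \<inter> outs M = {}"
    and inner: "\<forall>v\<in>vertices M. v \<noteq> S_vertex \<longrightarrow> v \<noteq> N_vertex \<longrightarrow> vertex_changes M v = 2"
    "\<forall>f\<in>inner_faces M. B.white_changes f = 2"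
    using bal unfolding B.balanced_def by blast+
  have succ_in: "succ M d \<in> v" if "d \<in> v" "v = vertex_of M e" for d v e
    using that by (simp flip: M.vertex_eq_iff)
  have "{d\<in>S_vertex. vertex_change M d} = {}"
    using S succ_in by blast
  moreover have "{d\<in>N_vertex. vertex_change M d} = {}"
    using N succ_in by blast
  moreover have "{d\<in>outer_face M. d \<in> W \<and> two_step_change M d} = {}"
  proof -
    have "d \<notin> outs M \<and> next_in_face M (next_in_face M d) \<notin> outs M" if d: "d \<in> outer_face M" "d \<in> W" for d
    proof -
      have "next_in_face M (next_in_face M d) \<in> outer_face M"
        using d(1) B.face_next_in[OF M.outer_face_in] by blast
      moreover have "next_in_face M (next_in_face M d) \<in> W"
        using d(2) W_sub by (simp add: subset_iff)
      ultimately show ?thesis using d W0 by blast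
    qed
    then show ?thesis by blast
  qed
  ultimately have "\<forall>x\<in>darts T. vertex_of T x \<in> outer_vertices T \<longrightarrow> lateral T x"
    unfolding no_outer_extremal_iff[OF o] by (metis card.empty)
  moreover have "outer_face T \<subseteq> outs T"
    unfolding outer_face_outs_iff using S N M.in_vertex succ_in by blast
  moreover have "\<forall>v\<in>inner_vertices T. card {d\<in>v. extremal T d} = 2"
    unfolding inner_extremal_iff[OF o] using inner by blast
  moreover have "\<exists>L. face_bicoloring T L \<and> (\<forall>d\<in>darts T. extremal T d \<longrightarrow> face_of T d \<in> L)"
    using light_bicoloring extremal_light[OF o] by blast
  moreover have "eulerian_triangulation T" by (rule eulerian_T[OF B.planar_axioms o])
  ultimately show ?thesis
    unfolding polyhedral_orientation_def using orientation_iff o by blast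
qed

section \<open>The vertex coloring and the counts\<close>

lemma vertex_r_eq: "d \<in> darts M \<Longrightarrow> vertex_of T (r (next_in_face M d)) = vertex_of T (r d)"
  using T.vertex_succ[of "r d"] by simp

text \<open>The colors spread from the outer triangle: a triangle adjacent to a colored one has a
  single color left for its third vertex.\<close>

lemma tricoloring_colors:
  assumes pl: "planar M" and C: "vertex_tricoloring T C" and d: "d \<in> darts M"
  shows "C (vertex_of T (p d)) = (if d \<in> W then Red else Blue)" "C (vertex_of T (r d)) = Green"
proof -
  interpret P: planar M by (rule pl)
  have neq: "C (vertex_of T x) \<noteq> C (vertex_of T (opp T x))" if "x \<in> darts T" for x
    using C that by (simp add: vertex_tricoloring_def)
  have vq: "vertex_of T (q e) = vertex_of T (p e)" if "e \<in> darts M" for e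
    using vertex_p vertex_q that by simp
  have vs: "vertex_of T (p (succ M e)) = vertex_of T (p e)" if "e \<in> darts M" for e
    using vertex_p that by simp
  have vn: "vertex_of T (p (next_in_face M e)) = vertex_of T (p (opp M e))" if "e \<in> darts M" for e
    using vertex_p that by simp
  have pp: "C (vertex_of T (p e)) \<noteq> C (vertex_of T (p (opp M e)))" if "e \<in> darts M" for e
    using neq[of "p e"] that by simp
  have qr': "C (vertex_of T (p e)) \<noteq> C (vertex_of T (r e))" if "e \<in> darts M" for e
    using neq[of "q e"] that vq by simp
  have tri: "C (vertex_of T (p (opp M e))) \<noteq> C (vertex_of T (r e))" if "e \<in> darts M" for e
    using qr'[of "next_in_face M e"] that vn vertex_r_eq by simp
  let ?P = "\<lambda>d. C (vertex_of T (p d)) = (if d \<in> W then Red else Blue) \<and> C (vertex_of T (r d)) = Green"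
  have base: "?P (next_in_face M (root M))"
  proof -
    have "next_in_face M (root M) \<in> W" using inv_next_W[of "next_in_face M (root M)"] root_W by simp
    moreover have "C (vertex_of T (root T)) = Red" "C (vertex_of T (next_in_face T (root T))) = Green"
      using C by (simp_all add: vertex_tricoloring_def root_vertex_def)
    ultimately show ?thesis unfolding root_T using vq vertex_r_eq by simp
  qed
  have opp: "?P (opp M e)" if e: "e \<in> darts M" "?P e" for e
  proof -
    have "C (vertex_of T (p (opp M e))) = (if opp M e \<in> W then Red else Blue)"
      using tri[OF e(1)] pp[OF e(1)] e W_opp
      by (cases "C (vertex_of T (p (opp M e)))") (auto split: if_splits)
    moreover have "C (vertex_of T (r (opp M e))) = Green"
    proof -
      have "C (vertex_of T (r (opp M e))) \<noteq> C (vertex_of T (p (opp M e)))"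
        "C (vertex_of T (r (opp M e))) \<noteq> C (vertex_of T (p e))"
        using qr'[of "opp M e"] tri[of "opp M e"] e(1) by auto
      then show ?thesis using calculation e W_opp
        by (cases "C (vertex_of T (r (opp M e)))") (auto split: if_splits)
    qed
    ultimately show ?thesis by blast
  qed
  have succ: "?P (succ M e)" if e: "e \<in> darts M" "?P e" for e
  proof -
    \<comment> \<open>\<open>?i\<close> precedes \<open>e\<close> on its face, so it has the same
      green vertex; this and the known color at \<open>e\<close> determine the color at the origin
      of \<open>?i\<close>. Crossing the edge then gives \<open>succ M e\<close>.\<close>
    let ?i = "opp M (succ M e)"
    have i: "?i \<in> darts M" "next_in_face M ?i = e" using e by auto
    have ri: "C (vertex_of T (r ?i)) = Green" using vertex_r_eq[OF i(1)] i(2) e by simp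
    have ci: "C (vertex_of T (p (succ M e))) = (if succ M e \<in> W then Red else Blue)"
      using e vs W_succ by simp
    have "C (vertex_of T (p ?i)) \<noteq> Green" using qr'[OF i(1)] ri by simp
    moreover have "C (vertex_of T (p ?i)) \<noteq> C (vertex_of T (p (succ M e)))" using pp[of "succ M e"] e by simp
    ultimately have "C (vertex_of T (p ?i)) = (if ?i \<in> W then Red else Blue)"
      using ci W_opp[of "succ M e"] e by (cases "C (vertex_of T (p ?i))") (auto split: if_splits)
    then have "?P ?i" using ri by blast
    from opp[OF i(1) this] show ?thesis by simp
  qed
  have "?P d" using d M.f.in_iff[THEN iffD2, OF M.root_in]
    by (induction rule: P.dart_induct) (use base succ opp in blast)+
  then show "C (vertex_of T (p d)) = (if d \<in> W then Red else Blue)" "C (vertex_of T (r d)) = Green"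
    by blast+
qed

lemma tricoloring_exists:
  assumes "bicolored_map M W" shows "\<exists>C. vertex_tricoloring T C"
proof -
  interpret B: bicolored_map M W by (rule assms)
  define C where "C = (\<lambda>v. if v \<in> (`) r ` faces M then Green
      else if v \<in> rb_vertex ` {v\<in>vertices M. v \<subseteq> W} then Red else Blue)"
  have cp: "C (vertex_of T (p d)) = (if d \<in> W then Red else Blue)" if d: "d \<in> darts M" for d
  proof -
    have "vertex_of T (p d) \<notin> (`) r ` faces M"
      unfolding vertex_p[OF d] using rb_neq_green M.vertex_in[OF d] by blast
    moreover have "vertex_of T (p d) \<in> rb_vertex ` {v\<in>vertices M. v \<subseteq> W} \<longleftrightarrow> d \<in> W"
    proof
      assume "vertex_of T (p d) \<in> rb_vertex ` {v\<in>vertices M. v \<subseteq> W}"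
      then have "vertex_of M d \<subseteq> W"
        unfolding vertex_p[OF d] using inj_onD[OF inj_rb] M.vertex_in[OF d] by auto
      then show "d \<in> W" using B.vertex_subset_W[OF d] by blast
    qed (use vertex_p[OF d] B.vertex_subset_W[OF d] d in auto)
    ultimately show ?thesis by (simp add: C_def)
  qed
  have cr: "C (vertex_of T (r d)) = Green" if "d \<in> darts M" for d
    using that by (simp add: C_def vertex_r)
  have vq: "vertex_of T (q e) = vertex_of T (p e)" if "e \<in> darts M" for e
    using vertex_p vertex_q that by simp
  have "C (vertex_of T x) \<noteq> C (vertex_of T (opp T x))" if "x \<in> darts T" for x
    using that by (cases rule: dart_cases) (auto simp: cp cr vq W_opp)
  moreover have nW: "next_in_face M (root M) \<in> W"
    using inv_next_W[of "next_in_face M (root M)"] root_W by simp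
  ultimately show ?thesis
    by (intro exI[of _ C])
      (simp add: vertex_tricoloring_def root_vertex_def root_T vq cp cr root_W del: T.vertex_next)
qed

text \<open>Each color occurs once on the outer triangle: red at the sink, blue at the source, green
  in the outer face.\<close>

lemma color_counts:
  assumes bm: "bicolored_map M W" and C: "vertex_tricoloring T C"
  shows "card {v\<in>inner_vertices T. C v = Red} + 1 = card (bicolored_map.white_vertices M W)"
    "card {v\<in>inner_vertices T. C v = Blue} + 1 = card (vertices M - bicolored_map.white_vertices M W)"
    "card {v\<in>inner_vertices T. C v = Green} = card (inner_faces M)"
    "card (inner_vertices T) + 2 = card (vertices M) + card (inner_faces M)"
proof -
  interpret B: bicolored_map M W by (rule bm)
  have Sv: "S_vertex \<in> vertices M" "S_vertex \<notin> B.white_vertices" using root_W by auto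
  have Nv: "N_vertex \<in> vertices M" "N_vertex \<in> B.white_vertices" using root_W by (auto simp del: M.vertex_next)
  have rb: "C (rb_vertex v) = (if v \<in> B.white_vertices then Red else Blue)" if "v \<in> vertices M" for v
  proof -
    obtain d where d: "d \<in> darts M" "v = vertex_of M d" using \<open>v \<in> vertices M\<close> by (auto simp: vertices_def)
    then show ?thesis
      using tricoloring_colors(1)[OF B.planar_axioms C d(1)] by (simp add: vertex_p)
  qed
  have gr: "C (r ` f) = Green" if "f \<in> inner_faces M" for f
  proof -
    obtain d where d: "d \<in> darts M" "f = face_of M d"
      using \<open>f \<in> inner_faces M\<close> by (auto simp: inner_faces_def faces_def)
    then show ?thesis
      using tricoloring_colors(2)[OF B.planar_axioms C d(1)] by (simp add: vertex_r)
  qed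
  have inj: "inj_on rb_vertex A" if "A \<subseteq> vertices M" for A using inj_rb that by (rule inj_on_subset)
  have Wv: "B.white_vertices \<subseteq> vertices M" by (auto simp: B.white_vertices_def)
  have fin: "finite B.white_vertices" "finite (vertices M)" "finite (inner_faces M)"
    using Wv M.finite_vertices M.finite_faces finite_subset by (auto simp: inner_faces_def)
  have "{v\<in>inner_vertices T. C v = Red} = rb_vertex ` (B.white_vertices - {N_vertex})"
    unfolding inner_vertices_T using rb gr Sv Nv Wv by (auto simp del: M.vertex_next split: if_splits)
  then show "card {v\<in>inner_vertices T. C v = Red} + 1 = card B.white_vertices"
    using Nv Wv fin card_Suc_Diff1[OF fin(1) Nv(2)] by (simp add: card_image inj subset_iff del: M.vertex_next)
  have "{v\<in>inner_vertices T. C v = Blue} = rb_vertex ` ((vertices M - B.white_vertices) - {S_vertex})"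
    unfolding inner_vertices_T using rb gr Sv Nv Wv by (auto simp del: M.vertex_next split: if_splits)
  moreover have "card ((vertices M - B.white_vertices) - {S_vertex}) + 1 = card (vertices M - B.white_vertices)"
    using card_Suc_Diff1[of "vertices M - B.white_vertices" S_vertex] Sv fin by simp
  ultimately show "card {v\<in>inner_vertices T. C v = Blue} + 1 = card (vertices M - B.white_vertices)"
    by (simp add: card_image inj subset_iff)
  have "{v\<in>inner_vertices T. C v = Green} = (`) r ` inner_faces M"
    unfolding inner_vertices_T using rb gr by (auto split: if_splits)
  moreover have injg: "inj_on ((`) r) (inner_faces M)"
    using inj_green by (rule inj_on_subset) (auto simp: inner_faces_def)
  ultimately show "card {v\<in>inner_vertices T. C v = Green} = card (inner_faces M)"
    by (simp add: card_image)
  have "rb_vertex ` (vertices M - {S_vertex, N_vertex}) \<inter> (`) r ` inner_faces M = {}"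
    using rb_neq_green unfolding inner_faces_def by blast
  then have "card (inner_vertices T) = card (vertices M - {S_vertex, N_vertex}) + card (inner_faces M)"
    unfolding inner_vertices_T using fin injg
    by (simp add: card_Un_disjoint card_image inj del: M.vertex_next)
  moreover have "card (vertices M - {S_vertex, N_vertex}) + 2 = card (vertices M)"
  proof -
    have two: "card {S_vertex, N_vertex} = 2" using B.source_neq_sink by (simp del: M.vertex_next)
    moreover have "{S_vertex, N_vertex} \<subseteq> vertices M" using Sv Nv by blast
    ultimately show ?thesis using fin(2)
      by (metis card_Diff_subset card_mono finite.emptyI finite_insert le_add_diff_inverse2)
  qed
  ultimately show "card (inner_vertices T) + 2 = card (vertices M) + card (inner_faces M)" by linarith
qed

end

lemma (in comb_map) card_inner_faces: "card (faces m) = card (inner_faces m) + 1"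
  using outer_face_in finite_faces card_Suc_Diff1 by (fastforce simp: inner_faces_def)

lemma polyhedral_imp_P_admissible:
  fixes M T :: "nat oriented_map"
  assumes star: "star_pair M T p q r W" and n: "n \<ge> 1" "a + b + c = n"
    and T: "T \<in> polyhedral_orientations n a b c"
  shows "M \<in> P_admissible_orientations (n + 1) (a + 1) (b + 1) c"
proof -
  interpret star_pair M T p q r W by (rule star)
  have poly: "polyhedral_orientation T" and cn: "card (inner_vertices T) = n"
    using T by (auto simp: polyhedral_orientations_def)
  obtain C where C: "vertex_tricoloring T C"
    "card {v \<in> inner_vertices T. C v = Red} = a" "card {v \<in> inner_vertices T. C v = Blue} = b"
    "card {v \<in> inner_vertices T. C v = Green} = c"
    using T by (auto simp: polyhedral_orientations_def)
  note bm = polyhedral_imp_balanced[OF poly]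
  interpret B: bicolored_map M W by (rule bm(1))
  note counts = color_counts[OF bm(1) C(1), unfolded C(2-4) cn]
  \<comment> \<open>Vertices and inner faces together number \<open>n + 2\<close>; the outer face
    adds 1, and Euler's formula subtracts 2.\<close>
  have E: "card (edges M) = n + 1" using counts(3,4) B.euler M.card_inner_faces by linarith
  then have "P_admissible M B.white_vertices" using bm(2) n by (intro B.balanced_imp_P_admissible) auto
  then show ?thesis unfolding P_admissible_orientations_def using counts E by auto
qed

lemma balanced_imp_polyhedral_orientations:
  fixes M T :: "nat oriented_map"
  assumes star: "star_pair M T p q r W" and bm: "bicolored_map M W" "bicolored_map.balanced M W"
    and n: "a + b + c = n" and counts: "card (bicolored_map.white_vertices M W) = a + 1"
      "card (vertices M - bicolored_map.white_vertices M W) = b + 1" "card (inner_faces M) = c"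
  shows "T \<in> polyhedral_orientations n a b c"
proof -
  interpret star_pair M T p q r W by (rule star)
  interpret B: bicolored_map M W by (rule bm(1))
  obtain C where C: "vertex_tricoloring T C" using tricoloring_exists[OF bm(1)] by blast
  note cc = color_counts[OF bm(1) C, unfolded counts]
  have "B.white_vertices \<subseteq> vertices M" by (auto simp: B.white_vertices_def)
  then have "card (vertices M) = card B.white_vertices + card (vertices M - B.white_vertices)"
    using M.finite_vertices by (metis card_Diff_subset card_mono finite_subset le_add_diff_inverse)
  then have "card (inner_vertices T) = n" using cc(4) n counts by linarith
  then show ?thesis
    unfolding polyhedral_orientations_def using balanced_imp_polyhedral[OF bm] C cc by auto
qed

section \<open>Existence of the two constructions\<close>

lemma permutes_if_inj:
  assumes "finite S" "inj_on f S" "f ` S \<subseteq> S" "\<And>x. x \<notin> S \<Longrightarrow> f x = x"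
  shows "f permutes S"
  using assms by (intro bij_imp_permutes) (simp_all add: bij_betw_def endo_inj_surj)

lemma star_triangulation_exists:
  fixes M :: "nat oriented_map"
  assumes "bicolored_map M W"
  shows "\<exists>T p q r. star_pair M (T :: nat oriented_map) p q r W"
proof -
  interpret B: bicolored_map M W by (rule assms)
  \<comment> \<open>Residues modulo 3 keep the three copies of the darts apart without leaving the
    natural numbers.\<close>
  define p q r :: "nat \<Rightarrow> nat" where "p = (\<lambda>d. 3 * d)" and "q = (\<lambda>d. 3 * d + 1)" and "r = (\<lambda>d. 3 * d + 2)"
  have neq [simp]: "p d \<noteq> q e" "q e \<noteq> p d" "p d \<noteq> r e" "r e \<noteq> p d" "q d \<noteq> r e" "r e \<noteq> q d" for d e
    unfolding p_def q_def r_def by presburger+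
  have inj [simp]: "p d = p e \<longleftrightarrow> d = e" "q d = q e \<longleftrightarrow> d = e" "r d = r e \<longleftrightarrow> d = e" for d e
    unfolding p_def q_def r_def by presburger+
  have div3 [simp]: "p d div 3 = d" "q d div 3 = d" "r d div 3 = d" for d
    unfolding p_def q_def r_def by presburger+
  define D where "D = darts M"
  define S where "S = p ` D \<union> q ` D \<union> r ` D"
  define sT where "sT = (\<lambda>x. let d = x div 3 in if x \<notin> S then x else if x = p d then q d
      else if x = q d then p (succ M d) else r (next_in_face M d))"
  define oT where "oT = (\<lambda>x. let d = x div 3 in if x \<notin> S then x else if x = p d then p (opp M d)
      else if x = q d then r d else q d)"
  define OT where "OT = p ` outs M \<union> q ` {d\<in>D. if d \<in> W then d \<notin> outs M else succ M d \<notin> outs M}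
      \<union> r ` {d\<in>D. \<not> (if d \<in> W then d \<notin> outs M else succ M d \<notin> outs M)}"
  define T :: "nat oriented_map" where
    "T = \<lparr>darts = S, succ = sT, opp = oT, root = q (next_in_face M (root M)), outs = OT\<rparr>"
  have T [simp]: "darts T = S" "succ T = sT" "opp T = oT" "root T = q (next_in_face M (root M))" "outs T = OT"
    by (simp_all add: T_def)
  have in_S [simp]: "p d \<in> S \<longleftrightarrow> d \<in> D" "q d \<in> S \<longleftrightarrow> d \<in> D" "r d \<in> S \<longleftrightarrow> d \<in> D" for d
    by (auto simp: S_def)
  have sT [simp]: "sT (p d) = q d" "sT (q d) = p (succ M d)" "sT (r d) = r (next_in_face M d)" if "d \<in> D" for d
    using that by (simp_all add: sT_def)
  have oT [simp]: "oT (p d) = p (opp M d)" "oT (q d) = r d" "oT (r d) = q d" if "d \<in> D" for d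
    using that by (simp_all add: oT_def)
  have closed [simp]: "succ M d \<in> D" "opp M d \<in> D" "next_in_face M d \<in> D" if "d \<in> D" for d
    using that by (simp_all add: D_def)
  have finS: "finite S" by (simp add: S_def D_def B.finite_darts)
  have caseS: "x \<in> S \<Longrightarrow> (\<And>d. d \<in> D \<Longrightarrow> P (p d)) \<Longrightarrow> (\<And>d. d \<in> D \<Longrightarrow> P (q d))
      \<Longrightarrow> (\<And>d. d \<in> D \<Longrightarrow> P (r d)) \<Longrightarrow> P x" for x P
    unfolding S_def by blast
  have "sT permutes S"
  proof (rule permutes_if_inj[OF finS])
    show "inj_on sT S" unfolding inj_on_def S_def by auto
    show "sT ` S \<subseteq> S" unfolding S_def by auto
    show "sT x = x" if "x \<notin> S" for x using that by (simp add: sT_def)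
  qed
  moreover have "oT permutes S"
  proof (rule permutes_if_inj[OF finS])
    show "inj_on oT S" unfolding inj_on_def S_def by auto
    show "oT ` S \<subseteq> S" unfolding S_def by auto
    show "oT x = x" if "x \<notin> S" for x using that by (simp add: oT_def)
  qed
  moreover have "oT x \<noteq> x \<and> oT (oT x) = x" if "x \<in> S" for x
    using that by (rule caseS) (auto simp: D_def B.opp_neq)
  ultimately have comb: "comb_map T"
    by (intro comb_map.intro) (simp_all add: finS, simp add: D_def)
  have outs_in: "p d \<in> OT \<longleftrightarrow> d \<in> outs M"
    "q d \<in> OT \<longleftrightarrow> d \<in> D \<and> (if d \<in> W then d \<notin> outs M else succ M d \<notin> outs M)"
    "r d \<in> OT \<longleftrightarrow> d \<in> D \<and> \<not> (if d \<in> W then d \<notin> outs M else succ M d \<notin> outs M)" for d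
    unfolding OT_def by auto
  have "star_pair M T p q r W"
  proof (intro star_pair.intro star_pair_axioms.intro)
    show "outs T \<subseteq> darts T" using B.outs_sub by (auto simp: OT_def S_def D_def)
    show "outs M \<subseteq> darts M" by (rule B.outs_sub)
    show "comb_map M" by (rule B.comb_map_axioms)
    show "comb_map T" by (rule comb)
    show "inj_on p (darts M)" "inj_on q (darts M)" "inj_on r (darts M)" by (auto simp: inj_on_def)
    show "p ` darts M \<inter> q ` darts M = {}" "p ` darts M \<inter> r ` darts M = {}"
      "q ` darts M \<inter> r ` darts M = {}" by auto
    show "darts T = p ` darts M \<union> q ` darts M \<union> r ` darts M" by (simp add: S_def D_def)
    show "root T = q (next_in_face M (root M))" by simp
    show "W \<subseteq> darts M" by (rule B.W_darts)
    show "root M \<notin> W" by (rule B.root_black)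
    fix d assume dM: "d \<in> darts M"
    then have d: "d \<in> D" by (simp add: D_def)
    show "succ T (p d) = q d" "succ T (q d) = p (succ M d)" "succ T (r d) = r (next_in_face M d)"
      "opp T (p d) = p (opp M d)" "opp T (q d) = r d" using d by simp_all
    show "succ M d \<in> W \<longleftrightarrow> d \<in> W" "opp M d \<in> W \<longleftrightarrow> d \<notin> W" using dM by simp_all
    show "p d \<in> outs T \<longleftrightarrow> d \<in> outs M" by (simp add: outs_in)
    show "q d \<in> outs T \<longleftrightarrow> (if d \<in> W then d \<notin> outs M else succ M d \<notin> outs M)"
      using d by (simp add: outs_in)
    show "r d \<in> outs T \<longleftrightarrow> q d \<notin> outs T" using d by (simp add: outs_in)
  qed
  then show ?thesis by blast
qed

text \<open>Around a red or blue vertex the green neighbours alternate with those of the other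
  color, so after deleting the edges to green vertices the next dart is found by turning
  twice.\<close>

lemma red_blue_submap_exists:
  fixes T :: "'d oriented_map"
  assumes poly: "polyhedral_orientation T" and tri: "vertex_tricoloring T C"
  shows "\<exists>(M :: 'd oriented_map) p q r W. star_pair M T p q r W"
proof -
  have planar: "planar T" and card3: "\<And>f. f \<in> faces T \<Longrightarrow> card f = 3" and orient: "orientation T"
    using poly by (simp_all add: polyhedral_orientation_def eulerian_triangulation_def
        rooted_triangulation_def rooted_planar_map_iff)
  interpret TP: planar T by (rule planar)
  let ?n = "next_in_face T" and ?s = "succ T" and ?o = "opp T"
  define col where "col = (\<lambda>d. C (vertex_of T d))"
  have n3: "?n (?n (?n d)) = d" if d: "d \<in> darts T" for d
  proof -
    obtain k where k: "(?n ^^ k) d = d" "inj_on (\<lambda>i. (?n ^^ i) d) {..<k}"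
      "orbit ?n d = (\<lambda>i. (?n ^^ i) d) ` {..<k}" using TP.f.orbit_period[of d] by metis
    have "card (orbit ?n d) = 3" using card3[OF TP.face_in[OF d]] by (simp add: face_of_def)
    then have "k = 3" using k(2,3) by (simp add: card_image)
    then show ?thesis using k(1) by (simp add: numeral_3_eq_3)
  qed
  have os: "?o (?s d) = ?n (?n d)" if "d \<in> darts T" for d
    using n3[OF that] TP.opp_succ TP.f.inv_cancel(1) by metis
  have so: "?s d = ?o (?n (?n d))" if "d \<in> darts T" for d
    using os[OF that] TP.opp_opp by metis
  have col_s [simp]: "col (?s d) = col d" for d by (simp add: col_def)
  have col_o [simp]: "col (?o d) = col (?n d)" for d by (simp add: col_def)
  have c1: "col d \<noteq> col (?n d)" if "d \<in> darts T" for d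
    using tri that by (simp add: vertex_tricoloring_def col_def)
  have distinct: "col d \<noteq> col (?n d)" "col (?n d) \<noteq> col (?n (?n d))" "col (?n (?n d)) \<noteq> col d"
    if "d \<in> darts T" for d
    using c1[of d] c1[of "?n d"] c1[of "?n (?n d)"] n3 that by auto
  have col_no: "col (?n (?o d)) = col d" for d by (simp add: col_def)
  have root_col: "col (root T) = Red" "col (?n (root T)) = Green" "col (?n (?n (root T))) = Blue"
    using tri unfolding vertex_tricoloring_def col_def root_vertex_def by blast+

  \<comment> \<open>Lightness in terms of colors: red, green, blue is the cyclic order on the outer
    triangle. It agrees with the given \<open>L\<close>, as both hold at the root and alternate
    across edges.\<close>
  define light where "light = (\<lambda>d. (col d, col (?n d)) \<in> {(Red, Green), (Green, Blue), (Blue, Red)})"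
  have light_n: "light (?n d) \<longleftrightarrow> light d" if "d \<in> darts T" for d
    using distinct[OF that] unfolding light_def
    by (cases "col d"; cases "col (?n d)"; cases "col (?n (?n d))") auto
  have light_o: "light (?o d) \<longleftrightarrow> \<not> light d" if "d \<in> darts T" for d
    using distinct(1)[OF that] unfolding light_def col_no col_o
    by (cases "col d"; cases "col (?n d)") auto
  obtain L where L: "face_bicoloring T L" "\<And>d. d \<in> darts T \<Longrightarrow> extremal T d \<Longrightarrow> face_of T d \<in> L"
    using poly unfolding polyhedral_orientation_def by blast
  have L_light: "face_of T d \<in> L \<longleftrightarrow> light d" if "d \<in> darts T" for d
    using that TP.root_in
  proof (induction rule: TP.dart_induct_face)
    case base
    have "face_of T (root T) \<in> L" using L(1) by (simp add: face_bicoloring_def outer_face_def)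
    then show ?case using root_col by (simp add: light_def)
  next
    case (face x) then show ?case by (simp add: light_n)
  next
    case (opp x)
    have "(face_of T x \<in> L) \<noteq> (face_of T (?o x) \<in> L)"
      using L(1) opp(1) unfolding face_bicoloring_def by blast
    then show ?case using opp light_o by blast
  qed
  have o_outs: "?o d \<in> outs T \<longleftrightarrow> d \<notin> outs T" if "d \<in> darts T" for d
    using orient that unfolding orientation_def by blast
  \<comment> \<open>The corner at \<open>?n d\<close> lies between \<open>?n d\<close> and
    \<open>?o d\<close>. It is dark, hence lateral, so consecutive darts of a dark contour are
    oriented alike.\<close>
  have dark: "?n d \<in> outs T \<longleftrightarrow> d \<in> outs T" if d: "d \<in> darts T" "\<not> light d" for d
  proof -
    have nd: "?n d \<in> darts T" using d by simp
    have "\<not> light (?n d)" using light_n d by simp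
    then have "lateral T (?n d)" using L_light[OF nd] L(2)[OF nd] by blast
    then show ?thesis using o_outs[OF d(1)] by (simp add: lateral_def)
  qed

  define D where "D = {d\<in>darts T. col d \<noteq> Green \<and> col (?n d) \<noteq> Green}"
  have DT: "d \<in> darts T" if "d \<in> D" for d using that by (simp add: D_def)
  have third: "col (?n (?n d)) = Green" if "d \<in> D" for d
    using that distinct[of d] unfolding D_def
    by (cases "col d"; cases "col (?n d)"; cases "col (?n (?n d))") auto
  have col_ns: "col (?n (?s d)) = col (?n (?n d))" if "d \<in> darts T" for d
    using col_o[of "?s d"] os[OF that] by simp
  have ss_D: "?s (?s d) \<in> D" if d: "d \<in> D" for d
  proof -
    have "col (?n (?s (?s d))) = col (?n (?n (?s d)))" using DT[OF d] by (intro col_ns) simp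
    moreover have "col (?n (?n (?s d))) \<noteq> Green"
      using distinct(2)[of "?s d"] col_ns[OF DT[OF d]] third[OF d] DT[OF d] by simp
    ultimately show ?thesis using d by (simp add: D_def)
  qed
  have o_D: "?o d \<in> D" if "d \<in> D" for d
    using that col_no by (simp add: D_def)
  \<comment> \<open>The contour of the outer triangle starts at the red vertex. Its third dart leads
    from the blue vertex back to it and becomes the root, so that the root edge joins source and
    sink.\<close>
  define M :: "'d oriented_map" where
    "M = \<lparr>darts = D, succ = (\<lambda>d. if d \<in> D then ?s (?s d) else d),
       opp = (\<lambda>d. if d \<in> D then ?o d else d), root = ?n (?n (root T)), outs = outs T \<inter> D\<rparr>"
  have M [simp]: "darts M = D" "d \<in> D \<Longrightarrow> succ M d = ?s (?s d)" "d \<in> D \<Longrightarrow> opp M d = ?o d"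
    "d \<notin> D \<Longrightarrow> succ M d = d" "d \<notin> D \<Longrightarrow> opp M d = d"
    "root M = ?n (?n (root T))" "outs M = outs T \<inter> D" for d
    by (simp_all add: M_def)
  have finD: "finite D" using TP.finite_darts by (simp add: D_def)
  have root_D: "?n (?n (root T)) \<in> D"
    using root_col n3[OF TP.root_in] by (simp add: D_def)
  have "succ M permutes D"
  proof (rule permutes_if_inj[OF finD])
    show "inj_on (succ M) D" by (auto simp: inj_on_def)
  qed (use ss_D in auto)
  moreover have "opp M permutes D"
  proof (rule permutes_if_inj[OF finD])
    show "inj_on (opp M) D" by (auto simp: inj_on_def)
  qed (use o_D in auto)
  ultimately have comb: "comb_map M"
    using finD root_D o_D TP.opp_neq DT by (intro comb_map.intro) auto
  then interpret M: comb_map M .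
  have s_next: "?s (next_in_face M d) = ?n d" "next_in_face M d \<in> D" if d: "d \<in> D" for d
  proof -
    show nD: "next_in_face M d \<in> D" using M.f.in_iff[of d] d by simp
    have "succ M (next_in_face M d) = opp M d" by (rule M.succ_next_in_face)
    then have "?s (?s (next_in_face M d)) = ?o d" unfolding M(2)[OF nD] M(3)[OF d] .
    then have "?s (?s (next_in_face M d)) = ?s (?n d)" by simp
    then show "?s (next_in_face M d) = ?n d" by (simp only: TP.s.inj_iff)
  qed
  have green_cover: "?n x \<in> D \<and> x = ?o (?s (?n x))" if x: "x \<in> darts T" "col x = Green" for x
    using distinct[OF x(1)] x n3[OF x(1)] os[of "?n x"] by (auto simp: D_def)
  have cover: "darts T = D \<union> ?s ` D \<union> (\<lambda>d. ?o (?s d)) ` D"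
  proof (intro subset_antisym subsetI)
    fix x assume x: "x \<in> darts T"
    consider "x \<in> D" | "col x = Green" | "col (?o x) = Green" using x by (auto simp: D_def)
    then show "x \<in> D \<union> ?s ` D \<union> (\<lambda>d. ?o (?s d)) ` D"
    proof cases
      case 2 then show ?thesis using green_cover[OF x] by blast
    next
      case 3
      have "?n (?o x) \<in> D \<and> ?o x = ?o (?s (?n (?o x)))" by (rule green_cover) (use x 3 in auto)
      then have "?n (?o x) \<in> D" "x = ?s (?n (?o x))" by auto
      then show ?thesis by blast
    qed blast
  qed (use DT in auto)
  define W where "W = {d\<in>D. col d = Red}"
  have W_o: "?o d \<in> W \<longleftrightarrow> d \<notin> W" if d: "d \<in> D" for d
    using d o_D[OF d] distinct(1)[OF DT[OF d]] unfolding W_def D_def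
    by (cases "col d"; cases "col (?n d)") auto
  have col_s_green: "col (?n (?s d)) = Green" if "d \<in> D" for d
    using col_ns[OF DT[OF that]] third[OF that] by simp
  \<comment> \<open>The edge \<open>?s d\<close> takes its direction from a dark triangle. For red
    \<open>d\<close> this is the triangle of \<open>d\<close>, with third dart
    \<open>?o (?s d)\<close>; for blue \<open>d\<close> it is the triangle of \<open>?s d\<close>,
    whose third dart is \<open>?o (?s (?s d))\<close>.\<close>
  have outs_s: "?s d \<in> outs T \<longleftrightarrow> (if d \<in> W then d \<notin> outs T else ?s (?s d) \<notin> outs T)" if d: "d \<in> D" for d
  proof (cases "d \<in> W")
    case True
    then have "\<not> light d" using d distinct(1)[OF DT[OF d]] by (auto simp: light_def W_def D_def)
    then have "?n (?n d) \<in> outs T \<longleftrightarrow> d \<in> outs T"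
      using dark[of d] dark[of "?n d"] light_n[of d] DT[OF d] by simp
    then show ?thesis using True so[OF DT[OF d]] o_outs[of "?n (?n d)"] DT[OF d] by simp
  next
    case False
    then have "col d = Blue" "col (?n d) = Red"
      using d distinct(1)[OF DT[OF d]] unfolding W_def D_def
      by (cases "col d"; cases "col (?n d)"; auto)+
    then have "light d" by (simp add: light_def)
    then have "\<not> light (?s d)"
      using so[OF DT[OF d]] light_o[of "?n (?n d)"] light_n[of d] light_n[of "?n d"] DT[OF d] by simp
    then have "?n (?n (?s d)) \<in> outs T \<longleftrightarrow> ?s d \<in> outs T"
      using dark[of "?s d"] dark[of "?n (?s d)"] light_n[of "?s d"] DT[OF d] by simp
    then show ?thesis using False so[of "?s d"] o_outs[of "?n (?n (?s d))"] DT[OF d] by simp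
  qed
  have "star_pair M T (\<lambda>d. d) ?s (\<lambda>d. ?o (?s d)) W"
  proof (intro star_pair.intro star_pair_axioms.intro)
    show "comb_map M" "comb_map T" by (fact comb, rule TP.comb_map_axioms)
    show "inj_on (\<lambda>d. d) (darts M)" "inj_on ?s (darts M)" "inj_on (\<lambda>d. ?o (?s d)) (darts M)"
      by (auto simp: inj_on_def)
    show "(\<lambda>d. d) ` darts M \<inter> ?s ` darts M = {}"
      using col_s_green by (auto simp: D_def)
    show "(\<lambda>d. d) ` darts M \<inter> (\<lambda>d. ?o (?s d)) ` darts M = {}"
      using col_s_green by (auto simp: D_def)
    show "?s ` darts M \<inter> (\<lambda>d. ?o (?s d)) ` darts M = {}"
    proof -
      have "col x \<noteq> Green" if "x \<in> ?s ` D" for x using that by (auto simp: D_def)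
      moreover have "col x = Green" if "x \<in> (\<lambda>d. ?o (?s d)) ` D" for x using that col_s_green by auto
      ultimately show ?thesis by auto
    qed
    show "darts T = (\<lambda>d. d) ` darts M \<union> ?s ` darts M \<union> (\<lambda>d. ?o (?s d)) ` darts M"
      using cover by simp
    show "root T = ?s (next_in_face M (root M))"
      using s_next(1)[OF root_D] n3 by simp
    show "W \<subseteq> darts M" by (auto simp: W_def)
    show "root M \<notin> W" using root_col by (simp add: W_def)
    show "outs M \<subseteq> darts M" by simp
    show "outs T \<subseteq> darts T" using orient by (simp add: orientation_def)
    fix d assume "d \<in> darts M"
    then have d: "d \<in> D" by simp
    show "?s d = ?s d" "?o (?s d) = ?o (?s d)" by (rule refl)+
    show "?s (?s d) = succ M d" "?o d = opp M d" using d by simp_all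
    show "?s (?o (?s d)) = ?o (?s (next_in_face M d))"
      using s_next(1)[OF d] os[OF DT[OF d]] TP.succ_next_in_face[of "?n d"] by simp
    show "succ M d \<in> W \<longleftrightarrow> d \<in> W" using d ss_D[OF d] by (simp add: W_def)
    show "opp M d \<in> W \<longleftrightarrow> d \<notin> W" using d W_o by simp
    show "d \<in> outs T \<longleftrightarrow> d \<in> outs M" using d by simp
    show "?s d \<in> outs T \<longleftrightarrow> (if d \<in> W then d \<notin> outs M else succ M d \<notin> outs M)"
      using d outs_s[OF d] ss_D[OF d] by simp
    show "?o (?s d) \<in> outs T \<longleftrightarrow> ?s d \<notin> outs T" using o_outs[of "?s d"] DT[OF d] by simp
  qed
  then show ?thesis by blast
qed

section \<open>Isomorphism classes\<close>

lemma image_eq_if_iff: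
  assumes "bij_betw h A B" "S \<subseteq> A" "S' \<subseteq> B" "\<And>x. x \<in> A \<Longrightarrow> h x \<in> S' \<longleftrightarrow> x \<in> S"
  shows "h ` S = S'"
  using assms unfolding bij_betw_def by blast

lemma iff_if_image_eq:
  assumes "inj_on h A" "S \<subseteq> A" "h ` S = S'" "x \<in> A"
  shows "h x \<in> S' \<longleftrightarrow> x \<in> S"
  using assms by (auto dest: inj_onD)

text \<open>In a connected map the root determines the white darts, so \<open>h\<close> respects
  them; they and \<open>outs M\<close> determine the orientation of the added edges.\<close>

lemma map_iso_lift:
  fixes M M' :: "'d oriented_map" and T T' :: "'e oriented_map"
  assumes "star_pair M T p q r W" "star_pair M' T' p' q' r' W'" "planar M" "map_iso M M'"
  shows "map_iso T T'"
proof -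
  interpret A: star_pair M T p q r W by (rule assms)
  interpret B: star_pair M' T' p' q' r' W' by (rule assms)
  interpret P: planar M by (rule assms)
  obtain h where bij: "bij_betw h (darts M) (darts M')"
    and hs: "\<And>d. d \<in> darts M \<Longrightarrow> h (succ M d) = succ M' (h d)"
    and ho: "\<And>d. d \<in> darts M \<Longrightarrow> h (opp M d) = opp M' (h d)"
    and hr: "h (root M) = root M'" and hO: "h ` outs M = outs M'"
    using assms(4) unfolding map_iso_def by blast
  have hD: "h d \<in> darts M'" if "d \<in> darts M" for d using bij that by (auto simp: bij_betw_def)
  have inj: "inj_on h (darts M)" using bij by (simp add: bij_betw_def)
  have hn: "h (next_in_face M d) = next_in_face M' (h d)" if d: "d \<in> darts M" for d
  proof -
    have "succ M' (h (next_in_face M d)) = h (opp M d)" using hs[of "next_in_face M d"] d by simp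
    then have "succ M' (h (next_in_face M d)) = succ M' (next_in_face M' (h d))" using ho d by simp
    then show ?thesis by (simp only: B.M.s.inj_iff)
  qed
  have hW: "h d \<in> W' \<longleftrightarrow> d \<in> W" if "d \<in> darts M" for d
    using that A.M.root_in
    by (induction rule: P.dart_induct)
      (simp_all add: hr A.root_W B.root_W hs ho hD A.W_succ B.W_succ A.W_opp B.W_opp)
  have hout: "h d \<in> outs M' \<longleftrightarrow> d \<in> outs M" if "d \<in> darts M" for d
    by (rule iff_if_image_eq[OF inj A.outs_M_sub hO that])
  define H where "H = (\<lambda>x. if x \<in> p ` darts M then p' (h (inv_into (darts M) p x))
    else if x \<in> q ` darts M then q' (h (inv_into (darts M) q x)) else r' (h (inv_into (darts M) r x)))"
  have Hp [simp]: "H (p d) = p' (h d)" if "d \<in> darts M" for d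
    using that A.inj_p by (simp add: H_def)
  have Hq [simp]: "H (q d) = q' (h d)" if "d \<in> darts M" for d
    using that A.inj_q A.pq by (auto simp: H_def)
  have Hr [simp]: "H (r d) = r' (h d)" if "d \<in> darts M" for d
    using that A.inj_r A.pr A.qr by (auto simp: H_def)
  have heq: "h d = h e \<longleftrightarrow> d = e" if "d \<in> darts M" "e \<in> darts M" for d e
    using inj that by (auto simp: inj_on_def)
  have "inj_on H (darts T)"
    unfolding inj_on_def A.darts_T by (auto simp: hD heq)
  moreover have "H ` darts T = darts T'"
  proof -
    have img: "H ` p ` darts M = p' ` h ` darts M" "H ` q ` darts M = q' ` h ` darts M"
      "H ` r ` darts M = r' ` h ` darts M"
      unfolding image_image by (auto intro!: image_cong)
    then show ?thesis using bij unfolding A.darts_T B.darts_T image_Un img by (simp add: bij_betw_def)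
  qed
  ultimately have Hbij: "bij_betw H (darts T) (darts T')" by (simp add: bij_betw_def)
  have "H (succ T x) = succ T' (H x) \<and> H (opp T x) = opp T' (H x)" if "x \<in> darts T" for x
    using that by (cases rule: A.dart_cases) (simp_all add: hD hs ho hn)
  moreover have "H (root T) = root T'" unfolding A.root_T B.root_T by (simp add: hn hr)
  moreover have "H ` outs T = outs T'"
  proof (rule image_eq_if_iff[OF Hbij A.outs_T_sub B.outs_T_sub])
    fix x assume "x \<in> darts T"
    then show "H x \<in> outs T' \<longleftrightarrow> x \<in> outs T"
      by (cases rule: A.dart_cases) (simp_all add: hD hout hW flip: hs)
  qed
  ultimately show ?thesis unfolding map_iso_def using Hbij by blast
qed

text \<open>The functions \<open>p\<close>, \<open>q\<close>, \<open>r\<close> are arbitrary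
  witnesses, so \<open>H\<close> need not respect them by definition. It does so at the root, which
  is a \<open>q\<close> dart on both sides, and \<open>succ\<close> and \<open>opp\<close> carry
  this through the connected map.\<close>

lemma map_iso_restrict:
  fixes M M' :: "'d oriented_map" and T T' :: "'e oriented_map"
  assumes "star_pair M T p q r W" "star_pair M' T' p' q' r' W'" "planar M" "planar M'" "map_iso T T'"
  shows "map_iso M M'"
proof -
  interpret A: star_pair M T p q r W by (rule assms)
  interpret B: star_pair M' T' p' q' r' W' by (rule assms)
  interpret P: planar M by (rule assms)
  interpret P': planar M' by (rule assms)
  obtain H where bij: "bij_betw H (darts T) (darts T')"
    and Hs: "\<And>d. d \<in> darts T \<Longrightarrow> H (succ T d) = succ T' (H d)"
    and Ho: "\<And>d. d \<in> darts T \<Longrightarrow> H (opp T d) = opp T' (H d)"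
    and Hr: "H (root T) = root T'" and HO: "H ` outs T = outs T'"
    using assms(5) unfolding map_iso_def by blast
  have injH: "inj_on H (darts T)" using bij by (simp add: bij_betw_def)
  \<comment> \<open>\<open>H\<close> takes both halves of the corner of \<open>d\<close> to those of
    the corner of \<open>e\<close>.\<close>
  let ?Q = "\<lambda>d e. e \<in> darts M' \<and> H (p d) = p' e \<and> H (q d) = q' e"
  have start: "?Q (next_in_face M (root M)) (next_in_face M' (root M'))"
  proof -
    let ?d = "next_in_face M (root M)" and ?e = "next_in_face M' (root M')"
    have q: "H (q ?d) = q' ?e" using Hr unfolding A.root_T B.root_T .
    have "succ T' (H (p ?d)) = succ T' (p' ?e)" using Hs[of "p ?d"] q by simp
    then have "H (p ?d) = p' ?e" by (simp only: B.T.s.inj_iff)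
    then show ?thesis using q by simp
  qed
  have Qs: "?Q (succ M d) (succ M' e)" if d: "d \<in> darts M" "?Q d e" for d e
  proof -
    have "H (p (succ M d)) = p' (succ M' e)" using Hs[of "q d"] d by simp
    moreover from this have "H (q (succ M d)) = q' (succ M' e)" using Hs[of "p (succ M d)"] d by simp
    ultimately show ?thesis using d by simp
  qed
  have Qo: "?Q (opp M d) (opp M' e)" if d: "d \<in> darts M" "?Q d e" for d e
  proof -
    have "H (p (opp M d)) = p' (opp M' e)" using Ho[of "p d"] d by simp
    moreover from this have "H (q (opp M d)) = q' (opp M' e)" using Hs[of "p (opp M d)"] d by simp
    ultimately show ?thesis using d by simp
  qed
  have nroot: "next_in_face M (root M) \<in> darts M" "next_in_face M' (root M') \<in> darts M'" by simp_all
  have "\<exists>e. ?Q d e" if "d \<in> darts M" for d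
    using that nroot(1)
  proof (induction rule: P.dart_induct)
    case base show ?case using start by blast
  next
    case (succ d) then show ?case using Qs by blast
  next
    case (opp d) then show ?case using Qo by blast
  qed
  then obtain h where h: "\<And>d. d \<in> darts M \<Longrightarrow> ?Q d (h d)" by metis
  have unique: "h d = e" if "d \<in> darts M" "?Q d e" for d e
    using h[OF that(1)] that B.eq_iffs(1)[of "h d" e] by simp
  have hs: "h (succ M d) = succ M' (h d)" if "d \<in> darts M" for d
    by (rule unique) (use that Qs h in auto)
  have ho: "h (opp M d) = opp M' (h d)" if "d \<in> darts M" for d
    by (rule unique) (use that Qo h in auto)
  have hbase: "h (next_in_face M (root M)) = next_in_face M' (root M')"
    by (rule unique[OF nroot(1) start])
  have hroot: "h (root M) = root M'"
  proof -
    have "succ M' (h (next_in_face M (root M))) = h (opp M (root M))"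
      using hs[OF nroot(1)] by simp
    then have "opp M' (root M') = opp M' (h (root M))" unfolding hbase using ho[of "root M"] by simp
    then show ?thesis by (simp only: B.M.o.inj_iff)
  qed
  have "inj_on h (darts M)"
  proof (rule inj_onI)
    fix d e assume de: "d \<in> darts M" "e \<in> darts M" "h d = h e"
    then have "H (p d) = H (p e)" using h by metis
    then have "p d = p e" using injH de by (auto dest: inj_onD)
    then show "d = e" using de by simp
  qed
  moreover have "h ` darts M = darts M'"
  proof (intro subset_antisym subsetI)
    fix e assume e: "e \<in> darts M'"
    show "e \<in> h ` darts M"
      using e nroot(2)
    proof (induction rule: P'.dart_induct)
      case base then show ?case using hbase nroot(1) by (metis imageI)
    next
      case (succ e)
      then obtain d where "d \<in> darts M" "e = h d" by blast
      then show ?case using hs[of d] by (intro image_eqI[of _ _ "succ M d"]) auto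
    next
      case (opp e)
      then obtain d where "d \<in> darts M" "e = h d" by blast
      then show ?case using ho[of d] by (intro image_eqI[of _ _ "opp M d"]) auto
    qed
  qed (use h in blast)
  ultimately have hbij: "bij_betw h (darts M) (darts M')" by (simp add: bij_betw_def)
  have "h ` outs M = outs M'"
  proof (rule image_eq_if_iff[OF hbij A.outs_M_sub B.outs_M_sub])
    fix d assume d: "d \<in> darts M"
    have "H (p d) \<in> outs T' \<longleftrightarrow> p d \<in> outs T"
      by (rule iff_if_image_eq[OF injH A.outs_T_sub HO]) (use d in simp)
    then show "h d \<in> outs M' \<longleftrightarrow> d \<in> outs M" using h[OF d] d by simp
  qed
  then show ?thesis unfolding map_iso_def using hbij hs ho hroot by blast
qed

section \<open>Isomorphism as an equivalence relation, and quotients\<close>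

lemma map_iso_refl: "map_iso m m"
  unfolding map_iso_def by (rule exI[of _ "\<lambda>d. d"]) (auto simp: bij_betw_def)

lemma map_iso_trans:
  assumes "map_iso m1 m2" "map_iso m2 m3" shows "map_iso m1 m3"
proof -
  obtain h where h: "bij_betw h (darts m1) (darts m2)"
    "\<forall>d\<in>darts m1. h (succ m1 d) = succ m2 (h d) \<and> h (opp m1 d) = opp m2 (h d)"
    "h (root m1) = root m2" "h ` outs m1 = outs m2" using assms(1) unfolding map_iso_def by blast
  obtain k where k: "bij_betw k (darts m2) (darts m3)"
    "\<forall>d\<in>darts m2. k (succ m2 d) = succ m3 (k d) \<and> k (opp m2 d) = opp m3 (k d)"
    "k (root m2) = root m3" "k ` outs m2 = outs m3" using assms(2) unfolding map_iso_def by blast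
  have "h d \<in> darts m2" if "d \<in> darts m1" for d using h(1) that by (auto simp: bij_betw_def)
  then have "\<forall>d\<in>darts m1. (k \<circ> h) (succ m1 d) = succ m3 ((k \<circ> h) d) \<and> (k \<circ> h) (opp m1 d) = opp m3 ((k \<circ> h) d)"
    using h(2) k(2) by simp
  moreover have "(k \<circ> h) ` outs m1 = outs m3" unfolding image_comp[symmetric] h(4) k(4) ..
  moreover have "(k \<circ> h) (root m1) = root m3" using h(3) k(3) by simp
  ultimately show ?thesis unfolding map_iso_def using bij_betw_trans[OF h(1) k(1)] by blast
qed

lemma map_iso_sym:
  assumes iso: "map_iso m m'" and cm: "comb_map m" "outs m \<subseteq> darts m"
  shows "map_iso m' m"
proof -
  interpret comb_map m by (rule cm)
  obtain h where h: "bij_betw h (darts m) (darts m')"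
    "\<And>d. d \<in> darts m \<Longrightarrow> h (succ m d) = succ m' (h d) \<and> h (opp m d) = opp m' (h d)"
    "h (root m) = root m'" "h ` outs m = outs m'" using iso unfolding map_iso_def by blast
  define k where "k = inv_into (darts m) h"
  have inj: "inj_on h (darts m)" and img: "h ` darts m = darts m'" using h(1) by (auto simp: bij_betw_def)
  have kh: "k (h d) = d" if "d \<in> darts m" for d unfolding k_def using inj that by simp
  have "k (succ m' e) = succ m (k e) \<and> k (opp m' e) = opp m (k e)" if "e \<in> darts m'" for e
  proof -
    from that have "e \<in> h ` darts m" unfolding img .
    then obtain d where d: "d \<in> darts m" "e = h d" by (elim imageE)
    have "k (h (succ m d)) = succ m d" "k (h (opp m d)) = opp m d" using d by (auto intro: kh)
    then show ?thesis using d h(2)[of d] kh by simp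
  qed
  moreover have "k (root m') = root m" using kh[of "root m"] h(3) by simp
  moreover have "k ` outs m' = outs m"
  proof -
    have "(\<lambda>x. k (h x)) ` outs m = (\<lambda>x. x) ` outs m" by (rule image_cong) (use kh cm(2) in auto)
    then show ?thesis unfolding h(4)[symmetric] image_image by simp
  qed
  moreover have "bij_betw k (darts m') (darts m)" unfolding k_def by (rule bij_betw_inv_into) (rule h(1))
  ultimately show ?thesis unfolding map_iso_def by blast
qed

lemma equiv_map_iso:
  assumes "\<And>m. m \<in> A \<Longrightarrow> comb_map m \<and> outs m \<subseteq> darts m"
  shows "equiv A {(m, m'). m \<in> A \<and> m' \<in> A \<and> map_iso m m'}"
proof (rule equivI)
  show "{(m, m'). m \<in> A \<and> m' \<in> A \<and> map_iso m m'} \<subseteq> A \<times> A" by auto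
  show "refl_on A {(m, m'). m \<in> A \<and> m' \<in> A \<and> map_iso m m'}"
    by (auto simp: refl_on_def map_iso_refl)
  show "sym {(m, m'). m \<in> A \<and> m' \<in> A \<and> map_iso m m'}"
    using assms map_iso_sym by (intro symI) blast
  show "trans {(m, m'). m \<in> A \<and> m' \<in> A \<and> map_iso m m'}"
    by (rule transI) (auto intro: map_iso_trans)
qed

text \<open>Any choice of partners induces a map of classes: \<open>compat\<close> makes it well
  defined and injective, and totality on the side of \<open>B\<close> makes it surjective. This
  avoids having to fix the names of the darts of the partner.\<close>

lemma quotients_bij_betw:
  assumes rA: "equiv A rA" and rB: "equiv B rB"
    and total: "\<And>x. x \<in> A \<Longrightarrow> \<exists>y\<in>B. R x y" "\<And>y. y \<in> B \<Longrightarrow> \<exists>x\<in>A. R x y"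
    and compat: "\<And>x x' y y'. x \<in> A \<Longrightarrow> x' \<in> A \<Longrightarrow> y \<in> B \<Longrightarrow> y' \<in> B \<Longrightarrow> R x y \<Longrightarrow> R x' y' \<Longrightarrow>
      (x, x') \<in> rA \<longleftrightarrow> (y, y') \<in> rB"
  shows "\<exists>\<Phi>. bij_betw \<Phi> (A // rA) (B // rB)"
proof -
  obtain f where f: "\<And>x. x \<in> A \<Longrightarrow> f x \<in> B \<and> R x (f x)" using total(1) by metis
  have ff: "(f x, f x') \<in> rB \<longleftrightarrow> (x, x') \<in> rA" if "x \<in> A" "x' \<in> A" for x x'
    using compat[of x x' "f x" "f x'"] f that by blast
  define \<Phi> where "\<Phi> = (\<lambda>X. rB `` (f ` X))"
  have \<Phi>: "\<Phi> (rA `` {x}) = rB `` {f x}" if x: "x \<in> A" for x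
  proof -
    have sub: "rA `` {x} \<subseteq> A" using rA by (auto simp: equiv_def)
    have "rB `` {f y} = rB `` {f x}" if "y \<in> rA `` {x}" for y
      using ff[OF x, of y] that sub equiv_class_eq[OF rB] by blast
    moreover have "x \<in> rA `` {x}" using equiv_class_self[OF rA x] .
    ultimately show ?thesis unfolding \<Phi>_def by blast
  qed
  have "inj_on \<Phi> (A // rA)"
  proof (rule inj_onI)
    fix X Y assume "X \<in> A // rA" "Y \<in> A // rA" and eq: "\<Phi> X = \<Phi> Y"
    then obtain x y where xy: "x \<in> A" "X = rA `` {x}" "y \<in> A" "Y = rA `` {y}" by (auto elim!: quotientE)
    then have "rB `` {f x} = rB `` {f y}" using eq \<Phi> by simp
    then have "(f x, f y) \<in> rB" using eq_equiv_class[OF _ rB] f xy by blast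
    then show "X = Y" using ff xy equiv_class_eq[OF rA] by blast
  qed
  moreover have "\<Phi> ` (A // rA) = B // rB"
  proof (intro subset_antisym subsetI)
    fix Y assume "Y \<in> \<Phi> ` (A // rA)"
    then obtain x where "x \<in> A" "Y = \<Phi> (rA `` {x})" by (auto elim!: quotientE)
    then show "Y \<in> B // rB" using \<Phi> f by (simp add: quotientI)
  next
    fix Y assume "Y \<in> B // rB"
    then obtain y where y: "y \<in> B" "Y = rB `` {y}" by (auto elim!: quotientE)
    obtain x where x: "x \<in> A" "R x y" using total(2)[OF y(1)] by blast
    have "(x, x) \<in> rA" using rA x by (auto simp: equiv_def refl_on_def)
    then have "(f x, y) \<in> rB" using compat[of x x "f x" y] x y f by blast
    then have "Y = \<Phi> (rA `` {x})" using y \<Phi>[OF x(1)] equiv_class_eq[OF rB] by simp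
    then show "Y \<in> \<Phi> ` (A // rA)" using x(1) by (auto intro: quotientI)
  qed
  ultimately show ?thesis unfolding bij_betw_def by blast
qed

lemma P_admissible_comb_map:
  assumes "P_admissible m WV" shows "planar m" "comb_map m" "outs m \<subseteq> darts m"
proof -
  interpret bicolored_map m "{d\<in>darts m. vertex_of m d \<in> WV}"
    by (rule P_admissible_imp_balanced(1)[OF assms])
  show "planar m" "comb_map m" "outs m \<subseteq> darts m" by (rule planar_axioms comb_map_axioms outs_sub)+
qed

theorem proposition7:
  fixes n a b c :: nat
  assumes "n \<ge> 1" and "a + b + c = n"
  shows "\<exists>\<Phi>. bij_betw \<Phi>
           (iso_classes (polyhedral_orientations n a b c))
           (iso_classes (P_admissible_orientations (n + 1) (a + 1) (b + 1) c))"
  unfolding iso_classes_def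
proof (rule quotients_bij_betw[where R = "\<lambda>T M. \<exists>p q r W. star_pair M T p q r W"])
  let ?A = "polyhedral_orientations n a b c"
  let ?B = "P_admissible_orientations (n + 1) (a + 1) (b + 1) c"
  have B: "planar M" "comb_map M" "outs M \<subseteq> darts M" if "M \<in> ?B" for M
    using that P_admissible_comb_map unfolding P_admissible_orientations_def by blast+
  show "equiv ?A {(m, m'). m \<in> ?A \<and> m' \<in> ?A \<and> map_iso m m'}"
    by (rule equiv_map_iso)
      (auto simp: polyhedral_orientations_def polyhedral_orientation_def eulerian_triangulation_def
        rooted_triangulation_def rooted_planar_map_iff planar_def orientation_def)
  show "equiv ?B {(m, m'). m \<in> ?B \<and> m' \<in> ?B \<and> map_iso m m'}"
    using B by (intro equiv_map_iso) blast
  show "\<exists>M\<in>?B. \<exists>p q r W. star_pair M T p q r W" if T: "T \<in> ?A" for T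
  proof -
    obtain C where "polyhedral_orientation T" "vertex_tricoloring T C"
      using T unfolding polyhedral_orientations_def by blast
    then obtain M p q r W where star: "star_pair (M :: nat oriented_map) T p q r W"
      using red_blue_submap_exists by blast
    then show ?thesis using polyhedral_imp_P_admissible[OF star assms T] by blast
  qed
  show "\<exists>T\<in>?A. \<exists>p q r W. star_pair M T p q r W" if M: "M \<in> ?B" for M
  proof -
    obtain WV where WV: "P_admissible M WV" "card WV = a + 1" "card (vertices M - WV) = b + 1"
      "card (inner_faces M) = c"
      using M unfolding P_admissible_orientations_def by blast
    note bal = P_admissible_imp_balanced[OF WV(1)]
    obtain T p q r where star: "star_pair M (T :: nat oriented_map) p q r {d\<in>darts M. vertex_of M d \<in> WV}"
      using star_triangulation_exists[OF bal(1)] by blast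
    have "T \<in> ?A"
      using WV by (intro balanced_imp_polyhedral_orientations[OF star bal(1,2) assms(2)]) (simp_all add: bal(3))
    then show ?thesis using star by blast
  qed
  fix T T' M M'
  assume mem: "T \<in> ?A" "T' \<in> ?A" "M \<in> ?B" "M' \<in> ?B"
    and "\<exists>p q r W. star_pair M T p q r W" "\<exists>p q r W. star_pair M' T' p q r W"
  then obtain p q r W p' q' r' W' where star: "star_pair M T p q r W" "star_pair M' T' p' q' r' W'" by blast
  have "map_iso T T' \<longleftrightarrow> map_iso M M'"
    using map_iso_lift[OF star B(1)[OF mem(3)]] map_iso_restrict[OF star B(1)[OF mem(3)] B(1)[OF mem(4)]]
    by blast
  then show "(T, T') \<in> {(m, m'). m \<in> ?A \<and> m' \<in> ?A \<and> map_iso m m'} \<longleftrightarrow>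
      (M, M') \<in> {(m, m'). m \<in> ?B \<and> m' \<in> ?B \<and> map_iso m m'}"
    using mem by simp
qed

end
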